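(* As $n\to\infty$, $$\frac{\chi_n(t)}{n}\to \sum_{k=0}^\infty (-1)^k\psi_{k+1,k,k}(t,t)\quad\text{almost surely in } D[0,\infty),$$ where $D[0,\infty)$ is equipped with the uniform topology; that is, for every $0<T<\infty$, almost surely $$\sup_{0\le t\le T}\left|\frac{\chi_n(t)}{n}-\sum_{k=0}^\infty(-1)^k\psi_{k+1,k,k}(t,t)\right|\to 0\quad\text{as } n\to\infty.$$
   Context: Let $\mathbb{N}_0=\{0,1,2,\dots\}$, $d\ge 1$, let $m$ be Lebesgue measure on $\mathbb{R}^d$, and let $B(x,r)$ be the closed Euclidean ball with center $x$ and radius $r\ge0$. Let $f$ be a probability density on $\mathbb{R}^d$ that is bounded almost everywhere, $\|f\|_\infty:=\inf\{a\in\mathbb{R}: m(f^{-1}(a,\infty))=0\}<\infty$. For $n\in\{1,2,\dots\}$ let $\mathcal{P}_n$ be a Poisson point process on $\mathbb{R}^d$ with intensity measure $A\mapsto n\int_A f(x)\,dx$; all $\mathcal{P}_n$ are defined on a common probability space. Let $s_n>0$ be a non-random sequence with $s_n\to0$ and $ns_n^d\to1$ as $n\to\infty$ (critical regime), and set $r_n(t):=s_nt$ for $t\ge0$. For $k\in\mathbb{N}_0$, $t\ge0$ and $\mathcal{Y}=\{y_0,\dots,y_k\}\subset\mathbb{R}^d$ let $$h_t^k(\mathcal{Y})=h_t^k(y_0,\dots,y_k):=\prod_{0\le i<j\le k}\mathbf{1}\{B(y_i,t)\cap B(y_j,t)\neq\emptyset\}$$ (the indicator that $\mathcal{Y}$ forms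 a $k$-simplex of the Vietoris-Rips complex with radius parameter $t$; $h_t^0\equiv1$). The Euler characteristic process is $$\chi_n(t):=\sum_{k=0}^\infty(-1)^k\sum_{\mathcal{Y}\subset\mathcal{P}_n,\ |\mathcal{Y}|=k+1}h^k_{r_n(t)}(\mathcal{Y}),\qquad t\ge0,$$ which is almost surely a finite sum. For $k_1,k_2\in\mathbb{N}_0$, $1\le j\le\min\{k_1,k_2\}+1$ and $t,s\ge0$ define $$\psi_{j,k_1,k_2}(t,s):=\frac{\int_{\mathbb{R}^d}f(x)^{k_1+k_2+2-j}dx}{j!(k_1+1-j)!(k_2+1-j)!}\int_{(\mathbb{R}^d)^{k_1+k_2+1-j}}h_t^{k_1}(0,y_1,\dots,y_{k_1})\,h_s^{k_2}(0,y_1,\dots,y_{j-1},y_{k_1+1},\dots,y_{k_1+k_2+1-j})\,d\mathbf{y},$$ where the inner integral is $1$ if $k_1=k_2=0$ (so $\psi_{1,0,0}(t,s)=\int f=1$). $D[0,\infty)$ is the space of real-valued right continuous functions on $[0,\infty)$ with left limits. *)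

theory Defs
  imports "HOL-Probability.Probability"
begin

text \<open>Number of points of \<open>Y\<close> lying in \<open>A\<close>, with value \<open>\<infinity>\<close> if there are infinitely many.\<close>

definition point_count :: "'a set \<Rightarrow> 'a set \<Rightarrow> ennreal" where
  "point_count Y A = emeasure (count_space UNIV) (Y \<inter> A)"

text \<open>
  A (simple) point process is a random locally finite set of points all of whose Borel counts are
  random variables. The Poisson probabilities are written out because \<^const>\<open>poisson_pmf\<close> requires
  a strictly positive rate, whereas sets of intensity \<open>0\<close> have to be covered too (with \<open>0 ^ 0 = 1\<close>
  the formula then says that there are almost surely no points).
\<close>

definition poisson_point_process ::
    "'w measure \<Rightarrow> 'a::euclidean_space measure \<Rightarrow> ('w \<Rightarrow> 'a set) \<Rightarrow> bool" where
  "poisson_point_process M \<Lambda> P \<longleftrightarrow>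
     prob_space M \<and> sets \<Lambda> = sets borel \<and>
     (\<forall>\<omega>\<in>space M. \<forall>B. bounded B \<longrightarrow> finite (P \<omega> \<inter> B)) \<and>
     (\<forall>A\<in>sets borel. (\<lambda>\<omega>. point_count (P \<omega>) A) \<in> borel_measurable M) \<and>
     (\<forall>A\<in>sets borel. emeasure \<Lambda> A < \<infinity> \<longrightarrow>
        (\<forall>k::nat. measure M {\<omega>\<in>space M. point_count (P \<omega>) A = of_nat k}
                   = exp (- measure \<Lambda> A) * measure \<Lambda> A ^ k / fact k)) \<and>
     (\<forall>A\<in>sets borel. emeasure \<Lambda> A = \<infinity> \<longrightarrow> (AE \<omega> in M. point_count (P \<omega>) A = \<infinity>)) \<and>
     (\<forall>(l::nat) A. (\<forall>i<l. A i \<in> sets borel) \<and> disjoint_family_on A {..<l} \<longrightarrow>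
        prob_space.indep_vars M (\<lambda>_. borel) (\<lambda>i \<omega>. point_count (P \<omega>) (A i)) {..<l})"

text \<open>The tuple \<open>(y\<^sub>0, \<dots>, y\<^sub>k)\<close> is encoded as a function on \<open>nat\<close>, read only on \<open>{..k}\<close>.\<close>

definition rips :: "nat \<Rightarrow> real \<Rightarrow> (nat \<Rightarrow> 'a::euclidean_space) \<Rightarrow> real" where
  "rips k t y = (\<Prod>(i, j)\<in>{(i, j). i < j \<and> j \<le> k}. of_bool (cball (y i) t \<inter> cball (y j) t \<noteq> {}))"

text \<open>
  The value at a set of \<open>k + 1\<close> points; by symmetry the enumeration is irrelevant, see
  \<open>rips_set_eq\<close> below.
\<close>

definition rips_set :: "nat \<Rightarrow> real \<Rightarrow> 'a::euclidean_space set \<Rightarrow> real" where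
  "rips_set k t Y = rips k t (SOME y. bij_betw y {..k} Y)"

text \<open>
  For finite \<open>P\<close> only finitely many terms of the series are nonzero. Note that
  \<open>card Y = k + 1\<close> forces \<open>Y\<close> to be finite.
\<close>

definition euler_char :: "real \<Rightarrow> 'a::euclidean_space set \<Rightarrow> real" where
  "euler_char t P = (\<Sum>k. (-1) ^ k * (\<Sum>Y | Y \<subseteq> P \<and> card Y = k + 1. rips_set k t Y))"

text \<open>
  Only meaningful for \<open>1 \<le> j \<le> min k1 k2 + 1\<close>, where no subtraction truncates. The integration
  variable is \<open>(y\<^sub>1, \<dots>, y\<^sub>N)\<close> with \<open>N = k1 + k2 + 1 - j\<close>. The second factor has the arguments
  \<open>0, y\<^sub>1, \<dots>, y\<^sub>j\<^sub>-\<^sub>1, y\<^sub>k\<^sub>1\<^sub>+\<^sub>1, \<dots>, y\<^sub>N\<close>, so its argument number \<open>i \<ge> j\<close> is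
  \<open>y\<close> at index \<open>k1 + 1 + (i - j)\<close>. If \<open>N = 0\<close>, which happens only for \<open>k1 = k2 = 0\<close>, the product
  measure is a unit point mass and the inner integral is \<open>1\<close>.
\<close>

definition psi ::
    "('a::euclidean_space \<Rightarrow> real) \<Rightarrow> nat \<Rightarrow> nat \<Rightarrow> nat \<Rightarrow> real \<Rightarrow> real \<Rightarrow> real" where
  "psi f j k1 k2 t s =
     (\<integral>x. f x ^ (k1 + k2 + 2 - j) \<partial>lborel) / (fact j * fact (k1 + 1 - j) * fact (k2 + 1 - j)) *
     (\<integral>(y :: nat \<Rightarrow> 'a). rips k1 t (\<lambda>i. if i = 0 then 0 else y i) *
           rips k2 s (\<lambda>i. if i = 0 then 0 else if i < j then y i else y (k1 + 1 + (i - j)))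
        \<partial>(\<Pi>\<^sub>M i\<in>{1..k1 + k2 + 1 - j}. lborel))"

lemma rips_eq_of_bool:
  "rips k t y = of_bool (\<forall>i\<le>k. \<forall>j\<le>k. i \<noteq> j \<longrightarrow> cball (y i) t \<inter> cball (y j) t \<noteq> {})"
proof -
  let ?I = "{(i, j). i < j \<and> j \<le> k}"
  have fin: "finite ?I"
    by (rule finite_subset[of _ "{..k} \<times> {..k}"]) auto
  have "rips k t y = of_bool (\<forall>(i, j)\<in>?I. cball (y i) t \<inter> cball (y j) t \<noteq> {})"
  proof (cases "\<forall>(i, j)\<in>?I. cball (y i) t \<inter> cball (y j) t \<noteq> {}")
    case True
    then have "rips k t y = 1"
      unfolding rips_def by (intro prod.neutral) auto
    with True show ?thesis by simp
  next
    case False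
    then have "rips k t y = 0"
      unfolding rips_def by (intro prod_zero[OF fin]) fastforce
    with False show ?thesis by simp
  qed
  also have "(\<forall>(i, j)\<in>?I. cball (y i) t \<inter> cball (y j) t \<noteq> {}) \<longleftrightarrow>
      (\<forall>i\<le>k. \<forall>j\<le>k. i \<noteq> j \<longrightarrow> cball (y i) t \<inter> cball (y j) t \<noteq> {})"
    (is "?L \<longleftrightarrow> ?R")
  proof
    assume L: ?L
    show ?R
    proof (intro allI impI)
      fix i j assume "i \<le> k" "j \<le> k" "i \<noteq> j"
      then consider "(i, j) \<in> ?I" | "(j, i) \<in> ?I" by fastforce
      then show "cball (y i) t \<inter> cball (y j) t \<noteq> {}"
        using L by cases (fastforce simp: Int_commute)+
    qed
  qed auto
  finally show ?thesis .
qed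

lemma rips_set_eq:
  assumes "bij_betw y {..k} Y"
  shows "rips_set k t Y = rips k t y"
proof -
  have *: "rips k t z = of_bool (\<forall>a\<in>Y. \<forall>b\<in>Y. a \<noteq> b \<longrightarrow> cball a t \<inter> cball b t \<noteq> {})"
    if z: "bij_betw z {..k} Y" for z
  proof -
    have "Y = z ` {..k}" and inj: "inj_on z {..k}"
      using z by (auto simp: bij_betw_def)
    then show ?thesis
      unfolding rips_eq_of_bool by (auto simp: inj_on_eq_iff[OF inj])
  qed
  show ?thesis
    unfolding rips_set_def using *[OF someI[of "\<lambda>y. bij_betw y {..k} Y", OF assms]] *[OF assms]
    by simp
qed

end

(*
  Discretise space by a grid of side e * s n. Replacing points by their cells turns the k-simplex
  counts into functions of independent Poisson cell counts, and enlarging or shrinking t by a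
  multiple of e sandwiches the true count between two such discretised counts.
  For a discretised count the mean is explicit (factorial moments of Poisson variables) and divided
  by n it converges because averages of f over small cells converge to f in L1. It also is a sum
  of local contributions that are independent within each of finitely many colour classes of cells,
  so its centred fourth moment is O(n^2), which is summable after division by n^4; no assumption on
  the joint law of the processes for different n is needed.
  Finally e -> 0. The even- and odd-dimensional parts of the Euler characteristic are separately
  monotone in t with continuous limits, so pointwise convergence is uniform.
*)
theory Submission
  imports Defs
begin

section \<open>Moments of Poisson variables and of centred sums\<close>

text \<open>Second moments would not do: the variance of a discretised count is of order
  \<open>n\<close>, so Chebyshev's bound is of order \<open>1 / n\<close>, which is not summable.
  Since the alternating sum is not monotone in the adjacency relation, everything before the last
  step treats clique sums with weights in [0, 1] that depend on the clique size only. The number of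
  cliques at a cell is exponential in the number of nearby points, so its moments come from
  exponential moments of Poisson counts. The bounds have the form \<open>exp x - 1\<close>, linear
  in the intensity \<open>x\<close> as long as \<open>x\<close> is bounded; summed over cells they
  cost the total intensity, at most \<open>n\<close>, and not the number of cells, which is
  uncontrolled. In the mean, translation invariance of the discretised relation separates an
  integral of a power of \<open>f\<close> from a number of lattice configurations. That number,
  rescaled, is the volume of a union of boxes, squeezed between volumes of Rips configurations at
  nearby radii. These volumes are homogeneous in the radius, so the limit is a power series, and its
  continuity closes the squeeze.\<close>

definition poisson_var :: "'w measure \<Rightarrow> ('w \<Rightarrow> nat) \<Rightarrow> real \<Rightarrow> bool" where
  "poisson_var M N \<mu> \<longleftrightarrow> N \<in> measurable M (count_space UNIV) \<and> 0 \<le> \<mu> \<and>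
     (\<forall>k. measure M {\<omega>\<in>space M. N \<omega> = k} = exp (- \<mu>) * \<mu> ^ k / fact k)"

context prob_space
begin

lemma nn_integral_poisson_var:
  fixes g :: "nat \<Rightarrow> real"
  assumes N: "poisson_var M N \<mu>" and g: "\<And>k. 0 \<le> g k"
    and s: "(\<lambda>k. g k * (exp (- \<mu>) * \<mu> ^ k / fact k)) sums c"
  shows "(\<integral>\<^sup>+\<omega>. ennreal (g (N \<omega>)) \<partial>M) = ennreal c"
proof -
  have [measurable]: "N \<in> measurable M (count_space UNIV)"
    using N by (simp add: poisson_var_def)
  have "\<mu> \<ge> 0" using N by (simp add: poisson_var_def)
  have "(\<integral>\<^sup>+\<omega>. ennreal (g (N \<omega>)) \<partial>M) =
      (\<integral>\<^sup>+\<omega>. (\<Sum>k. ennreal (g k) * indicator {\<omega>\<in>space M. N \<omega> = k} \<omega>) \<partial>M)"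
  proof (intro nn_integral_cong)
    fix \<omega> assume w: "\<omega> \<in> space M"
    have "(\<Sum>k. ennreal (g k) * indicator {\<omega>\<in>space M. N \<omega> = k} \<omega>) =
      (\<Sum>k\<in>{N \<omega>}. ennreal (g k) * indicator {\<omega>\<in>space M. N \<omega> = k} \<omega>)"
      by (intro suminf_finite) auto
    then show "ennreal (g (N \<omega>)) = (\<Sum>k. ennreal (g k) * indicator {\<omega>\<in>space M. N \<omega> = k} \<omega>)"
      using w by simp
  qed
  also have "\<dots> = (\<Sum>k. \<integral>\<^sup>+\<omega>. ennreal (g k) * indicator {\<omega>\<in>space M. N \<omega> = k} \<omega> \<partial>M)"
    by (intro nn_integral_suminf) measurable
  also have "\<dots> = (\<Sum>k. ennreal (g k) * emeasure M {\<omega>\<in>space M. N \<omega> = k})"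
    by (intro suminf_cong nn_integral_cmult_indicator) measurable
  also have "\<dots> = (\<Sum>k. ennreal (g k * (exp (- \<mu>) * \<mu> ^ k / fact k)))"
    using N g by (intro suminf_cong) (simp add: emeasure_eq_measure poisson_var_def ennreal_mult'[symmetric])
  also have "\<dots> = ennreal c"
    using s g \<open>\<mu> \<ge> 0\<close> by (intro suminf_ennreal_eq) auto
  finally show ?thesis .
qed

lemma poisson_exponential_moment:
  assumes N: "poisson_var M N \<mu>" and c: "0 \<le> c"
  shows "(\<integral>\<^sup>+\<omega>. ennreal (c ^ N \<omega>) \<partial>M) = ennreal (exp ((c - 1) * \<mu>))"
proof (rule nn_integral_poisson_var[OF N])
  have "(\<lambda>k. exp (-\<mu>) * ((c * \<mu>) ^ k /\<^sub>R fact k)) sums (exp (- \<mu>) * exp (c * \<mu>))"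
    by (intro sums_mult exp_converges)
  then show "(\<lambda>k. c ^ k * (exp (- \<mu>) * \<mu> ^ k / fact k)) sums exp ((c - 1) * \<mu>)"
    by (simp add: exp_add[symmetric] algebra_simps power_mult_distrib divide_inverse)
qed (use c in simp)

text \<open>The falling factorial counts injections of \<open>m\<close> indices into
  \<open>N\<close> points. Its clean moment is what turns the mean of a clique count into a plain
  product of rates.\<close>

lemma poisson_factorial_moment:
  assumes N: "poisson_var M N \<mu>"
  shows "(\<integral>\<^sup>+\<omega>. ennreal (real ((N \<omega> choose m) * fact m)) \<partial>M) = ennreal (\<mu> ^ m)"
proof (rule nn_integral_poisson_var[OF N])
  have "(\<lambda>k. exp (-\<mu>) * \<mu> ^ m * (\<mu> ^ k /\<^sub>R fact k)) sums (exp (- \<mu>) * \<mu> ^ m * exp \<mu>)"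
    by (intro sums_mult exp_converges)
  moreover have "exp (- \<mu>) * \<mu> ^ m * exp \<mu> = \<mu> ^ m"
    by (simp add: exp_minus)
  ultimately have *: "(\<lambda>k. exp (-\<mu>) * \<mu> ^ m * (\<mu> ^ k /\<^sub>R fact k)) sums (\<mu> ^ m)"
    by simp
  let ?g = "\<lambda>k. real ((k choose m) * fact m) * (exp (- \<mu>) * \<mu> ^ k / fact k)"
  \<comment> \<open>After the shift the falling factorial reduces \<open>1 / fact (k + m)\<close> to
    \<open>1 / fact k\<close>; the first \<open>m\<close> terms of the series vanish.\<close>
  have "?g (k + m) = exp (-\<mu>) * \<mu> ^ m * (\<mu> ^ k /\<^sub>R fact k)" for k
    using binomial_fact_lemma[of m "k + m"]
    by (simp add: binomial_fact power_add divide_simps)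
  then have "(\<lambda>k. ?g (k + m)) sums (\<mu> ^ m)" using * by simp
  then have "?g sums (\<mu> ^ m + (\<Sum>k<m. ?g k))"
    by (subst (asm) sums_iff_shift) simp
  moreover have "(\<Sum>k<m. ?g k) = 0" by (intro sum.neutral) (auto simp: binomial_eq_0)
  ultimately show "?g sums \<mu> ^ m" by simp
qed simp

text \<open>When one variable is added, every mixed term containing a first power has mean zero by
  independence and centring. The surviving mixed term is a product of second moments, which is why
  the second moment is carried through the induction.\<close>

lemma sum_centred_moments:
  fixes X :: "'i \<Rightarrow> 'a \<Rightarrow> real"
  assumes "finite I" and "indep_vars (\<lambda>_. borel) X I"
    and "\<And>i. i \<in> I \<Longrightarrow> integrable M (\<lambda>\<omega>. X i \<omega> ^ 4)"
    and "\<And>i. i \<in> I \<Longrightarrow> expectation (X i) = 0"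
  shows "integrable M (\<lambda>\<omega>. (\<Sum>i\<in>I. X i \<omega>) ^ 4) \<and>
    expectation (\<lambda>\<omega>. (\<Sum>i\<in>I. X i \<omega>) ^ 2) = (\<Sum>i\<in>I. expectation (\<lambda>\<omega>. X i \<omega> ^ 2)) \<and>
    expectation (\<lambda>\<omega>. (\<Sum>i\<in>I. X i \<omega>) ^ 4) \<le>
      (\<Sum>i\<in>I. expectation (\<lambda>\<omega>. X i \<omega> ^ 4)) + 3 * (\<Sum>i\<in>I. expectation (\<lambda>\<omega>. X i \<omega> ^ 2)) ^ 2"
  using assms
proof (induction I rule: finite_induct)
  case empty
  then show ?case by simp
next
  case (insert a I)
  define S where "S = (\<lambda>\<omega>. \<Sum>i\<in>I. X i \<omega>)"
  have indI: "indep_vars (\<lambda>_. borel) X I"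
    using insert.prems(1) by (rule indep_vars_subset) auto
  have IH: "integrable M (\<lambda>\<omega>. S \<omega> ^ 4)"
    "expectation (\<lambda>\<omega>. S \<omega> ^ 2) = (\<Sum>i\<in>I. expectation (\<lambda>\<omega>. X i \<omega> ^ 2))"
    "expectation (\<lambda>\<omega>. S \<omega> ^ 4) \<le>
      (\<Sum>i\<in>I. expectation (\<lambda>\<omega>. X i \<omega> ^ 4)) + 3 * (\<Sum>i\<in>I. expectation (\<lambda>\<omega>. X i \<omega> ^ 2)) ^ 2"
    using insert.IH[OF indI] insert.prems by (auto simp: S_def)
  have ind: "indep_var borel (X a) borel S"
    unfolding S_def using insert by (intro indep_vars_sum) auto
  have indp: "indep_var borel (\<lambda>\<omega>. X a \<omega> ^ p) borel (\<lambda>\<omega>. S \<omega> ^ q)" for p q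
    using indep_var_compose[OF ind, of "\<lambda>x. x ^ p" borel "\<lambda>x. x ^ q" borel] by (simp add: comp_def)
  have rv: "X i \<in> borel_measurable M" if "i \<in> insert a I" for i
    using insert.prems(1) that by (auto simp: indep_vars_def)
  have S[measurable]: "S \<in> borel_measurable M" and Xa[measurable]: "X a \<in> borel_measurable M"
    unfolding S_def using rv by auto
  have int: "integrable M (\<lambda>\<omega>. Y \<omega> ^ p)"
    if "integrable M (\<lambda>\<omega>. Y \<omega> ^ 4)" "Y \<in> borel_measurable M" "p \<le> 4" for p and Y :: "'a \<Rightarrow> real"
  proof (rule Bochner_Integration.integrable_bound)
    show "integrable M (\<lambda>\<omega>. 1 + Y \<omega> ^ 4)" using that by simp
    have "\<bar>y\<bar> ^ p \<le> 1 + \<bar>y\<bar> ^ 4" for y :: real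
    proof (cases "\<bar>y\<bar> \<le> 1")
      case True
      then have "\<bar>y\<bar> ^ p \<le> 1" by (intro power_le_one) auto
      then show ?thesis by (smt (verit) zero_le_power abs_ge_zero)
    next
      case False
      then have "\<bar>y\<bar> ^ p \<le> \<bar>y\<bar> ^ 4" using that by (intro power_increasing) auto
      then show ?thesis by simp
    qed
    then show "AE \<omega> in M. norm (Y \<omega> ^ p) \<le> norm (1 + Y \<omega> ^ 4)"
      by (intro AE_I2) (simp add: power_abs)
  qed (use that in measurable)
  have intX: "integrable M (\<lambda>\<omega>. X a \<omega> ^ p)" if "p \<le> 4" for p
    using int[OF insert.prems(2)[OF insertI1] Xa that] .
  have intS: "integrable M (\<lambda>\<omega>. S \<omega> ^ p)" if "p \<le> 4" for p
    using int[OF IH(1) S that] .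
  have intXS: "integrable M (\<lambda>\<omega>. X a \<omega> ^ p * S \<omega> ^ q)" if "p \<le> 4" "q \<le> 4" for p q
    using indep_var_integrable[OF indp intX intS] that by auto
  have eXS: "expectation (\<lambda>\<omega>. X a \<omega> ^ p * S \<omega> ^ q) =
      expectation (\<lambda>\<omega>. X a \<omega> ^ p) * expectation (\<lambda>\<omega>. S \<omega> ^ q)" if "p \<le> 4" "q \<le> 4" for p q
    using indep_var_lebesgue_integral[OF indp intX intS] that by auto
  \<comment> \<open>Zeroth powers are kept so that every term of both expansions is an instance of
    \<open>intXS\<close> and \<open>eXS\<close>.\<close>
  have ints: "integrable M (\<lambda>\<omega>. X a \<omega> ^ 2 * S \<omega> ^ 0)" "integrable M (\<lambda>\<omega>. X a \<omega> ^ 1 * S \<omega> ^ 1)"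
    "integrable M (\<lambda>\<omega>. X a \<omega> ^ 0 * S \<omega> ^ 2)" "integrable M (\<lambda>\<omega>. X a \<omega> ^ 4 * S \<omega> ^ 0)"
    "integrable M (\<lambda>\<omega>. X a \<omega> ^ 3 * S \<omega> ^ 1)" "integrable M (\<lambda>\<omega>. X a \<omega> ^ 2 * S \<omega> ^ 2)"
    "integrable M (\<lambda>\<omega>. X a \<omega> ^ 1 * S \<omega> ^ 3)" "integrable M (\<lambda>\<omega>. X a \<omega> ^ 0 * S \<omega> ^ 4)"
    by (intro intXS; simp)+
  have eX: "expectation (X a) = 0" using insert.prems(3) by simp
  have eS: "expectation S = 0"
  proof -
    have "integrable M (X i)" if "i \<in> I" for i
      using int[of "X i" 1] insert.prems(2)[of i] rv[of i] that by simp
    then show ?thesis unfolding S_def using insert.prems(3) by simp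
  qed
  have sq: "(\<lambda>\<omega>. (\<Sum>i\<in>insert a I. X i \<omega>) ^ 2) =
      (\<lambda>\<omega>. X a \<omega> ^ 2 * S \<omega> ^ 0 + 2 * (X a \<omega> ^ 1 * S \<omega> ^ 1) + X a \<omega> ^ 0 * S \<omega> ^ 2)"
    using insert.hyps by (auto simp: S_def power2_eq_square algebra_simps)
  have qu: "(\<lambda>\<omega>. (\<Sum>i\<in>insert a I. X i \<omega>) ^ 4) =
      (\<lambda>\<omega>. X a \<omega> ^ 4 * S \<omega> ^ 0 + 4 * (X a \<omega> ^ 3 * S \<omega> ^ 1) + 6 * (X a \<omega> ^ 2 * S \<omega> ^ 2)
        + 4 * (X a \<omega> ^ 1 * S \<omega> ^ 3) + X a \<omega> ^ 0 * S \<omega> ^ 4)"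
    using insert.hyps by (auto simp: S_def eval_nat_numeral algebra_simps)
  have "integrable M (\<lambda>\<omega>. (\<Sum>i\<in>insert a I. X i \<omega>) ^ 4)"
    unfolding qu by (intro Bochner_Integration.integrable_add integrable_mult_right intXS) auto
  moreover have E2: "expectation (\<lambda>\<omega>. (\<Sum>i\<in>insert a I. X i \<omega>) ^ 2) =
      expectation (\<lambda>\<omega>. X a \<omega> ^ 2) + expectation (\<lambda>\<omega>. S \<omega> ^ 2)"
  proof -
    have "expectation (\<lambda>\<omega>. (\<Sum>i\<in>insert a I. X i \<omega>) ^ 2) =
      expectation (\<lambda>\<omega>. X a \<omega> ^ 2 * S \<omega> ^ 0) + 2 * expectation (\<lambda>\<omega>. X a \<omega> ^ 1 * S \<omega> ^ 1)
        + expectation (\<lambda>\<omega>. X a \<omega> ^ 0 * S \<omega> ^ 2)"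
      unfolding sq
      by (simp only: Bochner_Integration.integral_add Bochner_Integration.integral_mult_right_zero
          Bochner_Integration.integrable_add integrable_mult_right ints)
    then show ?thesis by (subst (asm) (1 2 3) eXS) (auto simp: eX eS prob_space)
  qed
  moreover have E4: "expectation (\<lambda>\<omega>. (\<Sum>i\<in>insert a I. X i \<omega>) ^ 4) =
      expectation (\<lambda>\<omega>. X a \<omega> ^ 4) + 6 * (expectation (\<lambda>\<omega>. X a \<omega> ^ 2) * expectation (\<lambda>\<omega>. S \<omega> ^ 2))
       + expectation (\<lambda>\<omega>. S \<omega> ^ 4)"
  proof -
    have "expectation (\<lambda>\<omega>. (\<Sum>i\<in>insert a I. X i \<omega>) ^ 4) =
      expectation (\<lambda>\<omega>. X a \<omega> ^ 4 * S \<omega> ^ 0) + 4 * expectation (\<lambda>\<omega>. X a \<omega> ^ 3 * S \<omega> ^ 1)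
        + 6 * expectation (\<lambda>\<omega>. X a \<omega> ^ 2 * S \<omega> ^ 2) + 4 * expectation (\<lambda>\<omega>. X a \<omega> ^ 1 * S \<omega> ^ 3)
        + expectation (\<lambda>\<omega>. X a \<omega> ^ 0 * S \<omega> ^ 4)"
      unfolding qu
      by (simp only: Bochner_Integration.integral_add Bochner_Integration.integral_mult_right_zero
          Bochner_Integration.integrable_add integrable_mult_right ints)
    then show ?thesis by (subst (asm) (1 2 3 4 5) eXS) (auto simp: eX eS prob_space)
  qed
  moreover have "expectation (\<lambda>\<omega>. (\<Sum>i\<in>insert a I. X i \<omega>) ^ 4) \<le>
      (\<Sum>i\<in>insert a I. expectation (\<lambda>\<omega>. X i \<omega> ^ 4))
        + 3 * (\<Sum>i\<in>insert a I. expectation (\<lambda>\<omega>. X i \<omega> ^ 2)) ^ 2"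
  proof -
    define x where "x = expectation (\<lambda>\<omega>. X a \<omega> ^ 2)"
    define v where "v = (\<Sum>i\<in>I. expectation (\<lambda>\<omega>. X i \<omega> ^ 2))"
    \<comment> \<open>The constant 3 is half the binomial coefficient 6: the mixed term is then the
      cross term of \<open>3 * (x + v) ^ 2\<close>.\<close>
    have "6 * (x * v) + 3 * v ^ 2 \<le> 3 * (x + v) ^ 2"
      by (simp add: power2_eq_square algebra_simps)
    then show ?thesis
      using IH(3) unfolding E4 unfolding IH(2) sum.insert[OF insert.hyps] x_def[symmetric] v_def[symmetric]
      by linarith
  qed
  ultimately show ?case
    using IH(2) by (simp add: sum.insert[OF insert.hyps])
qed

text \<open>The fourth powers of the quotients have means at most \<open>C / n ^ 2\<close>. Their
  sum over \<open>n\<close> has finite mean, so it is almost surely finite and its terms tend to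
  zero.\<close>

lemma AE_tendsto_zero_of_fourth_moment:
  fixes Y :: "nat \<Rightarrow> 'a \<Rightarrow> real"
  assumes Y: "\<And>n. n \<ge> n0 \<Longrightarrow> Y n \<in> borel_measurable M"
    and b: "\<And>n. n \<ge> n0 \<Longrightarrow> (\<integral>\<^sup>+\<omega>. ennreal (Y n \<omega> ^ 4) \<partial>M) \<le> ennreal (C * real n ^ 2)"
    and C: "0 \<le> C"
  shows "AE \<omega> in M. (\<lambda>n. Y n \<omega> / real n) \<longlonglongrightarrow> 0"
proof -
  \<comment> \<open>The index 0 and those below \<open>n0\<close>, where nothing is known about
    \<open>Y n\<close>, are set to zero to get a series over all \<open>n\<close>.\<close>
  define Z where "Z n \<omega> = (if n \<ge> max n0 1 then (Y n \<omega> / real n) ^ 4 else 0)" for n \<omega>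
  have Z[measurable]: "Z n \<in> borel_measurable M" for n
  proof (cases "n \<ge> max n0 1")
    case True
    then have "Y n \<in> borel_measurable M" using Y by auto
    then show ?thesis using True unfolding Z_def by simp
  next
    case False
    then show ?thesis unfolding Z_def by (auto simp del: max.bounded_iff)
  qed
  have Zb: "(\<integral>\<^sup>+\<omega>. ennreal (Z n \<omega>) \<partial>M) \<le> ennreal (C * (inverse (real n)) ^ 2)" for n
  proof (cases "n \<ge> max n0 1")
    case True
    then have n: "n \<ge> n0" "real n > 0" by auto
    have "(\<integral>\<^sup>+\<omega>. ennreal (Z n \<omega>) \<partial>M) = (\<integral>\<^sup>+\<omega>. ennreal ((inverse (real n)) ^ 4) * ennreal (Y n \<omega> ^ 4) \<partial>M)"
      using True by (intro nn_integral_cong)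
        (simp add: Z_def divide_inverse power_mult_distrib ennreal_mult'[symmetric] mult.commute)
    also have "\<dots> = ennreal ((inverse (real n)) ^ 4) * (\<integral>\<^sup>+\<omega>. ennreal (Y n \<omega> ^ 4) \<partial>M)"
      using Y[OF n(1)] by (intro nn_integral_cmult) measurable
    also have "\<dots> \<le> ennreal ((inverse (real n)) ^ 4) * ennreal (C * real n ^ 2)"
      by (intro mult_left_mono b n) auto
    also have "\<dots> = ennreal (C * (inverse (real n)) ^ 2)"
      using n by (subst ennreal_mult'[symmetric]) (auto simp: field_simps eval_nat_numeral)
    finally show ?thesis .
  qed (auto simp: Z_def simp del: max.bounded_iff)
  have "(\<integral>\<^sup>+\<omega>. (\<Sum>n. ennreal (Z n \<omega>)) \<partial>M) = (\<Sum>n. \<integral>\<^sup>+\<omega>. ennreal (Z n \<omega>) \<partial>M)"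
    by (intro nn_integral_suminf) measurable
  also have "\<dots> \<le> (\<Sum>n. ennreal (C * (inverse (real n)) ^ 2))"
    by (intro suminf_le Zb) auto
  also have "\<dots> < \<infinity>"
  proof -
    have "summable (\<lambda>n. C * (inverse (real n)) ^ 2)"
      using inverse_power_summable[of 2, where 'a=real]
      by (intro summable_mult) (auto simp: power_inverse)
    then show ?thesis
      using C by (subst suminf_ennreal2) (auto simp: top.not_eq_extremum)
  qed
  finally have "AE \<omega> in M. (\<Sum>n. ennreal (Z n \<omega>)) \<noteq> \<infinity>"
    by (intro nn_integral_noteq_infinite) (auto simp: top.not_eq_extremum)
  then show ?thesis
  proof eventually_elim
    case (elim \<omega>)
    have Zp: "Z n \<omega> \<ge> 0" for n by (simp add: Z_def)
    then have "summable (\<lambda>n. Z n \<omega>)" using elim by (intro summable_suminf_not_top) (auto simp: top.not_eq_extremum)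
    then have "(\<lambda>n. Z n \<omega>) \<longlonglongrightarrow> 0" by (rule summable_LIMSEQ_zero)
    then have "(\<lambda>n. root 4 (Z n \<omega>)) \<longlonglongrightarrow> root 4 0" by (intro tendsto_intros)
    moreover have "\<forall>\<^sub>F n in sequentially. root 4 (Z n \<omega>) = \<bar>Y n \<omega> / real n\<bar>"
      using eventually_ge_at_top[of "max n0 1"]
    proof eventually_elim
      case (elim n)
      have "root 4 ((Y n \<omega> / real n) ^ 4) = \<bar>Y n \<omega> / real n\<bar>"
        using real_root_power_cancel[of 4 "\<bar>Y n \<omega> / real n\<bar>"] by (simp only: power_even_abs_numeral even_numeral)
      then show ?case using elim unfolding Z_def by (auto simp del: max.bounded_iff)
    qed
    ultimately have "(\<lambda>n. \<bar>Y n \<omega> / real n\<bar>) \<longlonglongrightarrow> 0"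
      by (subst (asm) filterlim_cong[OF refl refl]) auto
    then show ?case by (rule tendsto_rabs_zero_cancel)
  qed
qed

end

section \<open>Clique sums\<close>

abbreviation tuple_pairwise :: "('a \<Rightarrow> 'a \<Rightarrow> bool) \<Rightarrow> nat \<Rightarrow> (nat \<Rightarrow> 'a) \<Rightarrow> bool" where
  "tuple_pairwise R k y \<equiv> \<forall>i\<le>k. \<forall>j\<le>k. i \<noteq> j \<longrightarrow> R (y i) (y j)"

abbreviation cliques_of_card :: "('a \<Rightarrow> 'a \<Rightarrow> bool) \<Rightarrow> 'a set \<Rightarrow> nat \<Rightarrow> 'a set set" where
  "cliques_of_card R S n \<equiv> {Y. Y \<subseteq> S \<and> card Y = n \<and> pairwise R Y}"

abbreviation num_injections :: "nat \<Rightarrow> nat \<Rightarrow> nat" where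
  "num_injections m n \<equiv> (n choose m) * fact m"

abbreviation mult :: "(nat \<Rightarrow> 'z) \<Rightarrow> nat \<Rightarrow> 'z \<Rightarrow> nat" where
  "mult z k g \<equiv> card {i\<in>{..k}. z i = g}"

text \<open>The factorial is the number of orderings of a clique with \<open>k + 1\<close> vertices;
  the means below are sums over ordered tuples.\<close>

abbreviation weight :: "(nat \<Rightarrow> real) \<Rightarrow> nat \<Rightarrow> real" where
  "weight w k \<equiv> w (Suc k) / fact (Suc k)"

definition cliques :: "('a \<Rightarrow> 'a \<Rightarrow> bool) \<Rightarrow> 'a set \<Rightarrow> 'a set set" where
  "cliques R S = {Y. Y \<subseteq> S \<and> Y \<noteq> {} \<and> pairwise R Y}"

text \<open>The weights of interest are the indicators of odd and of even cardinality. Nonnegative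
  weights make the sum monotone in \<open>R\<close>, on which all comparisons rest.\<close>

definition clique_sum :: "(nat \<Rightarrow> real) \<Rightarrow> ('a \<Rightarrow> 'a \<Rightarrow> bool) \<Rightarrow> 'a set \<Rightarrow> real" where
  "clique_sum w R S = (\<Sum>Y\<in>cliques R S. w (card Y))"

lemma finite_cliques: "finite S \<Longrightarrow> finite (cliques R S)"
  by (rule finite_subset[of _ "Pow S"]) (auto simp: cliques_def)

lemma clique_sum_mono:
  assumes "finite S" "\<And>n. 0 \<le> w n"
    and "\<And>x y. x \<in> S \<Longrightarrow> y \<in> S \<Longrightarrow> R x y \<Longrightarrow> R' x y"
  shows "clique_sum w R S \<le> clique_sum w R' S"
  unfolding clique_sum_def
proof (rule sum_mono2)
  show "cliques R S \<subseteq> cliques R' S"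
    using assms(3) by (auto simp: cliques_def pairwise_def subset_iff)
qed (use assms in \<open>auto simp: finite_cliques\<close>)

lemma clique_sum_image:
  assumes "inj_on \<phi> S"
  shows "clique_sum w R (\<phi> ` S) = clique_sum w (\<lambda>a b. R (\<phi> a) (\<phi> b)) S"
proof -
  have "bij_betw (image \<phi>) (cliques (\<lambda>a b. R (\<phi> a) (\<phi> b)) S) (cliques R (\<phi> ` S))"
    unfolding bij_betw_def
  proof
    show "inj_on (image \<phi>) (cliques (\<lambda>a b. R (\<phi> a) (\<phi> b)) S)"
      by (rule inj_on_subset[OF inj_on_image_Pow[OF assms]]) (auto simp: cliques_def)
    show "image \<phi> ` cliques (\<lambda>a b. R (\<phi> a) (\<phi> b)) S = cliques R (\<phi> ` S)"
    proof (intro subset_antisym subsetI)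
      fix Y assume Y: "Y \<in> cliques R (\<phi> ` S)"
      let ?Z = "{x \<in> S. \<phi> x \<in> Y}"
      have "\<phi> ` ?Z = Y" using Y by (auto simp: cliques_def)
      moreover have "?Z \<in> cliques (\<lambda>a b. R (\<phi> a) (\<phi> b)) S"
        using Y assms by (auto simp: cliques_def pairwise_def inj_on_eq_iff)
      ultimately show "Y \<in> image \<phi> ` cliques (\<lambda>a b. R (\<phi> a) (\<phi> b)) S" by blast
    qed (auto simp: cliques_def pairwise_def)
  qed
  then have "clique_sum w R (\<phi> ` S) = (\<Sum>Y\<in>cliques (\<lambda>a b. R (\<phi> a) (\<phi> b)) S. w (card (\<phi> ` Y)))"
    unfolding clique_sum_def by (rule sum.reindex_bij_betw[symmetric])
  also have "\<dots> = clique_sum w (\<lambda>a b. R (\<phi> a) (\<phi> b)) S"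
    unfolding clique_sum_def
    by (intro sum.cong refl arg_cong[where f=w] card_image inj_on_subset[OF assms])
       (auto simp: cliques_def)
  finally show ?thesis .
qed

text \<open>A relation that sees only labels cannot tell points of equal label apart, so the sum is
  a function of the label counts alone. The second component on the right merely numbers the points
  sharing a label.\<close>

lemma clique_sum_labels:
  assumes S: "finite S" and q: "q ` S \<subseteq> G"
  shows "clique_sum w (\<lambda>a b. R (q a) (q b)) S =
    clique_sum w (\<lambda>a b. R (fst a) (fst b)) (SIGMA g:G. {..<card {x\<in>S. q x = g}})"
proof -
  have "\<exists>e. bij_betw e {..<card {x\<in>S. q x = g}} {x\<in>S. q x = g}" for g
    using S ex_bij_betw_nat_finite[of "{x\<in>S. q x = g}"] by (auto simp: atLeast0LessThan)
  then obtain e where e: "\<And>g. bij_betw (e g) {..<card {x\<in>S. q x = g}} {x\<in>S. q x = g}"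
    by metis
  define T where "T = (SIGMA g:G. {..<card {x\<in>S. q x = g}})"
  define \<phi> where "\<phi> = (\<lambda>(g, i). e g i)"
  have el: "e g i \<in> S \<and> q (e g i) = g" if "i < card {x\<in>S. q x = g}" for g i
    using bij_betwE[OF e[of g]] that by auto
  have inj: "inj_on \<phi> T"
  proof (rule inj_onI)
    fix x y assume xy: "x \<in> T" "y \<in> T" "\<phi> x = \<phi> y"
    obtain g i h j where [simp]: "x = (g, i)" "y = (h, j)" by (cases x, cases y)
    have ij: "i < card {x\<in>S. q x = g}" "j < card {x\<in>S. q x = h}" using xy by (auto simp: T_def)
    have "e g i = e h j" using xy by (simp add: \<phi>_def)
    then have [simp]: "g = h" using el[OF ij(1)] el[OF ij(2)] by simp
    have "i = j" using bij_betw_imp_inj_on[OF e[of g]] \<open>e g i = e h j\<close> ij by (auto dest: inj_onD)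
    then show "x = y" by simp
  qed
  have im: "\<phi> ` T = S"
  proof (intro subset_antisym subsetI)
    fix x assume x: "x \<in> S"
    then have "x \<in> e (q x) ` {..<card {y\<in>S. q y = q x}}"
      using e[of "q x"] by (auto simp: bij_betw_def)
    then show "x \<in> \<phi> ` T" using q x by (auto simp: T_def \<phi>_def image_iff split_beta)
  qed (auto simp: T_def \<phi>_def el)
  have lab: "q (\<phi> a) = fst a" if "a \<in> T" for a
    using that el by (auto simp: T_def \<phi>_def)
  have "clique_sum w (\<lambda>a b. R (q a) (q b)) S = clique_sum w (\<lambda>a b. R (q (\<phi> a)) (q (\<phi> b))) T"
    using clique_sum_image[OF inj, of w "\<lambda>a b. R (q a) (q b)"] by (simp add: im)
  also have "cliques (\<lambda>a b. R (q (\<phi> a)) (q (\<phi> b))) T = cliques (\<lambda>a b. R (fst a) (fst b)) T"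
  proof (intro set_eqI)
    fix Y
    have "pairwise (\<lambda>a b. R (q (\<phi> a)) (q (\<phi> b))) Y = pairwise (\<lambda>a b. R (fst a) (fst b)) Y" if "Y \<subseteq> T"
      unfolding pairwise_def using that lab by (metis subsetD)
    then show "Y \<in> cliques (\<lambda>a b. R (q (\<phi> a)) (q (\<phi> b))) T \<longleftrightarrow> Y \<in> cliques (\<lambda>a b. R (fst a) (fst b)) T"
      by (auto simp: cliques_def)
  qed
  then have "clique_sum w (\<lambda>a b. R (q (\<phi> a)) (q (\<phi> b))) T = clique_sum w (\<lambda>a b. R (fst a) (fst b)) T"
    by (simp add: clique_sum_def)
  finally show ?thesis by (simp add: T_def)
qed

lemma clique_sum_eq_sum_card:
  assumes "finite S" "card S \<le> n"
  shows "clique_sum w R S =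
    (\<Sum>k<n. w (Suc k) * real (card (cliques_of_card R S (Suc k))))"
proof -
  have fin: "finite Y" if "Y \<in> cliques R S" for Y
    using that assms by (auto simp: cliques_def intro: finite_subset)
  have "(\<Sum>k<n. w (Suc k) * real (card (cliques_of_card R S (Suc k)))) =
    (\<Sum>k<n. \<Sum>Y\<in>{Y \<in> cliques R S. card Y - 1 = k}. w (card Y))"
  proof (intro sum.cong refl)
    fix k
    have "cliques_of_card R S (Suc k) = {Y \<in> cliques R S. card Y - 1 = k}"
    proof (intro set_eqI iffI)
      fix Y assume "Y \<in> cliques_of_card R S (Suc k)"
      moreover from this have "Y \<noteq> {}" by auto
      ultimately show "Y \<in> {Y \<in> cliques R S. card Y - 1 = k}" by (simp add: cliques_def)
    next
      fix Y assume Y: "Y \<in> {Y \<in> cliques R S. card Y - 1 = k}"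
      then have "card Y > 0" using fin[of Y] by (simp add: cliques_def card_gt_0_iff)
      with Y show "Y \<in> cliques_of_card R S (Suc k)" by (auto simp: cliques_def)
    qed
    moreover have "(\<Sum>Y\<in>{Y \<in> cliques R S. card Y - 1 = k}. w (card Y)) =
       (\<Sum>Y\<in>{Y \<in> cliques R S. card Y - 1 = k}. w (Suc k))"
    proof (intro sum.cong refl)
      fix Y assume Y: "Y \<in> {Y \<in> cliques R S. card Y - 1 = k}"
      then have "card Y > 0" using fin[of Y] by (simp add: cliques_def card_gt_0_iff)
      with Y show "w (card Y) = w (Suc k)" by auto
    qed
    ultimately show "w (Suc k) * real (card (cliques_of_card R S (Suc k))) =
      (\<Sum>Y\<in>{Y \<in> cliques R S. card Y - 1 = k}. w (card Y))" by simp
  qed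
  also have "\<dots> = clique_sum w R S"
    unfolding clique_sum_def
  proof (rule sum.group)
    show "(\<lambda>Y. card Y - 1) ` cliques R S \<subseteq> {..<n}"
    proof (rule image_subsetI)
      fix Y assume Y: "Y \<in> cliques R S"
      then have "card Y \<le> card S" "card Y > 0"
        using fin[OF Y] assms by (auto simp: cliques_def card_gt_0_iff intro: card_mono)
      then show "card Y - 1 \<in> {..<n}" using assms by auto
    qed
  qed (use assms in \<open>auto simp: finite_cliques\<close>)
  finally show ?thesis ..
qed

lemma clique_sum_sums_card:
  assumes "finite S"
  shows "(\<lambda>k. w (Suc k) * real (card (cliques_of_card R S (Suc k))))
    sums clique_sum w R S"
proof -
  have "card (cliques_of_card R S (Suc k)) = 0" if "k \<notin> {..<card S}" for k
  proof -
    have "cliques_of_card R S (Suc k) = {}"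
    proof (rule equals0I)
      fix Y assume Y: "Y \<in> cliques_of_card R S (Suc k)"
      then have "card Y \<le> card S" by (intro card_mono[OF assms]) simp
      with Y that show False by simp
    qed
    then show ?thesis by (simp only: card.empty)
  qed
  then show ?thesis
    unfolding clique_sum_eq_sum_card[OF assms order_refl] by (intro sums_finite) auto
qed

section \<open>Rips simplices as cliques of a distance relation\<close>

lemma cball_inter_cball_nonempty_iff:
  fixes a b :: "'a::euclidean_space"
  shows "cball a r \<inter> cball b r \<noteq> {} \<longleftrightarrow> dist a b \<le> 2 * r"
proof
  assume "cball a r \<inter> cball b r \<noteq> {}"
  then obtain x where "dist a x \<le> r" "dist b x \<le> r" by auto
  then show "dist a b \<le> 2 * r" using dist_triangle[of a b x] by (simp add: dist_commute)
next
  assume *: "dist a b \<le> 2 * r"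
  have "midpoint a b \<in> cball a r \<inter> cball b r"
    using * by (simp add: dist_midpoint)
  then show "cball a r \<inter> cball b r \<noteq> {}" by blast
qed

lemma rips_set_eq_pairwise:
  assumes "card Y = Suc k"
  shows "rips_set k r Y = of_bool (pairwise (\<lambda>a b. dist a b \<le> 2 * r) Y)"
proof -
  have "finite Y" using assms card.infinite by fastforce
  then obtain y where y: "bij_betw y {..k} Y"
    using ex_bij_betw_nat_finite[of Y] assms by (auto simp: atLeast0LessThan lessThan_Suc_atMost)
  then have Y: "Y = y ` {..k}" and inj: "inj_on y {..k}" by (auto simp: bij_betw_def)
  show ?thesis
    unfolding rips_set_eq[OF y] rips_eq_of_bool cball_inter_cball_nonempty_iff
    unfolding Y pairwise_def by (auto simp: inj_on_eq_iff[OF inj])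
qed

text \<open>A \<open>k\<close>-simplex has \<open>k + 1\<close> vertices, so the sign
  \<open>(-1) ^ k\<close> is positive exactly for odd cardinality. Each of the two sums is monotone
  in \<open>r\<close>, which their difference is not.\<close>

lemma euler_char_eq_clique_sum:
  assumes P: "finite P"
  shows "euler_char r P = clique_sum (\<lambda>n. of_bool (odd n)) (\<lambda>a b. dist a b \<le> 2 * r) P
    - clique_sum (\<lambda>n. of_bool (even n)) (\<lambda>a b. dist a b \<le> 2 * r) P"
proof -
  let ?R = "\<lambda>a b. dist a b \<le> 2 * r"
  let ?C = "\<lambda>k. cliques_of_card ?R P (Suc k)"
  have "(\<Sum>Y | Y \<subseteq> P \<and> card Y = k + 1. rips_set k r Y) = real (card (?C k))" for k
  proof -
    have "(\<Sum>Y | Y \<subseteq> P \<and> card Y = k + 1. rips_set k r Y) =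
      (\<Sum>Y | Y \<subseteq> P \<and> card Y = k + 1. of_bool (pairwise ?R Y))"
      by (intro sum.cong) (auto simp: rips_set_eq_pairwise)
    also have "\<dots> = (\<Sum>Y\<in>?C k. 1)"
      using P by (intro sum.mono_neutral_cong_right) (auto intro: finite_subset[of _ "Pow P"])
    finally show ?thesis by simp
  qed
  then have "euler_char r P = (\<Sum>k. (-1) ^ k * real (card (?C k)))"
    by (simp add: euler_char_def)
  also have "\<dots> = (\<Sum>k. of_bool (odd (Suc k)) * real (card (?C k)) - of_bool (even (Suc k)) * real (card (?C k)))"
    by (intro suminf_cong) auto
  also have "\<dots> = clique_sum (\<lambda>n. of_bool (odd n)) ?R P - clique_sum (\<lambda>n. of_bool (even n)) ?R P"
    by (rule sums_unique[symmetric], rule sums_diff) (rule clique_sum_sums_card[OF P])+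
  finally show ?thesis .
qed

text \<open>A new index \<open>a\<close> may be sent to any point with label \<open>z a\<close> that
  is not yet taken. The number of such points does not depend on the earlier choices, so the falling
  factorials build up one factor at a time.\<close>

lemma card_labelled_injections:
  assumes "finite I" "finite S" "finite G" "z \<in> I \<rightarrow> G"
  shows "card {y \<in> I \<rightarrow>\<^sub>E S. inj_on y I \<and> (\<forall>i\<in>I. q (y i) = z i)} =
    (\<Prod>g\<in>G. (card {x\<in>S. q x = g} choose card {i\<in>I. z i = g}) * fact (card {i\<in>I. z i = g}))"
  using assms(1,4)
proof (induction I rule: finite_induct)
  case empty
  then show ?case by (simp add: PiE_empty_domain)
next
  case (insert a I)
  define A where "A = {y \<in> I \<rightarrow>\<^sub>E S. inj_on y I \<and> (\<forall>i\<in>I. q (y i) = z i)}"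
  define B where "B = {y \<in> insert a I \<rightarrow>\<^sub>E S. inj_on y (insert a I) \<and> (\<forall>i\<in>insert a I. q (y i) = z i)}"
  define m where "m g = card {i\<in>I. z i = g}" for g
  define N where "N g = card {x\<in>S. q x = g}" for g
  have finA: "finite A"
    unfolding A_def using finite_PiE[of I "\<lambda>_. S"] insert.hyps assms(2) by simp
  let ?F = "\<lambda>y. {x\<in>S. q x = z a} - y ` I"
  have "bij_betw (\<lambda>y. (restrict y I, y a)) B (SIGMA y:A. ?F y)"
  proof (rule bij_betw_byWitness[where f'="\<lambda>(y, x). y(a := x)"])
    show "\<forall>y\<in>B. (\<lambda>(y, x). y(a := x)) (restrict y I, y a) = y"
      using insert.hyps by (auto simp: B_def PiE_def extensional_def fun_eq_iff)
    show "\<forall>p\<in>SIGMA y:A. ?F y. (\<lambda>y. (restrict y I, y a)) ((\<lambda>(y, x). y(a := x)) p) = p"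
      using insert.hyps by (auto simp: A_def PiE_def extensional_def fun_eq_iff restrict_def)
    show "(\<lambda>y. (restrict y I, y a)) ` B \<subseteq> (SIGMA y:A. ?F y)"
      using insert.hyps by (auto simp: A_def B_def inj_on_def)
    show "(\<lambda>(y, x). y(a := x)) ` (SIGMA y:A. ?F y) \<subseteq> B"
    proof (rule image_subsetI)
      fix p assume p: "p \<in> (SIGMA y:A. ?F y)"
      obtain y x where [simp]: "p = (y, x)" by (cases p)
      have y: "y \<in> A" and x: "x \<in> S" "x \<notin> y ` I" "z a = q x" using p by auto
      have "y(a := x) \<in> insert a I \<rightarrow>\<^sub>E S" using x y by (auto simp: A_def PiE_def extensional_def)
      moreover have "inj_on (y(a := x)) (insert a I)"
        using x y insert.hyps by (auto simp: A_def inj_on_fun_updI inj_on_def)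
      ultimately show "(case p of (y, x) \<Rightarrow> y(a := x)) \<in> B"
        using x y insert.hyps by (auto simp: A_def B_def)
    qed
  qed
  then have "card B = card (SIGMA y:A. ?F y)" by (rule bij_betw_same_card)
  also have "\<dots> = (\<Sum>y\<in>A. card (?F y))"
    using finA assms by (intro card_SigmaI) auto
  \<comment> \<open>Of the points already taken, only those of indices with the same label are
    excluded, and \<open>y\<close> is injective on these indices.\<close>
  also have "\<dots> = (\<Sum>y\<in>A. N (z a) - m (z a))"
  proof (intro sum.cong refl)
    fix y assume y: "y \<in> A"
    have "?F y = {x\<in>S. q x = z a} - y ` {i\<in>I. z i = z a}"
      using y by (auto simp: A_def)
    moreover have "y ` {i\<in>I. z i = z a} \<subseteq> {x\<in>S. q x = z a}"
      using y by (auto simp: A_def)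
    moreover have "card (y ` {i\<in>I. z i = z a}) = m (z a)"
      unfolding m_def using y by (intro card_image) (auto simp: A_def inj_on_def)
    ultimately show "card (?F y) = N (z a) - m (z a)"
      using insert.hyps by (simp add: card_Diff_subset N_def)
  qed
  also have "\<dots> = card A * (N (z a) - m (z a))" by simp
  also have "card A = (\<Prod>g\<in>G. (N g choose m g) * fact (m g))"
    unfolding A_def N_def m_def using insert.IH insert.prems by auto
  also have "\<dots> * (N (z a) - m (z a)) =
    (\<Prod>g\<in>G. (N g choose card {i\<in>insert a I. z i = g}) * fact (card {i\<in>insert a I. z i = g}))"
  proof -
    have za: "z a \<in> G" using insert.prems by auto
    have m': "card {i\<in>insert a I. z i = g} = (if g = z a then Suc (m g) else m g)" for g
    proof (cases "g = z a")
      case True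
      then have "{i\<in>insert a I. z i = g} = insert a {i\<in>I. z i = g}" by auto
      then show ?thesis using insert.hyps True by (simp add: m_def)
    next
      case False
      then have "{i\<in>insert a I. z i = g} = {i\<in>I. z i = g}" by auto
      then show ?thesis using False by (simp add: m_def)
    qed
    \<comment> \<open>For \<open>n \<le> k\<close> both sides are zero, so the truncated subtraction
      is harmless.\<close>
    have step: "(n choose Suc k) * fact (Suc k) = (n choose k) * fact k * (n - k)" for n k :: nat
    proof -
      have "Suc k * (n choose Suc k) = (n - k) * (n choose k)"
        unfolding binomial_absorb_comp binomial_absorption by simp
      then show ?thesis by (metis fact_Suc mult.assoc mult.commute of_nat_id)
    qed
    show ?thesis
      unfolding m' prod.remove[OF \<open>finite G\<close> za]
      using step[of "N (z a)" "m (z a)"] by (simp add: mult_ac)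
  qed
  finally show ?case by (simp add: B_def N_def)
qed

lemma card_cliques_eq_tuples:
  assumes S: "finite S"
  shows "card (cliques_of_card R S (Suc k)) * fact (Suc k) =
    card {y \<in> {..k} \<rightarrow>\<^sub>E S. inj_on y {..k} \<and> tuple_pairwise R k y}"
proof -
  let ?A = "{y \<in> {..k} \<rightarrow>\<^sub>E S. inj_on y {..k} \<and> tuple_pairwise R k y}"
  let ?B = "cliques_of_card R S (Suc k)"
  have finA: "finite ?A"
    using finite_PiE[of "{..k}" "\<lambda>_. S"] S by simp
  have finB: "finite ?B" by (rule finite_subset[of _ "Pow S"]) (use S in auto)
  have "card {y \<in> ?A. y ` {..k} = Y} = fact (Suc k)" if Y: "Y \<in> ?B" for Y
  proof -
    have fY: "finite Y" using Y S finite_subset by auto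
    \<comment> \<open>With a single trivial label the labelled count becomes the number of
      injections of \<open>{..k}\<close> into \<open>Y\<close>; as \<open>card Y = k + 1\<close>,
      these are exactly the enumerations of \<open>Y\<close>.\<close>
    have "{y \<in> ?A. y ` {..k} = Y} = {y \<in> {..k} \<rightarrow>\<^sub>E Y. inj_on y {..k} \<and> (\<forall>i\<in>{..k}. () = ())}"
    proof (intro set_eqI iffI)
      fix y assume "y \<in> {y \<in> ?A. y ` {..k} = Y}"
      then show "y \<in> {y \<in> {..k} \<rightarrow>\<^sub>E Y. inj_on y {..k} \<and> (\<forall>i\<in>{..k}. () = ())}" by auto
    next
      fix y assume "y \<in> {y \<in> {..k} \<rightarrow>\<^sub>E Y. inj_on y {..k} \<and> (\<forall>i\<in>{..k}. () = ())}"
      then have y: "y \<in> {..k} \<rightarrow>\<^sub>E Y" "inj_on y {..k}" by auto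
      have im: "y ` {..k} = Y"
        using y Y fY by (intro card_subset_eq) (auto simp: card_image)
      then have "y i \<noteq> y j" "y i \<in> Y" "y j \<in> Y" if "i \<le> k" "j \<le> k" "i \<noteq> j" for i j
        using that y(2) by (auto dest: inj_onD)
      then have "tuple_pairwise R k y"
        using Y by (auto simp: pairwise_def)
      then show "y \<in> {y \<in> ?A. y ` {..k} = Y}" using y Y im by (auto simp: PiE_iff)
    qed
    also have "card \<dots> = fact (Suc k)"
      using card_labelled_injections[of "{..k}" Y "{()}" "\<lambda>_. ()" "\<lambda>_. ()"] fY Y by simp
    finally show ?thesis .
  qed
  then have "card ?B * fact (Suc k) = (\<Sum>Y\<in>?B. card {y \<in> ?A. y ` {..k} = Y})" by simp
  also have "\<dots> = (\<Sum>Y\<in>?B. \<Sum>y\<in>{y \<in> ?A. y ` {..k} = Y}. 1)" by simp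
  also have "\<dots> = (\<Sum>y\<in>?A. 1)"
  proof (rule sum.group[OF finA finB])
    show "(\<lambda>y. y ` {..k}) ` ?A \<subseteq> ?B"
      by (auto simp: card_image pairwise_def)
  qed
  finally show ?thesis by simp
qed

text \<open>Sorting tuples of points by their tuple of labels turns adjacency into a condition on
  the labels and leaves free injective choices within each label. A label may occur repeatedly in
  \<open>z\<close>; then \<open>R g g\<close> decides whether points sharing it are
  adjacent.\<close>

lemma card_labelled_tuples:
  fixes k :: nat
  assumes S: "finite S" and G: "finite G" "q ` S \<subseteq> G"
  shows "card {y \<in> {..k} \<rightarrow>\<^sub>E S. inj_on y {..k} \<and> tuple_pairwise (\<lambda>a b. R (q a) (q b)) k y} =
    (\<Sum>z | z \<in> {..k} \<rightarrow>\<^sub>E G \<and> tuple_pairwise R k z.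
       \<Prod>g\<in>G. num_injections (mult z k g) (card {x\<in>S. q x = g}))"
proof -
  let ?A = "{y \<in> {..k} \<rightarrow>\<^sub>E S. inj_on y {..k} \<and> tuple_pairwise (\<lambda>a b. R (q a) (q b)) k y}"
  let ?Z = "{z. z \<in> {..k} \<rightarrow>\<^sub>E G \<and> tuple_pairwise R k z}"
  have finA: "finite ?A"
    using finite_PiE[of "{..k}" "\<lambda>_. S"] S by simp
  have finZ: "finite ?Z"
    using finite_PiE[of "{..k}" "\<lambda>_. G"] G by simp
  have "card ?A = (\<Sum>y\<in>?A. 1)" by simp
  also have "\<dots> = (\<Sum>z\<in>?Z. \<Sum>y\<in>{y\<in>?A. restrict (q \<circ> y) {..k} = z}. 1)"
    by (rule sum.group[OF finA finZ, symmetric]) (use G in \<open>auto simp: PiE_iff\<close>)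
  also have "\<dots> = (\<Sum>z\<in>?Z. card {y \<in> {..k} \<rightarrow>\<^sub>E S. inj_on y {..k} \<and> (\<forall>i\<in>{..k}. q (y i) = z i)})"
  proof (intro sum.cong refl)
    fix z assume z: "z \<in> ?Z"
    have "restrict (q \<circ> y) {..k} = z \<longleftrightarrow> (\<forall>i\<in>{..k}. q (y i) = z i)" for y
      using z by (auto simp: fun_eq_iff PiE_def extensional_def restrict_def)
    then have "{y\<in>?A. restrict (q \<circ> y) {..k} = z} =
      {y \<in> {..k} \<rightarrow>\<^sub>E S. inj_on y {..k} \<and> (\<forall>i\<in>{..k}. q (y i) = z i)}"
      using z by auto
    then show "(\<Sum>y\<in>{y\<in>?A. restrict (q \<circ> y) {..k} = z}. 1) =
      card {y \<in> {..k} \<rightarrow>\<^sub>E S. inj_on y {..k} \<and> (\<forall>i\<in>{..k}. q (y i) = z i)}" by simp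
  qed
  also have "\<dots> = (\<Sum>z\<in>?Z. \<Prod>g\<in>G. num_injections (mult z k g) (card {x\<in>S. q x = g}))"
    by (intro sum.cong refl card_labelled_injections S G) auto
  finally show ?thesis .
qed

text \<open>Each clique is shared out among the cells of its vertices in equal parts, which makes the clique
  sum a sum over cells of contributions depending only on nearby cells.\<close>

definition rooted_sum :: "(nat \<Rightarrow> real) \<Rightarrow> ('z \<Rightarrow> 'z \<Rightarrow> bool) \<Rightarrow> 'z set \<Rightarrow> ('z \<Rightarrow> nat) \<Rightarrow> 'z \<Rightarrow> real" where
  "rooted_sum w R G N q = (\<Sum>Y\<in>cliques (\<lambda>a b. R (fst a) (fst b)) (SIGMA g:G. {..<N g}).
     w (card Y) * (real (card {y\<in>Y. fst y = q}) / real (card Y)))"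

lemma clique_sum_eq_sum_rooted:
  assumes G: "finite G"
  shows "clique_sum w (\<lambda>a b. R (fst a) (fst b)) (SIGMA g:G. {..<N g}) = (\<Sum>q\<in>G. rooted_sum w R G N q)"
proof -
  let ?S = "SIGMA g:G. {..<N g}"
  let ?C = "cliques (\<lambda>a b. R (fst a) (fst b)) ?S"
  have "(\<Sum>q\<in>G. rooted_sum w R G N q) =
    (\<Sum>Y\<in>?C. \<Sum>q\<in>G. w (card Y) * (real (card {y\<in>Y. fst y = q}) / real (card Y)))"
    unfolding rooted_sum_def by (rule sum.swap)
  also have "\<dots> = (\<Sum>Y\<in>?C. w (card Y))"
  proof (intro sum.cong refl)
    fix Y assume Y: "Y \<in> ?C"
    have fin: "finite Y" "Y \<noteq> {}" "Y \<subseteq> ?S" using Y G by (auto simp: cliques_def intro: finite_subset)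
    have "(\<Sum>q\<in>G. card {y\<in>Y. fst y = q}) = (\<Sum>q\<in>G. \<Sum>y\<in>{y\<in>Y. fst y = q}. 1)" by simp
    also have "\<dots> = (\<Sum>y\<in>Y. 1)" using fin G by (intro sum.group) auto
    finally have "(\<Sum>q\<in>G. card {y\<in>Y. fst y = q}) = card Y" by simp
    then have "(\<Sum>q\<in>G. real (card {y\<in>Y. fst y = q})) = real (card Y)"
      by (simp only: of_nat_sum[symmetric])
    then show "(\<Sum>q\<in>G. w (card Y) * (real (card {y\<in>Y. fst y = q}) / real (card Y))) = w (card Y)"
      using fin by (simp add: sum_distrib_left[symmetric] sum_divide_distrib[symmetric])
  qed
  finally show ?thesis by (simp add: clique_sum_def)
qed

text \<open>If a clique has a vertex over \<open>q\<close>, its other vertices lie over neighbours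
  of \<open>q\<close>; hence a clique leaving \<open>K\<close> has no share at \<open>q\<close>.
  This locality is the source of independence between distant cells.\<close>

lemma rooted_sum_local:
  assumes "finite G" "K \<subseteq> G" "q \<in> K" "\<And>g. g \<in> G \<Longrightarrow> R g q \<Longrightarrow> g \<in> K"
    and N: "\<And>g. g \<in> K \<Longrightarrow> N g = N' g"
  shows "rooted_sum w R G N q = rooted_sum w R K N' q"
proof -
  let ?R = "\<lambda>a b. R (fst a) (fst b)"
  have S: "(SIGMA g:K. {..<N g}) = (SIGMA g:K. {..<N' g})" using N by auto
  have "rooted_sum w R G N q = rooted_sum w R K N q"
    unfolding rooted_sum_def
  proof (rule sum.mono_neutral_right)
    show "finite (cliques ?R (SIGMA g:G. {..<N g}))" using assms by (intro finite_cliques) auto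
    show "cliques ?R (SIGMA g:K. {..<N g}) \<subseteq> cliques ?R (SIGMA g:G. {..<N g})"
      using assms by (force simp: cliques_def)
    show "\<forall>Y\<in>cliques ?R (SIGMA g:G. {..<N g}) - cliques ?R (SIGMA g:K. {..<N g}).
      w (card Y) * (real (card {y \<in> Y. fst y = q}) / real (card Y)) = 0"
    proof
      fix Y assume Y: "Y \<in> cliques ?R (SIGMA g:G. {..<N g}) - cliques ?R (SIGMA g:K. {..<N g})"
      have "{y \<in> Y. fst y = q} = {}"
      proof (rule ccontr)
        assume "{y \<in> Y. fst y = q} \<noteq> {}"
        then obtain y where y: "y \<in> Y" "fst y = q" by auto
        have "x \<in> (SIGMA g:K. {..<N g})" if x: "x \<in> Y" for x
        proof -
          have xG: "x \<in> (SIGMA g:G. {..<N g})" using Y x by (auto simp: cliques_def)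
          moreover have "fst x \<in> K"
          proof (cases "x = y")
            case True then show ?thesis using y assms by simp
          next
            case False
            then have "R (fst x) q" using Y x y by (auto simp: cliques_def pairwise_def)
            then show ?thesis using xG assms by auto
          qed
          ultimately show ?thesis by auto
        qed
        then have "Y \<in> cliques ?R (SIGMA g:K. {..<N g})" using Y by (auto simp: cliques_def)
        then show False using Y by simp
      qed
      then show "w (card Y) * (real (card {y \<in> Y. fst y = q}) / real (card Y)) = 0"
        by (simp only: card.empty of_nat_0 div_0 mult_zero_right)
    qed
  qed
  then show ?thesis by (simp add: rooted_sum_def S)
qed

text \<open>Every share is at most 1, and there are at most as many cliques as nonempty sets of
  points. The \<open>- 1\<close> from the missing empty set is essential: it makes the later moment
  bounds vanish with the intensity.\<close>

lemma rooted_sum_bounds: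
  assumes "finite K" and w: "\<And>n. 0 \<le> w n" "\<And>n. w n \<le> 1"
  shows "0 \<le> rooted_sum w R K N q" "rooted_sum w R K N q \<le> 2 ^ (\<Sum>g\<in>K. N g) - 1"
proof -
  let ?S = "SIGMA g:K. {..<N g}"
  have fS: "finite ?S" using assms by auto
  show "0 \<le> rooted_sum w R K N q"
    unfolding rooted_sum_def using w by (intro sum_nonneg mult_nonneg_nonneg) auto
  have "rooted_sum w R K N q \<le> (\<Sum>Y\<in>cliques (\<lambda>a b. R (fst a) (fst b)) ?S. 1)"
    unfolding rooted_sum_def
  proof (rule sum_mono)
    fix Y assume "Y \<in> cliques (\<lambda>a b. R (fst a) (fst b)) ?S"
    then have "finite Y" using fS by (auto simp: cliques_def intro: finite_subset)
    then have "card {y\<in>Y. fst y = q} \<le> card Y" by (intro card_mono) auto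
    then have "real (card {y\<in>Y. fst y = q}) / real (card Y) \<le> 1"
      by (cases "card Y = 0") (auto simp: field_simps)
    then show "w (card Y) * (real (card {y\<in>Y. fst y = q}) / real (card Y)) \<le> 1"
      using w by (intro mult_le_one) auto
  qed
  also have "\<dots> \<le> real (card (Pow ?S - {{}}))"
  proof -
    have "card (cliques (\<lambda>a b. R (fst a) (fst b)) ?S) \<le> card (Pow ?S - {{}})"
      using fS by (intro card_mono) (auto simp: cliques_def)
    then show ?thesis by simp
  qed
  also have "card (Pow ?S - {{}}) = 2 ^ (\<Sum>g\<in>K. N g) - 1"
    using fS assms by (simp add: card_Diff_subset card_Pow card_SigmaI)
  also have "real (2 ^ (\<Sum>g\<in>K. N g) - 1) = 2 ^ (\<Sum>g\<in>K. N g) - 1"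
    by (simp add: of_nat_diff)
  finally show "rooted_sum w R K N q \<le> 2 ^ (\<Sum>g\<in>K. N g) - 1" by simp
qed

section \<open>Cliques over independent Poisson cells\<close>

definition clique_tuples :: "('z \<Rightarrow> 'z \<Rightarrow> bool) \<Rightarrow> nat \<Rightarrow> 'z set \<Rightarrow> (nat \<Rightarrow> 'z) set" where
  "clique_tuples R k G = {z \<in> {..k} \<rightarrow>\<^sub>E G. tuple_pairwise R k z}"

lemma finite_clique_tuples: "finite G \<Longrightarrow> finite (clique_tuples R k G)"
  unfolding clique_tuples_def using finite_PiE[of "{..k}" "\<lambda>_. G"] by simp

locale poisson_cells = prob_space M for M :: "'w measure" +
  fixes G :: "'z set" and N :: "'z \<Rightarrow> 'w \<Rightarrow> nat" and rate :: "'z \<Rightarrow> real"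
  assumes fin: "finite G"
    and ind: "indep_vars (\<lambda>_. count_space UNIV) N G"
    and poi: "\<And>g. g \<in> G \<Longrightarrow> poisson_var M (N g) (rate g)"
begin

abbreviation points :: "'w \<Rightarrow> ('z \<times> nat) set" where
  "points \<omega> \<equiv> (SIGMA g:G. {..<N g \<omega>})"

abbreviation total :: "(nat \<Rightarrow> real) \<Rightarrow> ('z \<Rightarrow> 'z \<Rightarrow> bool) \<Rightarrow> 'w \<Rightarrow> real" where
  "total w R \<omega> \<equiv> clique_sum w (\<lambda>a b. R (fst a) (fst b)) (points \<omega>)"

lemma measurable_N: "g \<in> G \<Longrightarrow> N g \<in> measurable M (count_space UNIV)"
  using poi by (simp add: poisson_var_def)

lemma rate_nonneg: "g \<in> G \<Longrightarrow> 0 \<le> rate g"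
  using poi by (simp add: poisson_var_def)

lemma nn_integral_prod_counts:
  fixes h :: "'z \<Rightarrow> nat \<Rightarrow> ennreal"
  assumes K: "K \<subseteq> G"
  shows "(\<integral>\<^sup>+\<omega>. (\<Prod>g\<in>K. h g (N g \<omega>)) \<partial>M) = (\<Prod>g\<in>K. \<integral>\<^sup>+\<omega>. h g (N g \<omega>) \<partial>M)"
proof (rule indep_vars_nn_integral)
  show "finite K" using K fin finite_subset by blast
  have "indep_vars (\<lambda>_. count_space UNIV) N K" by (rule indep_vars_subset[OF ind K])
  then show "indep_vars (\<lambda>_. borel) (\<lambda>g \<omega>. h g (N g \<omega>)) K"
    by (rule indep_vars_compose2) simp
qed simp

lemma card_points_tuples:
  "real (card (cliques_of_card (\<lambda>a b. R (fst a) (fst b)) (points \<omega>) (Suc k))) =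
   (\<Sum>z\<in>clique_tuples R k G. \<Prod>g\<in>G. real (num_injections (mult z k g) (N g \<omega>))) / fact (Suc k)"
proof -
  let ?S = "points \<omega>"
  have S: "finite ?S" using fin by auto
  have c: "card {x\<in>?S. fst x = g} = N g \<omega>" if "g \<in> G" for g
  proof -
    have "{x\<in>?S. fst x = g} = {g} \<times> {..<N g \<omega>}" using that by auto
    then show ?thesis by simp
  qed
  have "card (cliques_of_card (\<lambda>a b. R (fst a) (fst b)) ?S (Suc k)) * fact (Suc k) =
    (\<Sum>z\<in>clique_tuples R k G. \<Prod>g\<in>G. num_injections (mult z k g) (card {x\<in>?S. fst x = g}))"
    unfolding card_cliques_eq_tuples[OF S] clique_tuples_def
    by (rule card_labelled_tuples[OF S fin]) auto
  also have "\<dots> = (\<Sum>z\<in>clique_tuples R k G. \<Prod>g\<in>G. num_injections (mult z k g) (N g \<omega>))"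
    by (intro sum.cong prod.cong refl) (simp add: c)
  finally have "real (card (cliques_of_card (\<lambda>a b. R (fst a) (fst b)) ?S (Suc k)) * fact (Suc k)) =
    real (\<Sum>z\<in>clique_tuples R k G. \<Prod>g\<in>G. num_injections (mult z k g) (N g \<omega>))"
    by (rule arg_cong)
  then show ?thesis
    by (simp add: field_simps del: fact_Suc)
qed

text \<open>Independence factorises the mean over cells, and each factor is a factorial moment, the
  rate to the power of the multiplicity of its cell. Regrouping gives one rate per tuple entry,
  whether or not cells repeat. Monotone convergence moves the integral through the series over
  \<open>k\<close>.\<close>

lemma nn_integral_total:
  assumes w: "\<And>n. 0 \<le> w n"
  shows "(\<integral>\<^sup>+\<omega>. ennreal (total w R \<omega>) \<partial>M) =
    (\<Sum>k. ennreal (weight w k * (\<Sum>z\<in>clique_tuples R k G. \<Prod>i\<le>k. rate (z i))))"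
proof -
  define T where "T k \<omega> = (\<Sum>z\<in>clique_tuples R k G. \<Prod>g\<in>G. ennreal (real (num_injections (mult z k g) (N g \<omega>))))" for k \<omega>
  have fin_tup: "finite (clique_tuples R k G)" for k by (rule finite_clique_tuples[OF fin])
  have mh: "(\<lambda>\<omega>. h (N g \<omega>)) \<in> borel_measurable M" if "g \<in> G" for g and h :: "nat \<Rightarrow> ennreal"
    using measurable_N[OF that] by (rule measurable_compose) simp
  have mT: "T k \<in> borel_measurable M" for k
    unfolding T_def by (intro borel_measurable_sum borel_measurable_prod_ennreal mh)
  have "(\<integral>\<^sup>+\<omega>. ennreal (total w R \<omega>) \<partial>M) = (\<integral>\<^sup>+\<omega>. (\<Sum>k. ennreal (weight w k) * T k \<omega>) \<partial>M)"
  proof (intro nn_integral_cong)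
    fix \<omega>
    have S: "finite (points \<omega>)" using fin by auto
    have "ennreal (total w R \<omega>) = (\<Sum>k. ennreal (w (Suc k) *
       real (card (cliques_of_card (\<lambda>a b. R (fst a) (fst b)) (points \<omega>) (Suc k)))))"
      by (rule suminf_ennreal_eq[symmetric]) (auto simp: w intro: clique_sum_sums_card[OF S])
    also have "\<dots> = (\<Sum>k. ennreal (weight w k) * T k \<omega>)"
    proof (intro suminf_cong)
      fix k
      have "T k \<omega> = ennreal (\<Sum>z\<in>clique_tuples R k G. \<Prod>g\<in>G. real (num_injections (mult z k g) (N g \<omega>)))"
        unfolding T_def by (simp only: sum_ennreal prod_ennreal prod_nonneg of_nat_0_le_iff)
      then show "ennreal (w (Suc k) * real (card (cliques_of_card (\<lambda>a b. R (fst a) (fst b)) (points \<omega>) (Suc k)))) =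
        ennreal (weight w k) * T k \<omega>"
        unfolding card_points_tuples using w
        by (simp add: ennreal_mult'[symmetric] sum_nonneg prod_nonneg del: fact_Suc of_nat_mult)
    qed
    finally show "ennreal (total w R \<omega>) = (\<Sum>k. ennreal (weight w k) * T k \<omega>)" .
  qed
  also have "\<dots> = (\<Sum>k. \<integral>\<^sup>+\<omega>. ennreal (weight w k) * T k \<omega> \<partial>M)"
    using mT by (intro nn_integral_suminf) measurable
  also have "\<dots> = (\<Sum>k. ennreal (weight w k) * (\<integral>\<^sup>+\<omega>. T k \<omega> \<partial>M))"
    by (intro suminf_cong nn_integral_cmult mT)
  also have "\<dots> = (\<Sum>k. ennreal (weight w k * (\<Sum>z\<in>clique_tuples R k G. \<Prod>i\<le>k. rate (z i))))"
  proof (intro suminf_cong)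
    fix k
    have zG: "z i \<in> G" if "z \<in> clique_tuples R k G" "i \<le> k" for z i
      using that by (auto simp: clique_tuples_def PiE_iff)
    have "(\<integral>\<^sup>+\<omega>. T k \<omega> \<partial>M) = (\<Sum>z\<in>clique_tuples R k G. \<integral>\<^sup>+\<omega>. (\<Prod>g\<in>G. ennreal (real
      (num_injections (mult z k g) (N g \<omega>)))) \<partial>M)"
      unfolding T_def by (intro nn_integral_sum borel_measurable_prod_ennreal mh)
    also have "\<dots> = (\<Sum>z\<in>clique_tuples R k G. \<Prod>g\<in>G. \<integral>\<^sup>+\<omega>. ennreal (real
      (num_injections (mult z k g) (N g \<omega>))) \<partial>M)"
      by (intro sum.cong refl nn_integral_prod_counts order_refl)
    also have "\<dots> = (\<Sum>z\<in>clique_tuples R k G. ennreal (\<Prod>i\<le>k. rate (z i)))"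
    proof (intro sum.cong refl)
      fix z assume z: "z \<in> clique_tuples R k G"
      have "(\<Prod>g\<in>G. \<integral>\<^sup>+\<omega>. ennreal (real
        (num_injections (mult z k g) (N g \<omega>))) \<partial>M) =
        (\<Prod>g\<in>G. ennreal (rate g ^ mult z k g))"
        by (intro prod.cong refl poisson_factorial_moment poi)
      also have "\<dots> = ennreal (\<Prod>g\<in>G. rate g ^ mult z k g)"
        by (intro prod_ennreal) (simp add: rate_nonneg)
      also have "(\<Prod>g\<in>G. rate g ^ mult z k g) = (\<Prod>g\<in>G. \<Prod>i\<in>{i\<in>{..k}. z i = g}. rate (z i))"
        by (intro prod.cong refl) simp
      also have "\<dots> = (\<Prod>i\<le>k. rate (z i))"
        using fin zG[OF z] by (intro prod.group) auto
      finally show "(\<Prod>g\<in>G. \<integral>\<^sup>+\<omega>. ennreal (real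
        (num_injections (mult z k g) (N g \<omega>))) \<partial>M) =
        ennreal (\<Prod>i\<le>k. rate (z i))" .
    qed
    also have "\<dots> = ennreal (\<Sum>z\<in>clique_tuples R k G. \<Prod>i\<le>k. rate (z i))"
      using zG by (intro sum_ennreal prod_nonneg) (auto intro!: rate_nonneg)
    finally show "ennreal (weight w k) * (\<integral>\<^sup>+\<omega>. T k \<omega> \<partial>M) =
      ennreal (weight w k * (\<Sum>z\<in>clique_tuples R k G. \<Prod>i\<le>k. rate (z i)))"
      using w by (simp only: ennreal_mult' divide_nonneg_pos fact_gt_zero)
  qed
  finally show ?thesis .
qed

abbreviation root_part :: "(nat \<Rightarrow> real) \<Rightarrow> ('z \<Rightarrow> 'z \<Rightarrow> bool) \<Rightarrow> 'z \<Rightarrow> 'w \<Rightarrow> real" where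
  "root_part w R q \<omega> \<equiv> rooted_sum w R G (\<lambda>g. N g \<omega>) q"

context
  fixes w :: "nat \<Rightarrow> real" and R :: "'z \<Rightarrow> 'z \<Rightarrow> bool" and K :: "'z \<Rightarrow> 'z set"
  assumes w: "\<And>n. 0 \<le> w n" "\<And>n. w n \<le> 1"
    and K: "\<And>q. q \<in> G \<Longrightarrow> K q \<subseteq> G" "\<And>q. q \<in> G \<Longrightarrow> q \<in> K q"
      "\<And>g q. g \<in> G \<Longrightarrow> q \<in> G \<Longrightarrow> R g q \<Longrightarrow> g \<in> K q"
begin

lemma finite_K: "q \<in> G \<Longrightarrow> finite (K q)"
  using K fin finite_subset by blast

text \<open>Seen through the coordinates in \<open>K q\<close>, a root part is a function on a
  discrete product space. This gives its measurability and, for disjoint blocks \<open>K q\<close>,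
  independence.\<close>

lemma root_part_eq:
  "q \<in> G \<Longrightarrow> root_part w R q \<omega> = rooted_sum w R (K q) (restrict (\<lambda>g. N g \<omega>) (K q)) q"
  by (rule rooted_sum_local) (use fin K in auto)

text \<open>A finite product of countable discrete spaces is discrete, so every function on it is
  measurable.\<close>

lemma measurable_rooted_sum:
  "q \<in> G \<Longrightarrow> (\<lambda>x. rooted_sum w R (K q) x q) \<in> borel_measurable (\<Pi>\<^sub>M g\<in>K q. count_space UNIV)"
  using count_space_PiM_finite[of "K q" "\<lambda>_. UNIV :: nat set"] finite_K by simp

lemma measurable_root_part: "q \<in> G \<Longrightarrow> root_part w R q \<in> borel_measurable M"
  unfolding root_part_eq
  by (rule measurable_compose[OF measurable_restrict measurable_rooted_sum])
     (use K(1) measurable_N in blast)+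

lemma indep_root_parts:
  assumes "L \<subseteq> G" "disjoint_family_on K L"
  shows "indep_vars (\<lambda>_. borel) (\<lambda>q \<omega>. root_part w R q \<omega>) L"
proof -
  have "indep_vars (\<lambda>q. \<Pi>\<^sub>M g\<in>K q. count_space UNIV) (\<lambda>q \<omega>. restrict (\<lambda>g. N g \<omega>) (K q)) L"
    using assms K by (intro indep_vars_restrict[OF ind]) auto
  then have "indep_vars (\<lambda>_. borel)
      (\<lambda>q \<omega>. rooted_sum w R (K q) (restrict (\<lambda>g. N g \<omega>) (K q)) q) L"
    by (rule indep_vars_compose2) (use assms measurable_rooted_sum in auto)
  then show ?thesis
    by (subst indep_vars_cong[OF refl _ refl]) (use assms root_part_eq in auto)
qed

text \<open>The base is \<open>2 ^ 4\<close>, because fourth powers of quantities below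
  \<open>2 ^ m\<close> are to be integrated, with \<open>m\<close> the number of nearby points;
  \<open>15 = 16 - 1\<close> comes from the Poisson generating function.\<close>

lemma exponential_moment_nbhd:
  assumes q: "q \<in> G"
  shows "integrable M (\<lambda>\<omega>. 16 ^ (\<Sum>g\<in>K q. N g \<omega>) :: real)"
    "expectation (\<lambda>\<omega>. 16 ^ (\<Sum>g\<in>K q. N g \<omega>)) = exp (15 * (\<Sum>g\<in>K q. rate g))"
proof -
  have "(\<integral>\<^sup>+\<omega>. ennreal (16 ^ (\<Sum>g\<in>K q. N g \<omega>)) \<partial>M) = (\<integral>\<^sup>+\<omega>. (\<Prod>g\<in>K q. ennreal (16 ^ N g \<omega>)) \<partial>M)"
    by (intro nn_integral_cong) (simp add: power_sum prod_ennreal)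
  also have "\<dots> = (\<Prod>g\<in>K q. \<integral>\<^sup>+\<omega>. ennreal (16 ^ N g \<omega>) \<partial>M)"
    using K q by (intro nn_integral_prod_counts) auto
  also have "\<dots> = (\<Prod>g\<in>K q. ennreal (exp ((16 - 1) * rate g)))"
    using K q by (intro prod.cong refl poisson_exponential_moment poi) auto
  also have "\<dots> = ennreal (exp (15 * (\<Sum>g\<in>K q. rate g)))"
    using finite_K[OF q] by (simp add: prod_ennreal exp_sum sum_distrib_left)
  finally have *: "(\<integral>\<^sup>+\<omega>. ennreal (16 ^ (\<Sum>g\<in>K q. N g \<omega>)) \<partial>M) = ennreal (exp (15 * (\<Sum>g\<in>K q. rate g)))" .
  have "N g \<in> measurable M (count_space UNIV)" if "g \<in> K q" for g
    using that K q measurable_N by blast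
  then have "(\<lambda>\<omega>. \<Sum>g\<in>K q. N g \<omega>) \<in> measurable M (count_space UNIV)"
    by (intro measurable_sum_nat) 
  then have "(\<lambda>\<omega>. 16 ^ (\<Sum>g\<in>K q. N g \<omega>) :: real) \<in> borel_measurable M"
    by (rule measurable_compose) simp
  then show "integrable M (\<lambda>\<omega>. 16 ^ (\<Sum>g\<in>K q. N g \<omega>) :: real)"
    "expectation (\<lambda>\<omega>. 16 ^ (\<Sum>g\<in>K q. N g \<omega>)) = exp (15 * (\<Sum>g\<in>K q. rate g))"
    using * by (subst (asm) nn_integral_eq_integrable; simp)+
qed

lemma root_part_moments:
  assumes q: "q \<in> G"
  shows "integrable M (\<lambda>\<omega>. root_part w R q \<omega> ^ 4)" "integrable M (\<lambda>\<omega>. root_part w R q \<omega> ^ 2)"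
    "integrable M (root_part w R q)"
    "expectation (\<lambda>\<omega>. root_part w R q \<omega> ^ 4) \<le> exp (15 * (\<Sum>g\<in>K q. rate g)) - 1"
    "expectation (\<lambda>\<omega>. root_part w R q \<omega> ^ 2) \<le> exp (15 * (\<Sum>g\<in>K q. rate g)) - 1"
proof -
  let ?m = "\<lambda>\<omega>. \<Sum>g\<in>K q. N g \<omega>"
  note [measurable] = measurable_root_part[OF q]
  have "root_part w R q \<omega> = rooted_sum w R (K q) (\<lambda>g. N g \<omega>) q" for \<omega>
    by (rule rooted_sum_local) (use fin K q in auto)
  then have b: "0 \<le> root_part w R q \<omega>" "root_part w R q \<omega> \<le> 2 ^ ?m \<omega> - 1" for \<omega>
    using rooted_sum_bounds[OF finite_K[OF q] w] by simp_all
  \<comment> \<open>With \<open>a = 2 ^ m\<close> the chain is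
    \<open>x ^ k \<le> (a - 1) ^ k \<le> a ^ k - 1 \<le> a ^ 4 - 1\<close>; its second inequality is
    the superadditivity of powers proved as \<open>p\<close>.\<close>
  have pw: "x ^ 4 \<le> 16 ^ m - 1 \<and> x ^ 2 \<le> 16 ^ m - 1 \<and> x \<le> 16 ^ m - 1"
    if "0 \<le> x" "x \<le> 2 ^ m - 1" for x :: real and m :: nat
  proof -
    define a where "a = (2 :: real) ^ m"
    have a: "1 \<le> a" "x \<le> a - 1" using that by (auto simp: a_def)
    have a4: "16 ^ m = a ^ 4" unfolding a_def by (simp flip: power_mult power_mult_distrib) (simp add: power_mult mult.commute[of m])
    have le: "a ^ 1 \<le> a ^ 4" "a ^ 2 \<le> a ^ 4" using a by (intro power_increasing; simp)+
    have p: "y ^ k + 1 \<le> (y + 1) ^ k" if "0 \<le> y" "1 \<le> k" for y :: real and k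
      using that(2)
    proof (induction k rule: dec_induct)
      case (step k)
      have "y ^ Suc k + 1 \<le> (y + 1) * (y ^ k + 1)" using that(1) by (simp add: algebra_simps)
      also have "\<dots> \<le> (y + 1) * (y + 1) ^ k" using step that(1) by (intro mult_left_mono) auto
      finally show ?case by simp
    qed simp
    have "x ^ k \<le> (a - 1) ^ k" for k using that a by (intro power_mono) auto
    then have "x ^ k \<le> a ^ k - 1" if "k \<ge> 1" for k using p[of "a - 1" k] a that by (smt (verit))
    from this[of 4] this[of 2] this[of 1] show ?thesis unfolding a4 using le by auto
  qed
  have dom: "integrable M (\<lambda>\<omega>. 16 ^ ?m \<omega> - 1 :: real)"
    using exponential_moment_nbhd[OF q] by simp
  have e: "expectation (\<lambda>\<omega>. 16 ^ ?m \<omega> - 1) = exp (15 * (\<Sum>g\<in>K q. rate g)) - 1"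
    using exponential_moment_nbhd[OF q] by (simp add: prob_space)
  have pw': "norm (root_part w R q \<omega> ^ 4) \<le> norm (16 ^ ?m \<omega> - 1 :: real)"
    "norm (root_part w R q \<omega> ^ 2) \<le> norm (16 ^ ?m \<omega> - 1 :: real)"
    "norm (root_part w R q \<omega>) \<le> norm (16 ^ ?m \<omega> - 1 :: real)" for \<omega>
    using pw[OF b[of \<omega>]] b(1)[of \<omega>] by (auto simp: power_abs)
  show i4: "integrable M (\<lambda>\<omega>. root_part w R q \<omega> ^ 4)" 
    by (rule Bochner_Integration.integrable_bound[OF dom]) (use pw' in auto)
  show i2: "integrable M (\<lambda>\<omega>. root_part w R q \<omega> ^ 2)"
    by (rule Bochner_Integration.integrable_bound[OF dom]) (use pw' in auto)
  show "integrable M (root_part w R q)"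
    by (rule Bochner_Integration.integrable_bound[OF dom]) (use pw' in auto)
  show "expectation (\<lambda>\<omega>. root_part w R q \<omega> ^ 4) \<le> exp (15 * (\<Sum>g\<in>K q. rate g)) - 1"
    unfolding e[symmetric] by (rule integral_mono[OF i4 dom]) (use pw b in auto)
  show "expectation (\<lambda>\<omega>. root_part w R q \<omega> ^ 2) \<le> exp (15 * (\<Sum>g\<in>K q. rate g)) - 1"
    unfolding e[symmetric] by (rule integral_mono[OF i2 dom]) (use pw b in auto)
qed

text \<open>Disjoint neighbourhoods make the root parts of one class independent. The sum of fourth
  moments gives \<open>2 * A\<close>, the squared sum of variances gives
  \<open>3 * A ^ 2\<close>.\<close>

lemma centred_class_sum:
  fixes L :: "'z set"
  assumes L: "L \<subseteq> G" "disjoint_family_on K L"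
  defines "D \<equiv> \<lambda>\<omega>. \<Sum>q\<in>L. root_part w R q \<omega> - expectation (root_part w R q)"
    and "A \<equiv> \<Sum>q\<in>L. exp (15 * (\<Sum>g\<in>K q. rate g)) - 1"
  shows "D \<in> borel_measurable M"
    "(\<integral>\<^sup>+\<omega>. ennreal (D \<omega> ^ 4) \<partial>M) \<le> ennreal (2 * A + 3 * A ^ 2)"
proof -
  let ?X = "\<lambda>q. root_part w R q"
  let ?Y = "\<lambda>q \<omega>. ?X q \<omega> - expectation (?X q)"
  let ?b = "\<lambda>q. exp (15 * (\<Sum>g\<in>K q. rate g)) - 1"
  have finL: "finite L" using L fin finite_subset by blast
  have meas: "?X q \<in> borel_measurable M" if "q \<in> L" for q
    using that L by (intro measurable_root_part) auto
  then show "D \<in> borel_measurable M" unfolding D_def by auto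
  have mom: "integrable M (\<lambda>\<omega>. ?Y q \<omega> ^ 4) \<and> expectation (\<lambda>\<omega>. ?Y q \<omega> ^ 4) \<le> 2 * ?b q \<and>
     expectation (\<lambda>\<omega>. ?Y q \<omega> ^ 2) \<le> ?b q \<and> expectation (?Y q) = 0" if "q \<in> L" for q
  proof -
    have q: "q \<in> G" using that L by auto
    note m = root_part_moments[OF q]
    note [measurable] = meas[OF that]
    define e where "e = expectation (?X q)"
    have nn: "0 \<le> ?X q \<omega>" for \<omega> using rooted_sum_bounds[OF fin w] by simp
    then have e0: "0 \<le> e" unfolding e_def by simp
    have var: "expectation (\<lambda>\<omega>. (?X q \<omega> - e)\<^sup>2) = expectation (\<lambda>\<omega>. (?X q \<omega>)\<^sup>2) - e\<^sup>2"
      unfolding e_def using m by (intro variance_eq) auto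
    \<comment> \<open>Nonnegativity of the variance is used for the root part and for its square,
      which yields \<open>e4\<close>. Together with \<open>pb\<close>, centring at most doubles the
      bound on the fourth moment.\<close>
    have e2: "e\<^sup>2 \<le> expectation (\<lambda>\<omega>. (?X q \<omega>)\<^sup>2)"
      using var by (smt (verit) Bochner_Integration.integral_nonneg zero_le_power2)
    have sq4: "(\<lambda>\<omega>. (?X q \<omega> ^ 2) ^ 2) = (\<lambda>\<omega>. ?X q \<omega> ^ 4)" by (simp flip: power_mult)
    have "expectation (\<lambda>\<omega>. (?X q \<omega> ^ 2 - expectation (\<lambda>\<omega>. ?X q \<omega> ^ 2))\<^sup>2) =
      expectation (\<lambda>\<omega>. (?X q \<omega> ^ 2) ^ 2) - (expectation (\<lambda>\<omega>. ?X q \<omega> ^ 2))\<^sup>2"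
      using m by (intro variance_eq) (auto simp: sq4)
    then have "(expectation (\<lambda>\<omega>. ?X q \<omega> ^ 2))\<^sup>2 \<le> expectation (\<lambda>\<omega>. ?X q \<omega> ^ 4)"
      unfolding sq4 by (smt (verit) Bochner_Integration.integral_nonneg zero_le_power2)
    moreover have "(e\<^sup>2)\<^sup>2 \<le> (expectation (\<lambda>\<omega>. ?X q \<omega> ^ 2))\<^sup>2"
      using e2 by (intro power_mono) auto
    ultimately have e4: "e ^ 4 \<le> expectation (\<lambda>\<omega>. ?X q \<omega> ^ 4)"
      by (simp flip: power_mult)
    have pb: "(x - y) ^ 4 \<le> x ^ 4 + y ^ 4" if "0 \<le> x" "0 \<le> y" for x y :: real
    proof -
      have "\<bar>x - y\<bar> ^ 4 \<le> (max x y) ^ 4" using that by (intro power_mono) auto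
      also have "\<dots> \<le> x ^ 4 + y ^ 4" using that by (auto simp: max_def)
      finally show ?thesis by simp
    qed
    have i: "integrable M (\<lambda>\<omega>. ?X q \<omega> ^ 4 + e ^ 4)" using m by simp
    have iY: "integrable M (\<lambda>\<omega>. (?X q \<omega> - e) ^ 4)"
    proof (rule Bochner_Integration.integrable_bound[OF i])
      show "AE \<omega> in M. norm ((?X q \<omega> - e) ^ 4) \<le> norm (?X q \<omega> ^ 4 + e ^ 4)"
        using pb[OF nn e0] by (intro AE_I2) (simp add: power_abs)
    qed simp
    have "expectation (\<lambda>\<omega>. (?X q \<omega> - e) ^ 4) \<le> expectation (\<lambda>\<omega>. ?X q \<omega> ^ 4 + e ^ 4)"
      by (rule integral_mono[OF iY i]) (rule pb[OF nn e0])
    also have "\<dots> = expectation (\<lambda>\<omega>. ?X q \<omega> ^ 4) + e ^ 4" using m by (simp add: prob_space)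
    finally have "expectation (\<lambda>\<omega>. (?X q \<omega> - e) ^ 4) \<le> 2 * ?b q" 
      using add_mono[OF m(4) order_trans[OF e4 m(4)]] by simp
    moreover have "expectation (\<lambda>\<omega>. (?X q \<omega> - e) ^ 2) \<le> ?b q"
      using var m(5) by (smt (verit) zero_le_power2)
    moreover have "expectation (\<lambda>\<omega>. ?X q \<omega> - e) = 0"
      using m unfolding e_def by (simp add: prob_space)
    ultimately show ?thesis using iY by (simp add: e_def)
  qed
  have "indep_vars (\<lambda>_. borel) ?Y L"
    by (rule indep_vars_compose2[OF indep_root_parts[OF L], where Y="\<lambda>q x. x - expectation (?X q)"]) simp
  from sum_centred_moments[OF finL this]
  have S: "integrable M (\<lambda>\<omega>. D \<omega> ^ 4)" "expectation (\<lambda>\<omega>. D \<omega> ^ 4) \<le>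
      (\<Sum>i\<in>L. expectation (\<lambda>\<omega>. ?Y i \<omega> ^ 4)) + 3 * (\<Sum>i\<in>L. expectation (\<lambda>\<omega>. ?Y i \<omega> ^ 2)) ^ 2"
    using mom unfolding D_def by auto
  have "(\<Sum>i\<in>L. expectation (\<lambda>\<omega>. ?Y i \<omega> ^ 4)) \<le> 2 * A"
  proof -
    have "2 * A = (\<Sum>i\<in>L. 2 * ?b i)" unfolding A_def by (rule sum_distrib_left)
    then show ?thesis using mom by (simp only:) (intro sum_mono, blast)
  qed
  moreover have "(\<Sum>i\<in>L. expectation (\<lambda>\<omega>. ?Y i \<omega> ^ 2)) ^ 2 \<le> A ^ 2"
    unfolding A_def using mom by (intro power_mono sum_mono sum_nonneg) auto
  ultimately have "expectation (\<lambda>\<omega>. D \<omega> ^ 4) \<le> 2 * A + 3 * A ^ 2" using S(2) by linarith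
  moreover have "(\<integral>\<^sup>+\<omega>. ennreal (D \<omega> ^ 4) \<partial>M) = ennreal (expectation (\<lambda>\<omega>. D \<omega> ^ 4))"
    using S(1) by (intro nn_integral_eq_integral) auto
  ultimately show "(\<integral>\<^sup>+\<omega>. ennreal (D \<omega> ^ 4) \<partial>M) \<le> ennreal (2 * A + 3 * A ^ 2)"
    by (simp add: ennreal_leI)
qed

text \<open>The mean is written through the nonnegative integral to match the explicit formula of
  \<open>nn_integral_total\<close>. Integrability of the root parts identifies it with the sum of
  their expectations, and the colours only group the terms.\<close>

lemma total_minus_expectation:
  fixes col :: "'z \<Rightarrow> 'c"
  assumes C: "finite C" "col ` G \<subseteq> C"
  shows "total w R \<omega> - enn2real (\<integral>\<^sup>+\<omega>. ennreal (total w R \<omega>) \<partial>M) =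
    (\<Sum>c\<in>C. \<Sum>q\<in>{q\<in>G. col q = c}. root_part w R q \<omega> - expectation (root_part w R q))"
proof -
  have t: "total w R = (\<lambda>\<omega>. \<Sum>q\<in>G. root_part w R q \<omega>)"
    using clique_sum_eq_sum_rooted[OF fin] by (intro ext)
  have i: "integrable M (total w R)"
    unfolding t using root_part_moments by auto
  have nn: "0 \<le> total w R \<omega>" for \<omega>
    unfolding clique_sum_def using w by (intro sum_nonneg)
  have "(\<integral>\<^sup>+\<omega>. ennreal (total w R \<omega>) \<partial>M) = ennreal (expectation (total w R))"
    by (intro nn_integral_eq_integral i) (simp add: nn)
  then have "enn2real (\<integral>\<^sup>+\<omega>. ennreal (total w R \<omega>) \<partial>M) = expectation (total w R)"
    using nn by simp
  also have "\<dots> = (\<Sum>q\<in>G. expectation (root_part w R q))"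
    unfolding t using root_part_moments by simp
  finally have "total w R \<omega> - enn2real (\<integral>\<^sup>+\<omega>. ennreal (total w R \<omega>) \<partial>M) =
    (\<Sum>q\<in>G. root_part w R q \<omega> - expectation (root_part w R q))"
    using fun_cong[OF t, of \<omega>] by (simp add: sum_subtractf)
  also have "\<dots> = (\<Sum>c\<in>C. \<Sum>q\<in>{q\<in>G. col q = c}. root_part w R q \<omega> - expectation (root_part w R q))"
    by (rule sum.group[symmetric]) (use C fin in auto)
  finally show ?thesis .
qed

end

end

section \<open>Averages over the cells of a grid\<close>

definition grid_label :: "real \<Rightarrow> real ^ 'd \<Rightarrow> int ^ 'd" where
  "grid_label l x = (\<chi> i. \<lfloor>x $ i / l\<rfloor>)"

lemma measurable_grid_label[measurable]:
  "grid_label l \<in> measurable borel (count_space (UNIV :: (int ^ 'd) set))"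
proof (subst measurable_count_space_eq_countable, safe)
  fix z :: "int ^ 'd"
  have "grid_label l -` {z} = (\<Inter>i. {x. \<lfloor>x $ i / l\<rfloor> = z $ i})"
    by (auto simp: grid_label_def vec_eq_iff)
  moreover have "{x :: real ^ 'd. \<lfloor>x $ i / l\<rfloor> = z $ i} \<in> sets borel" for i
  proof -
    have [measurable]: "(\<lambda>x :: real ^ 'd. x $ i) \<in> borel_measurable borel"
      by (intro borel_measurable_continuous_onI continuous_intros)
    show ?thesis by measurable
  qed
  ultimately show "grid_label l -` {z} \<inter> space borel \<in> sets borel"
    by auto
qed auto

lemma measurable_grid_label_shift[measurable]:
  "Measurable.pred (borel \<Otimes>\<^sub>M borel)
     (\<lambda>p :: (real ^ 'd) \<times> (real ^ 'd). grid_label l (snd p) = grid_label l (fst p) + v)"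
proof -
  have "(\<lambda>p :: (real ^ 'd) \<times> (real ^ 'd). (grid_label l (fst p), grid_label l (snd p))) \<in>
    measurable (borel \<Otimes>\<^sub>M borel) (count_space UNIV \<Otimes>\<^sub>M count_space UNIV)" by measurable
  then have "(\<lambda>p :: (real ^ 'd) \<times> (real ^ 'd). (grid_label l (fst p), grid_label l (snd p))) \<in>
    measurable (borel \<Otimes>\<^sub>M borel) (count_space UNIV)"
    by (simp add: pair_measure_countable)
  from measurable_compose[OF this, of "\<lambda>q. snd q = fst q + v" "count_space UNIV"] show ?thesis by simp
qed

abbreviation cell :: "real \<Rightarrow> int ^ 'd \<Rightarrow> (real ^ 'd) set" where
  "cell l z \<equiv> {y. grid_label l y = z}"

text \<open>The half-open cube lies between the open and the closed box with the same corners, and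
  these have equal volume.\<close>

lemma emeasure_cell:
  fixes z :: "int ^ 'd"
  assumes l: "0 < l"
  shows "emeasure lborel (cell l z) = ennreal (l ^ CARD('d))"
proof -
  define a :: "real ^ 'd" where "a = (\<chi> i. l * of_int (z $ i))"
  define b :: "real ^ 'd" where "b = a + l *\<^sub>R (\<Sum>Basis)"
  have one: "(\<Sum>Basis :: real ^ 'd) $ i = 1" for i
  proof -
    have "axis i 1 \<in> (Basis :: (real ^ 'd) set)" by simp
    then have "(\<Sum>Basis :: real ^ 'd) \<bullet> axis i 1 = 1" by (simp add: inner_sum_left_Basis)
    then show ?thesis by (simp add: inner_axis)
  qed
  have bi: "b $ i = a $ i + l" for i
    using one[of i] by (simp add: b_def del: sum_component)
  have iff: "grid_label l y = z \<longleftrightarrow> (\<forall>i. a $ i \<le> y $ i \<and> y $ i < b $ i)" for y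
    using l unfolding bi by (auto simp: grid_label_def vec_eq_iff a_def floor_eq_iff field_simps)
  have "(cell l z) \<in> sets borel" by measurable
  moreover have "box a b \<subseteq> (cell l z)" "(cell l z) \<subseteq> cbox a b"
    by (auto simp: iff mem_box_cart less_imp_le)
  ultimately have le: "emeasure lborel (box a b) \<le> emeasure lborel (cell l z)"
    "emeasure lborel (cell l z) \<le> emeasure lborel (cbox a b)"
    by (auto intro!: emeasure_mono)
  have ba: "(b - a) \<bullet> u = l" if "u \<in> Basis" for u
    using that by (simp add: b_def inner_sum_left_Basis)
  have "a \<bullet> u \<le> b \<bullet> u" if "u \<in> Basis" for u using ba[OF that] l by (simp add: inner_diff_left)
  then have "emeasure lborel (box a b) = ennreal (\<Prod>u\<in>Basis. (b - a) \<bullet> u)"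
    "emeasure lborel (cbox a b) = ennreal (\<Prod>u\<in>Basis. (b - a) \<bullet> u)" by simp_all
  moreover have "(\<Prod>u\<in>(Basis :: (real ^ 'd) set). (b - a) \<bullet> u) = l ^ CARD('d)" by (simp add: ba)
  ultimately show ?thesis using le by simp
qed

text \<open>The displacement \<open>v\<close> counts cells: the average is taken \<open>v\<close>
  steps away from the cell of \<open>x\<close>. A product of rates of several neighbouring cells
  thus becomes a product of functions of the single variable \<open>x\<close>.\<close>

definition cell_avg :: "real \<Rightarrow> int ^ 'd \<Rightarrow> (real ^ 'd \<Rightarrow> real) \<Rightarrow> real ^ 'd \<Rightarrow> real" where
  "cell_avg l v g x = (LBINT y. indicator (cell l (grid_label l x + v)) y * g y) / l ^ CARD('d)"

lemma integrable_cell_indicator: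
  fixes g :: "real ^ 'd \<Rightarrow> real"
  assumes "integrable lborel g"
  shows "integrable lborel (\<lambda>y. indicator (cell l z) y * g y)"
  using integrable_mult_indicator[OF _ assms, of "(cell l z)"] by simp

lemma measurable_cell_avg[measurable]:
  fixes g :: "real ^ 'd \<Rightarrow> real"
  assumes [measurable]: "g \<in> borel_measurable borel"
  shows "cell_avg l v g \<in> borel_measurable borel"
proof -
  have "(\<lambda>p. indicator {y. grid_label l y = grid_label l (fst p) + v} (snd p) * g (snd p)) \<in>
    borel_measurable (borel \<Otimes>\<^sub>M lborel)"
    unfolding indicator_def by measurable
  then have "(\<lambda>x. LBINT y. indicator (cell l (grid_label l x + v)) y * g y) \<in> borel_measurable borel"
    by (intro lborel.borel_measurable_lebesgue_integral) (simp add: split_beta')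
  then show ?thesis unfolding cell_avg_def by measurable
qed

text \<open>By Fubini: for fixed \<open>y\<close> the points \<open>x\<close> with
  \<open>grid_label l y = grid_label l x + v\<close> fill exactly one cell, whose volume cancels the
  denominator.\<close>

lemma nn_integral_cell_avg:
  fixes g :: "real ^ 'd \<Rightarrow> real"
  assumes l: "0 < l" and g: "integrable lborel g" "\<And>x. 0 \<le> g x"
  shows "(\<integral>\<^sup>+x. ennreal (cell_avg l v g x) \<partial>lborel) = (\<integral>\<^sup>+x. ennreal (g x) \<partial>lborel)"
proof -
  let ?k = "\<lambda>x y :: real ^ 'd. grid_label l y = grid_label l x + v"
  have [measurable]: "g \<in> borel_measurable borel" using g by simp
  let ?c = "ennreal (1 / l ^ CARD('d))"
  have "(\<integral>\<^sup>+x. ennreal (cell_avg l v g x) \<partial>lborel) =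
    (\<integral>\<^sup>+x. \<integral>\<^sup>+y. ?c * (indicator {p. ?k (fst p) (snd p)} (x, y) * ennreal (g y)) \<partial>lborel \<partial>lborel)"
  proof (intro nn_integral_cong)
    fix x :: "real ^ 'd"
    have "ennreal (cell_avg l v g x) = ?c * ennreal (LBINT y. indicator {y. ?k x y} y * g y)"
      unfolding cell_avg_def using l g by (subst ennreal_mult'[symmetric]) auto
    also have "ennreal (LBINT y. indicator {y. ?k x y} y * g y) =
      (\<integral>\<^sup>+y. ennreal (indicator {y. ?k x y} y * g y) \<partial>lborel)"
      using g by (intro nn_integral_eq_integral[symmetric] integrable_cell_indicator) auto
    also have "\<dots> = (\<integral>\<^sup>+y. indicator {p. ?k (fst p) (snd p)} (x, y) * ennreal (g y) \<partial>lborel)"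
      by (intro nn_integral_cong) (auto simp: indicator_def)
    also have "?c * \<dots> = (\<integral>\<^sup>+y. ?c * (indicator {p. ?k (fst p) (snd p)} (x, y) * ennreal (g y)) \<partial>lborel)"
      by (intro nn_integral_cmult[symmetric]) (simp add: indicator_def)
    finally show "ennreal (cell_avg l v g x) =
      (\<integral>\<^sup>+y. ?c * (indicator {p. ?k (fst p) (snd p)} (x, y) * ennreal (g y)) \<partial>lborel)" .
  qed
  also have "\<dots> = (\<integral>\<^sup>+y. \<integral>\<^sup>+x. ?c * (indicator {p. ?k (fst p) (snd p)} (x, y) * ennreal (g y)) \<partial>lborel \<partial>lborel)"
    by (intro lborel_pair.Fubini'[symmetric]) (simp add: split_beta' indicator_def)
  also have "\<dots> = (\<integral>\<^sup>+y. ennreal (g y) \<partial>lborel)"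
  proof (intro nn_integral_cong)
    fix y :: "real ^ 'd"
    have "(\<integral>\<^sup>+x. ?c * (indicator {p. ?k (fst p) (snd p)} (x, y) * ennreal (g y)) \<partial>lborel) =
      (\<integral>\<^sup>+x. (?c * ennreal (g y)) * indicator {x. grid_label l x = grid_label l y - v} x \<partial>lborel)"
      by (intro nn_integral_cong) (auto simp: indicator_def algebra_simps)
    also have "\<dots> = (?c * ennreal (g y)) * emeasure lborel {x :: real ^ 'd. grid_label l x = grid_label l y - v}"
      by (intro nn_integral_cmult_indicator) measurable
    also have "\<dots> = ennreal (g y)"
      using l g by (simp add: emeasure_cell ennreal_mult'[symmetric])
    finally show "(\<integral>\<^sup>+x. ?c * (indicator {p. ?k (fst p) (snd p)} (x, y) * ennreal (g y)) \<partial>lborel) = ennreal (g y)" .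
  qed
  finally show ?thesis .
qed

lemma cell_avg_nonneg: "0 < l \<Longrightarrow> (\<And>x. 0 \<le> g x) \<Longrightarrow> 0 \<le> cell_avg l v g x"
  unfolding cell_avg_def by (auto intro!: divide_nonneg_pos Bochner_Integration.integral_nonneg)

lemma integrable_cell_avg_nonneg:
  fixes g :: "real ^ 'd \<Rightarrow> real"
  assumes l: "0 < l" and g: "integrable lborel g" "\<And>x. 0 \<le> g x"
  shows "integrable lborel (cell_avg l v g)" "(LBINT x. cell_avg l v g x) = (LBINT x. g x)"
proof -
  have [measurable]: "g \<in> borel_measurable borel" using g by simp
  have "(\<integral>\<^sup>+x. ennreal (cell_avg l v g x) \<partial>lborel) = ennreal (LBINT x. g x)"
    using nn_integral_cell_avg[OF assms] nn_integral_eq_integral[OF g(1)] g by simp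
  then have "integrable lborel (cell_avg l v g) \<and> (LBINT x. cell_avg l v g x) = (LBINT x. g x)"
    using cell_avg_nonneg[OF l, where g=g and v=v] g by (subst nn_integral_eq_integrable[symmetric]) auto
  then show "integrable lborel (cell_avg l v g)" "(LBINT x. cell_avg l v g x) = (LBINT x. g x)"
    by auto
qed

lemma cell_avg_diff:
  fixes g h :: "real ^ 'd \<Rightarrow> real"
  assumes "integrable lborel g" "integrable lborel h"
  shows "cell_avg l v (\<lambda>x. g x - h x) x = cell_avg l v g x - cell_avg l v h x"
  unfolding cell_avg_def using assms
  by (simp add: right_diff_distrib integrable_cell_indicator diff_divide_distrib)

lemma abs_cell_avg_le:
  fixes g :: "real ^ 'd \<Rightarrow> real"
  assumes l: "0 < l" and g: "integrable lborel g"
  shows "\<bar>cell_avg l v g x\<bar> \<le> cell_avg l v (\<lambda>x. \<bar>g x\<bar>) x"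
proof -
  have "\<bar>LBINT y. indicator (cell l (grid_label l x + v)) y * g y\<bar> \<le>
    (LBINT y. \<bar>indicator (cell l (grid_label l x + v)) y * g y\<bar>)"
    by (rule integral_abs_bound)
  also have "\<dots> = (LBINT y. indicator (cell l (grid_label l x + v)) y * \<bar>g y\<bar>)"
    by (simp add: abs_mult)
  finally show ?thesis using l by (simp add: cell_avg_def divide_right_mono)
qed

text \<open>Shifted averaging is an L1 contraction, which allows convergence to be checked on a
  dense class only.\<close>

lemma integrable_cell_avg:
  fixes g :: "real ^ 'd \<Rightarrow> real"
  assumes l: "0 < l" and g: "integrable lborel g"
  shows "integrable lborel (cell_avg l v g)"
    "(LBINT x. \<bar>cell_avg l v g x\<bar>) \<le> (LBINT x. \<bar>g x\<bar>)"
proof -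
  have [measurable]: "g \<in> borel_measurable borel" using g by simp
  note a = integrable_cell_avg_nonneg[OF l, of "\<lambda>x. \<bar>g x\<bar>" v]
  show i: "integrable lborel (cell_avg l v g)"
    by (rule Bochner_Integration.integrable_bound[OF a(1)]) (use g abs_cell_avg_le[OF l g, of v] in \<open>auto intro!: AE_I2 intro: order_trans[OF _ abs_ge_self]\<close>)
  have "(LBINT x. \<bar>cell_avg l v g x\<bar>) \<le> (LBINT x. cell_avg l v (\<lambda>x. \<bar>g x\<bar>) x)"
    by (rule integral_mono) (use i g a abs_cell_avg_le[OF l g] in auto)
  then show "(LBINT x. \<bar>cell_avg l v g x\<bar>) \<le> (LBINT x. \<bar>g x\<bar>)"
    using a g by simp
qed

lemma cell_avg_le:
  fixes g :: "real ^ 'd \<Rightarrow> real"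
  assumes l: "0 < l" and g: "integrable lborel g" "AE x in lborel. g x \<le> C"
  shows "cell_avg l v g x \<le> C"
proof -
  let ?S = "(cell l (grid_label l x + v))"
  have S: "emeasure lborel ?S = ennreal (l ^ CARD('d))" by (rule emeasure_cell[OF l])
  have Sm: "?S \<in> sets lborel" by measurable
  have iS: "integrable lborel (\<lambda>y. indicator ?S y * C)"
    using S Sm by (intro integrable_mult_left integrable_real_indicator) auto
  have "(LBINT y. indicator ?S y * g y) \<le> (LBINT y. indicator ?S y * C)"
    by (rule integral_mono_AE[OF integrable_cell_indicator[OF g(1)] iS])
       (use g(2) in \<open>auto simp: indicator_def\<close>)
  also have "\<dots> = l ^ CARD('d) * C"
    using S Sm l by (simp add: measure_def)
  finally show ?thesis using l by (simp add: cell_avg_def field_simps)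
qed

lemma dist_le_of_grid_label:
  fixes x y :: "real ^ 'd"
  assumes l: "0 < l" and xy: "grid_label l y = grid_label l x + v"
  shows "dist x y \<le> l * (\<Sum>i\<in>UNIV. 1 + \<bar>of_int (v $ i)\<bar>)"
proof -
  have "\<bar>(x - y) $ i\<bar> \<le> l * (1 + \<bar>of_int (v $ i)\<bar>)" for i
  proof -
    have "\<lfloor>y $ i / l\<rfloor> = \<lfloor>x $ i / l\<rfloor> + v $ i"
      using xy by (simp add: grid_label_def vec_eq_iff)
    then have "\<bar>x $ i / l - y $ i / l\<bar> \<le> 1 + \<bar>of_int (v $ i)\<bar>"
      by linarith
    then have "\<bar>(x $ i - y $ i) / l\<bar> \<le> 1 + \<bar>of_int (v $ i)\<bar>" by (simp add: diff_divide_distrib)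
    then show ?thesis using l by (simp add: abs_divide field_simps)
  qed
  then have "(\<Sum>i\<in>UNIV. \<bar>(x - y) $ i\<bar>) \<le> (\<Sum>i\<in>UNIV. l * (1 + \<bar>of_int (v $ i)\<bar>))"
    by (intro sum_mono)
  with norm_le_l1_cart[of "x - y"] show ?thesis
    by (simp add: dist_norm sum_distrib_left)
qed

abbreviation avg_error :: "real \<Rightarrow> int ^ 'd \<Rightarrow> (real ^ 'd \<Rightarrow> real) \<Rightarrow> real" where
  "avg_error l v g \<equiv> LBINT x. \<bar>cell_avg l v g x - g x\<bar>"

context
  fixes l :: "nat \<Rightarrow> real" and v :: "int ^ 'd"
  assumes l: "\<And>n. 0 < l n" "l \<longlonglongrightarrow> 0"
begin

text \<open>By contraction, replacing \<open>g\<close> by \<open>h\<close> costs the L1 distance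
  twice, once inside the average and once outside. Three terms of size \<open>e / 4\<close> leave
  room for the strict inequality.\<close>

lemma cell_avg_tendsto_approx:
  fixes g :: "real ^ 'd \<Rightarrow> real"
  assumes g: "integrable lborel g"
    and a: "\<And>e. 0 < e \<Longrightarrow> \<exists>h. integrable lborel h \<and> (LBINT x. \<bar>g x - h x\<bar>) \<le> e \<and>
       (\<lambda>n. avg_error (l n) v h) \<longlonglongrightarrow> 0"
  shows "(\<lambda>n. avg_error (l n) v g) \<longlonglongrightarrow> 0"
proof (rule order_tendstoI)
  fix e :: real assume "e < 0"
  then show "\<forall>\<^sub>F n in sequentially. e < avg_error (l n) v g"
    by (intro always_eventually allI) (auto intro!: less_le_trans[of e 0] Bochner_Integration.integral_nonneg)
next
  fix e :: real assume e: "0 < e"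
  obtain h where h: "integrable lborel h" "(LBINT x. \<bar>g x - h x\<bar>) \<le> e / 4"
    "(\<lambda>n. avg_error (l n) v h) \<longlonglongrightarrow> 0"
    using a[of "e / 4"] e by auto
  have "\<forall>\<^sub>F n in sequentially. avg_error (l n) v h < e / 4"
    using order_tendstoD(2)[OF h(3), of "e / 4"] e by simp
  then show "\<forall>\<^sub>F n in sequentially. avg_error (l n) v g < e"
  proof eventually_elim
    case (elim n)
    let ?A = "cell_avg (l n) v"
    note ia = integrable_cell_avg[OF l(1)[of n], where v=v]
    have ig: "integrable lborel (\<lambda>x. g x - h x)" using g h by auto
    have "(LBINT x. \<bar>?A g x - g x\<bar>) \<le>
      (\<integral>x. \<bar>?A (\<lambda>x. g x - h x) x\<bar> + \<bar>?A h x - h x\<bar> + \<bar>g x - h x\<bar> \<partial>lborel)"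
      by (rule integral_mono) (use ia g h ig in \<open>auto simp: cell_avg_diff\<close>)
    also have "\<dots> = (LBINT x. \<bar>?A (\<lambda>x. g x - h x) x\<bar>) + (LBINT x. \<bar>?A h x - h x\<bar>) + (LBINT x. \<bar>g x - h x\<bar>)"
      using ia(1)[OF ig] ia(1)[OF h(1)] g h ig by simp
    also have "\<dots> < e" using ia(2)[OF ig] elim h(2) e by linarith
    finally show ?case .
  qed
qed

text \<open>On an open set the averages of the indicator are eventually \<open>1\<close>; as averaging preserves mass,
  the mass outside must vanish, so nothing needs to be known about the boundary.\<close>

lemma cell_avg_tendsto_open:
  assumes U: "open U" "emeasure lborel U < \<infinity>"
  shows "(\<lambda>n. avg_error (l n) v (indicator U)) \<longlonglongrightarrow> 0"
proof -
  let ?A = "\<lambda>n. cell_avg (l n) v (indicator U)"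
  have Um[measurable]: "U \<in> sets borel" using U by simp
  have iU: "integrable lborel (indicator U :: real ^ 'd \<Rightarrow> real)"
    using U by (intro integrable_real_indicator) auto
  have iA: "integrable lborel (?A n)" "(LBINT x. ?A n x) = (LBINT x. indicator U x)" for n
    using integrable_cell_avg_nonneg[OF l(1) iU, where v=v] by auto
  have b: "0 \<le> ?A n x" "?A n x \<le> 1" for n x
    using cell_avg_nonneg[OF l(1), where g="indicator U" and v=v] cell_avg_le[OF l(1) iU, where C=1 and v=v]
    by (auto simp: indicator_def)
  have m: "?A n \<in> borel_measurable lborel" for n using iA by simp
  have iUA: "integrable lborel (\<lambda>x. indicator U x * (1 - ?A n x))" for n
    by (rule Bochner_Integration.integrable_bound[OF iU])
       (use m b in \<open>auto simp: indicator_def intro!: AE_I2\<close>)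
  have lim: "(\<lambda>n. LBINT x. indicator U x * (1 - ?A n x)) \<longlonglongrightarrow> (\<integral>(x :: real ^ 'd). 0 \<partial>lborel)"
  proof (rule integral_dominated_convergence[where w="indicator U"])
    show "AE x in lborel. (\<lambda>n. indicator U x * (1 - ?A n x)) \<longlonglongrightarrow> 0"
    proof (intro AE_I2)
      fix x
      show "(\<lambda>n. indicator U x * (1 - ?A n x)) \<longlonglongrightarrow> 0"
      proof (cases "x \<in> U")
        case True
        then obtain e where e: "e > 0" "\<And>y. dist y x < e \<Longrightarrow> y \<in> U" using U by (auto simp: open_dist)
        have "(\<lambda>n. l n * (\<Sum>i\<in>UNIV. 1 + \<bar>of_int (v $ i)\<bar>)) \<longlonglongrightarrow> 0 * (\<Sum>i\<in>UNIV. 1 + \<bar>of_int (v $ i)\<bar>)"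
          by (intro tendsto_intros l)
        then have "\<forall>\<^sub>F n in sequentially. l n * (\<Sum>i\<in>UNIV. 1 + \<bar>of_int (v $ i)\<bar>) < e"
          using e by (intro order_tendstoD) auto
        then have "\<forall>\<^sub>F n in sequentially. indicator U x * (1 - ?A n x) = 0"
        proof eventually_elim
          case (elim n)
          have "indicator (cell (l n) (grid_label (l n) x + v)) y * indicator U y =
            (indicator (cell (l n) (grid_label (l n) x + v)) y :: real)" for y
          proof -
            have "y \<in> U" if "grid_label (l n) y = grid_label (l n) x + v"
              using dist_le_of_grid_label[OF l(1) that] elim by (intro e(2)) (simp add: dist_commute)
            then show ?thesis by (auto simp: indicator_def)
          qed
          then have "?A n x = (LBINT y. indicator (cell (l n) (grid_label (l n) x + v)) y) / l n ^ CARD('d)"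
            by (simp only: cell_avg_def)
          also have "\<dots> = 1" using l(1)[of n] by (simp add: measure_def emeasure_cell[OF l(1)])
          finally show ?case by simp
        qed
        then show ?thesis by (rule tendsto_eventually)
      qed simp
    qed
  qed (use iU m b in \<open>auto simp: indicator_def\<close>)
  \<comment> \<open>The average and the indicator have the same integral, so the mass lost inside
    \<open>U\<close> equals the mass gained outside; this is the factor 2.\<close>
  have "(LBINT x. \<bar>?A n x - indicator U x\<bar>) = 2 * (LBINT x. indicator U x * (1 - ?A n x))" for n
  proof -
    have "(\<lambda>x. \<bar>?A n x - indicator U x\<bar>) = (\<lambda>x. ?A n x - indicator U x + 2 * (indicator U x * (1 - ?A n x)))"
      using b[of n] by (auto simp: indicator_def fun_eq_iff)
    then show ?thesis using iU iA iUA by simp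
  qed
  moreover have "(\<lambda>n. 2 * (LBINT x. indicator U x * (1 - ?A n x))) \<longlonglongrightarrow> 2 * 0"
    using lim by (intro tendsto_mult tendsto_const) simp
  ultimately show ?thesis by simp
qed

text \<open>Outer regularity passes from open sets to measurable sets of finite measure, linearity
  to simple functions, and L1 approximation to all integrable functions. Convergence in L1 suits the
  means, which are integrals of products of averages.\<close>

lemma cell_avg_tendsto:
  fixes g :: "real ^ 'd \<Rightarrow> real"
  assumes g: "integrable lborel g"
  shows "(\<lambda>n. avg_error (l n) v g) \<longlonglongrightarrow> 0"
  using g
proof (induction rule: integrable_induct)
  case (base A c)
  have "(\<lambda>n. avg_error (l n) v (indicator A)) \<longlonglongrightarrow> 0"
  proof (rule cell_avg_tendsto_approx)
    show iA: "integrable lborel (indicator A :: real ^ 'd \<Rightarrow> real)"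
      using base by (intro integrable_real_indicator) auto
    fix e :: real assume e: "0 < e"
    obtain U where U: "open U" "A \<subseteq> U" "emeasure lborel (U - A) < ennreal e"
      using outer_regular_lborel[of A e] base e by auto
    have [measurable]: "U \<in> sets borel" "A \<in> sets borel" using U base by auto
    have "emeasure lborel U \<le> emeasure lborel (U - A) + emeasure lborel A"
      by (rule order_trans[OF emeasure_mono[of U "(U - A) \<union> A"] emeasure_subadditive]) auto
    also have "\<dots> < \<infinity>" using base U(3) by (auto simp: ennreal_add_eq_top less_top[symmetric])
    finally have fU: "emeasure lborel U < \<infinity>" .
    have "(LBINT x. \<bar>indicator A x - indicator U x\<bar>) = (LBINT x. indicator (U - A) x :: real)"
      using U(2) by (intro Bochner_Integration.integral_cong) (auto simp: indicator_def)
    also have "\<dots> = measure lborel (U - A)" by simp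
    also have "\<dots> \<le> e"
      using U(3) e by (simp add: measure_def enn2real_leI less_imp_le)
    finally show "\<exists>h. integrable lborel h \<and> (LBINT x. \<bar>indicator A x - h x\<bar>) \<le> e \<and>
       (\<lambda>n. avg_error (l n) v h) \<longlonglongrightarrow> 0"
      using cell_avg_tendsto_open[OF U(1) fU] U fU
      by (intro exI[of _ "indicator U"]) (auto intro!: integrable_real_indicator)
  qed
  then have "(\<lambda>n. \<bar>c\<bar> * avg_error (l n) v (indicator A)) \<longlonglongrightarrow> \<bar>c\<bar> * 0"
    by (intro tendsto_intros)
  moreover have "\<bar>c\<bar> * avg_error (l n) v (indicator A) =
     (LBINT x. \<bar>cell_avg (l n) v (\<lambda>x. indicator A x *\<^sub>R c) x - indicator A x *\<^sub>R c\<bar>)" for n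
  proof -
    have "cell_avg (l n) v (\<lambda>x. indicator A x *\<^sub>R c) x = cell_avg (l n) v (indicator A) x * c" for x
      by (simp add: cell_avg_def mult.assoc[symmetric])
    then show ?thesis
      by (simp add: integral_mult_right_zero[symmetric] abs_mult[symmetric] algebra_simps del: Bochner_Integration.integral_mult_right_zero)
  qed
  ultimately show ?case by simp
next
  case (add f g)
  have "(\<lambda>n. avg_error (l n) v f + avg_error (l n) v g) \<longlonglongrightarrow> 0 + 0"
    by (intro tendsto_intros add)
  then have lim: "(\<lambda>n. avg_error (l n) v f + avg_error (l n) v g) \<longlonglongrightarrow> 0"
    by simp
  show ?case
  proof (rule tendsto_sandwich[OF _ _ tendsto_const lim])
    show "\<forall>\<^sub>F n in sequentially. avg_error (l n) v (\<lambda>x. f x + g x) \<le>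
      avg_error (l n) v f + avg_error (l n) v g"
    proof (intro always_eventually allI)
      fix n
      note ia = integrable_cell_avg[OF l(1)[of n], where v=v]
      have ig: "integrable lborel (\<lambda>x. f x + g x)" using add by auto
      have "cell_avg (l n) v (\<lambda>x. f x + g x) x = cell_avg (l n) v f x + cell_avg (l n) v g x" for x
        using cell_avg_diff[OF ig add(1), of "l n" v x] by simp
      then have "avg_error (l n) v (\<lambda>x. f x + g x) \<le>
        (\<integral>x. \<bar>cell_avg (l n) v f x - f x\<bar> + \<bar>cell_avg (l n) v g x - g x\<bar> \<partial>lborel)"
        by (intro integral_mono) (use ia add in auto)
      also have "\<dots> = avg_error (l n) v f + avg_error (l n) v g"
        using ia(1)[OF add(1)] ia(1)[OF add(2)] add by simp
      finally show "avg_error (l n) v (\<lambda>x. f x + g x) \<le>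
      avg_error (l n) v f + avg_error (l n) v g" .
    qed
  qed (auto intro!: always_eventually Bochner_Integration.integral_nonneg)
next
  case (lim f s)
  show ?case
  proof (rule cell_avg_tendsto_approx[OF lim(4)])
    fix e :: real assume e: "0 < e"
    have [measurable]: "f \<in> borel_measurable lborel" "s i \<in> borel_measurable lborel" for i
      using lim(1,4) by auto
    have "(\<lambda>i. LBINT x. \<bar>f x - s i x\<bar>) \<longlonglongrightarrow> (\<integral>(x :: real ^ 'd). 0 \<partial>lborel)"
    proof (rule integral_dominated_convergence[where w="\<lambda>x. 3 * \<bar>f x\<bar>"])
      show "AE x in lborel. (\<lambda>i. \<bar>f x - s i x\<bar>) \<longlonglongrightarrow> 0"
      proof (intro AE_I2)
        fix x
        have "(\<lambda>i. \<bar>f x - s i x\<bar>) \<longlonglongrightarrow> \<bar>f x - f x\<bar>" using lim(2) by (intro tendsto_intros) auto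
        then show "(\<lambda>i. \<bar>f x - s i x\<bar>) \<longlonglongrightarrow> 0" by simp
      qed
      \<comment> \<open>The approximating functions satisfy
        \<open>\<bar>s i x\<bar> \<le> 2 * \<bar>f x\<bar>\<close>, hence the factor 3.\<close>
      show "AE x in lborel. norm \<bar>f x - s i x\<bar> \<le> 3 * \<bar>f x\<bar>" for i
      proof (intro AE_I2)
        fix x show "norm \<bar>f x - s i x\<bar> \<le> 3 * \<bar>f x\<bar>" using lim(3)[of x i] by simp
      qed
    qed (use lim(4) in auto)
    then have "\<forall>\<^sub>F i in sequentially. (LBINT x. \<bar>f x - s i x\<bar>) < e"
      using e by (intro order_tendstoD) auto
    then obtain i where "(LBINT x. \<bar>f x - s i x\<bar>) < e"
      by (auto simp: eventually_sequentially)
    then show "\<exists>h. integrable lborel h \<and> (LBINT x. \<bar>f x - h x\<bar>) \<le> e \<and>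
       (\<lambda>n. avg_error (l n) v h) \<longlonglongrightarrow> 0"
      using lim(1,5) by (intro exI[of _ "s i"]) auto
  qed
qed

end

section \<open>Products of cell intensities\<close>

text \<open>Dividing all factors by \<open>C\<close> reduces to factors of modulus at most 1, where
  a product is 1-Lipschitz in each factor. The extra \<open>C\<close> on the left avoids the
  exponent \<open>card I - 1\<close>.\<close>

lemma abs_prod_diff_le:
  fixes a b :: "'i \<Rightarrow> real"
  assumes "finite I" and C: "0 < C"
    and a: "\<And>i. i \<in> I \<Longrightarrow> \<bar>a i\<bar> \<le> C" and b: "\<And>i. i \<in> I \<Longrightarrow> \<bar>b i\<bar> \<le> C"
  shows "\<bar>(\<Prod>i\<in>I. a i) - (\<Prod>i\<in>I. b i)\<bar> * C \<le> C ^ card I * (\<Sum>i\<in>I. \<bar>a i - b i\<bar>)"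
proof -
  have "norm ((\<Prod>i\<in>I. a i / C) - (\<Prod>i\<in>I. b i / C)) \<le> (\<Sum>i\<in>I. norm (a i / C - b i / C))"
    by (rule norm_prod_diff) (use a b C in auto)
  also have "(\<Prod>i\<in>I. a i / C) - (\<Prod>i\<in>I. b i / C) = ((\<Prod>i\<in>I. a i) - (\<Prod>i\<in>I. b i)) / C ^ card I"
    by (simp add: prod_dividef diff_divide_distrib)
  also have "(\<Sum>i\<in>I. norm (a i / C - b i / C)) = (\<Sum>i\<in>I. \<bar>a i - b i\<bar>) / C"
    using C by (simp add: diff_divide_distrib[symmetric] sum_divide_distrib)
  finally show ?thesis using C by (simp add: field_simps abs_divide)
qed

abbreviation power_moment :: "('a::euclidean_space \<Rightarrow> real) \<Rightarrow> nat \<Rightarrow> real" where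
  "power_moment f k \<equiv> LBINT x. f x ^ Suc k"

text \<open>This is the expected number of points in the cell. Setting it to zero off
  \<open>G\<close> lets sums over translated tuples ignore whether the translates stay inside
  \<open>G\<close>.\<close>

definition cell_rate :: "(real ^ 'd \<Rightarrow> real) \<Rightarrow> real \<Rightarrow> (int ^ 'd) set \<Rightarrow> nat \<Rightarrow> int ^ 'd \<Rightarrow> real" where
  "cell_rate f l G n z =
    (if z \<in> G then real n * (LBINT y. indicator (cell l z) y * f y) else 0)"

text \<open>In the application \<open>l n\<close> is \<open>e * s n\<close> from
  \<open>n = 1\<close> on, so \<open>\<kappa>\<close> is the power \<open>e ^ CARD('d)\<close>. The
  sets \<open>G n\<close> make the family of cells finite while the mass missed by them tends to
  zero.\<close>

locale refining_grid =
  fixes f :: "real ^ 'd \<Rightarrow> real" and C \<kappa> :: real and l :: "nat \<Rightarrow> real" and G :: "nat \<Rightarrow> (int ^ 'd) set"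
  assumes f: "integrable lborel f" "\<And>x. 0 \<le> f x" "(LBINT x. f x) = 1" "AE x in lborel. f x \<le> C"
    and l: "\<And>n. 0 < l n" "l \<longlonglongrightarrow> 0" "(\<lambda>n. real n * l n ^ CARD('d)) \<longlonglongrightarrow> \<kappa>"
    and G: "\<And>n. finite (G n)"
      "(\<lambda>n. LBINT x. indicator {x. grid_label (l n) x \<notin> G n} x * f x) \<longlonglongrightarrow> 0"
begin

abbreviation rate :: "nat \<Rightarrow> int ^ 'd \<Rightarrow> real" where
  "rate n \<equiv> cell_rate f (l n) (G n) n"

lemma rate_nonneg: "0 \<le> rate n z"
  using f(2) by (auto simp: cell_rate_def intro!: mult_nonneg_nonneg Bochner_Integration.integral_nonneg)

abbreviation inside :: "nat \<Rightarrow> real ^ 'd \<Rightarrow> real" where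
  "inside n x \<equiv> indicator {x. grid_label (l n) x \<in> G n} x * f x"

abbreviation outside :: "nat \<Rightarrow> real" where
  "outside n \<equiv> LBINT x. indicator {x. grid_label (l n) x \<notin> G n} x * f x"

lemma integrable_inside:
  "integrable lborel (inside n)"
  using integrable_mult_indicator[OF _ f(1), of "{x. grid_label (l n) x \<in> G n}"] by simp

lemma cell_avg_inside_eq_rate:
  assumes "1 \<le> n"
  shows "cell_avg (l n) v (inside n) x =
    rate n (grid_label (l n) x + v) / (real n * l n ^ CARD('d))"
proof -
  have "indicator (cell (l n) (grid_label (l n) x + v)) y *
      (indicator {x. grid_label (l n) x \<in> G n} y * f y) =
    (if grid_label (l n) x + v \<in> G n then indicator (cell (l n) (grid_label (l n) x + v)) y * f y else 0)" for y
    by (auto simp: indicator_def)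
  then show ?thesis using assms by (simp add: cell_avg_def cell_rate_def)
qed

text \<open>By L1 contraction, cutting \<open>f\<close> off outside the chosen cells changes its
  average by no more than the mass cut off.\<close>

lemma cell_avg_inside_tendsto:
  "(\<lambda>n. LBINT x. \<bar>cell_avg (l n) v (inside n) x - f x\<bar>) \<longlonglongrightarrow> 0"
proof -
  let ?A = "\<lambda>n. cell_avg (l n) v"
  let ?h = "\<lambda>n x. inside n x"
  show ?thesis
  proof (rule tendsto_sandwich[OF _ _ tendsto_const])
    show "(\<lambda>n. outside n + (LBINT x. \<bar>?A n f x - f x\<bar>)) \<longlonglongrightarrow> 0"
      using tendsto_add[OF G(2) cell_avg_tendsto[OF l(1,2) f(1), of v]] by simp
    show "\<forall>\<^sub>F n in sequentially. (LBINT x. \<bar>?A n (?h n) x - f x\<bar>) \<le>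
      outside n + (LBINT x. \<bar>?A n f x - f x\<bar>)"
    proof (intro always_eventually allI)
      fix n
      have io: "integrable lborel (\<lambda>x. ?h n x - f x)" using integrable_inside f by simp
      have i1: "integrable lborel (?A n (?h n))" "integrable lborel (?A n f)"
        by (rule integrable_cell_avg(1)[OF l(1) integrable_inside] integrable_cell_avg(1)[OF l(1) f(1)])+
      have "(LBINT x. \<bar>?A n (?h n) x - f x\<bar>) \<le> (\<integral>x. \<bar>?A n (\<lambda>x. ?h n x - f x) x\<bar> + \<bar>?A n f x - f x\<bar> \<partial>lborel)"
        by (rule integral_mono)
           (use i1 f integrable_inside in \<open>auto simp: cell_avg_diff\<close>)
      also have "\<dots> = (LBINT x. \<bar>?A n (\<lambda>x. ?h n x - f x) x\<bar>) + (LBINT x. \<bar>?A n f x - f x\<bar>)"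
        using integrable_cell_avg(1)[OF l(1) io] integrable_cell_avg(1)[OF l(1) f(1)] f by simp
      also have "\<dots> \<le> (LBINT x. \<bar>?h n x - f x\<bar>) + (LBINT x. \<bar>?A n f x - f x\<bar>)"
        using integrable_cell_avg(2)[OF l(1) io] by simp
      also have "(LBINT x. \<bar>?h n x - f x\<bar>) = outside n"
        using f(2) by (intro Bochner_Integration.integral_cong) (auto simp: indicator_def)
      finally show "(LBINT x. \<bar>?A n (?h n) x - f x\<bar>) \<le>
      outside n + (LBINT x. \<bar>?A n f x - f x\<bar>)" .
    qed
  qed (auto intro!: always_eventually Bochner_Integration.integral_nonneg)
qed

lemma C_pos: "0 < C"
proof (rule ccontr)
  assume *: "\<not> 0 < C"
  have "AE x in lborel. f x = 0" using f(4)
  proof eventually_elim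
    case (elim x) then show ?case using f(2)[of x] * by linarith
  qed
  then have "(LBINT x. f x) = (\<integral>(x :: real ^ 'd). 0 \<partial>lborel)"
    using f(1) by (intro integral_cong_AE) auto
  then show False using f(3) by simp
qed

lemma integrable_power_density: "integrable lborel (\<lambda>x. f x ^ Suc k)"
proof (rule Bochner_Integration.integrable_bound)
  show "integrable lborel (\<lambda>x. C ^ k * f x)" using f by simp
  show "(\<lambda>x. f x ^ Suc k) \<in> borel_measurable lborel" using f(1) by simp
  show "AE x in lborel. norm (f x ^ Suc k) \<le> norm (C ^ k * f x)"
    using f(4)
  proof eventually_elim
    case (elim x)
    have "f x ^ k * f x \<le> C ^ k * f x"
      using f(2)[of x] elim by (intro mult_right_mono power_mono) auto
    then show ?case using f(2)[of x] C_pos by (simp add: abs_mult power_abs mult.commute)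
  qed
qed

lemma integral_power_density_le: "power_moment f k \<le> C ^ k"
proof -
  have "power_moment f k \<le> (LBINT x. C ^ k * f x)"
  proof (rule integral_mono_AE[OF integrable_power_density])
    show "AE x in lborel. f x ^ Suc k \<le> C ^ k * f x"
      using f(4)
    proof eventually_elim
      case (elim x)
      have "f x ^ k * f x \<le> C ^ k * f x"
        using f(2)[of x] elim by (intro mult_right_mono power_mono) auto
      then show ?case by (simp add: mult.commute)
    qed
  qed (use f in auto)
  then show ?thesis using f by simp
qed

text \<open>Up to a power of \<open>n * l n ^ CARD('d)\<close>, the sum over cells is the integral
  of a product of \<open>k + 1\<close> shifted averages of \<open>f\<close>. Each average tends to
  \<open>f\<close> in L1 and all are bounded by \<open>C\<close>, so the shifts disappear in the
  limit and \<open>f ^ Suc k\<close> remains.\<close>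

lemma sum_prod_rate_tendsto:
  fixes v :: "nat \<Rightarrow> int ^ 'd"
  assumes v0: "v 0 = 0"
  shows "(\<lambda>n. (\<Sum>z\<in>G n. \<Prod>i\<le>k. rate n (z + v i)) / real n) \<longlonglongrightarrow> \<kappa> ^ k * power_moment f k"
proof -
  define F where "F n i = cell_avg (l n) (v i) (inside n)" for n i
  have iF: "integrable lborel (F n i)" for n i
    unfolding F_def by (rule integrable_cell_avg(1)[OF l(1) integrable_inside])
  have F0: "0 \<le> F n i x" for n i x
    unfolding F_def using f(2) by (intro cell_avg_nonneg l) auto
  have FC: "F n i x \<le> C" for n i x
    unfolding F_def
  proof (rule cell_avg_le[OF l(1) integrable_inside])
    show "AE x in lborel. inside n x \<le> C"
      using f(4) by eventually_elim (use C_pos in \<open>auto simp: indicator_def\<close>)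
  qed
  have iP: "integrable lborel (\<lambda>x. \<Prod>i\<le>k. F n i x)" for n
  proof (rule Bochner_Integration.integrable_bound)
    show "integrable lborel (\<lambda>x. C ^ k * F n 0 x)" using iF by simp
    show "(\<lambda>x. \<Prod>i\<le>k. F n i x) \<in> borel_measurable lborel"
      using iF by (intro borel_measurable_prod) auto
    show "AE x in lborel. norm (\<Prod>i\<le>k. F n i x) \<le> norm (C ^ k * F n 0 x)"
    proof (intro AE_I2)
      fix x
      have "(\<Prod>i\<le>k. F n i x) = F n 0 x * (\<Prod>i<k. F n (Suc i) x)"
        by (simp add: prod.atMost_shift)
      also have "\<dots> \<le> F n 0 x * (\<Prod>i<k. C)"
        using F0 FC by (intro mult_left_mono prod_mono) auto
      finally have "(\<Prod>i\<le>k. F n i x) \<le> C ^ k * F n 0 x" by (simp add: mult.commute)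
      moreover have "0 \<le> (\<Prod>i\<le>k. F n i x)" using F0 by (intro prod_nonneg) auto
      ultimately show "norm (\<Prod>i\<le>k. F n i x) \<le> norm (C ^ k * F n 0 x)" by simp
    qed
  qed
  have lim: "(\<lambda>n. LBINT x. (\<Prod>i\<le>k. F n i x)) \<longlonglongrightarrow> power_moment f k"
  proof (rule LIM_zero_cancel, rule tendsto_rabs_zero_cancel, rule tendsto_sandwich[OF _ _ tendsto_const])
    have "(\<lambda>n. C ^ k * (\<Sum>i\<le>k. LBINT x. \<bar>F n i x - f x\<bar>)) \<longlonglongrightarrow> C ^ k * (\<Sum>i\<le>k. 0)"
      unfolding F_def by (intro tendsto_mult tendsto_const tendsto_sum cell_avg_inside_tendsto)
    then show "(\<lambda>n. C ^ k * (\<Sum>i\<le>k. LBINT x. \<bar>F n i x - f x\<bar>)) \<longlonglongrightarrow> 0" by simp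
    show "\<forall>\<^sub>F n in sequentially. \<bar>(LBINT x. (\<Prod>i\<le>k. F n i x)) - power_moment f k\<bar> \<le>
      C ^ k * (\<Sum>i\<le>k. LBINT x. \<bar>F n i x - f x\<bar>)"
    proof (intro always_eventually allI)
      fix n
      have "\<bar>(LBINT x. (\<Prod>i\<le>k. F n i x)) - power_moment f k\<bar> =
        \<bar>\<integral>x. (\<Prod>i\<le>k. F n i x) - f x ^ Suc k \<partial>lborel\<bar>"
        using iP integrable_power_density by (subst Bochner_Integration.integral_diff) auto
      also have "\<dots> \<le> (LBINT x. \<bar>(\<Prod>i\<le>k. F n i x) - f x ^ Suc k\<bar>)" by (rule integral_abs_bound)
      also have "\<dots> \<le> (LBINT x. C ^ k * (\<Sum>i\<le>k. \<bar>F n i x - f x\<bar>))"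
      proof (rule integral_mono_AE)
        show "AE x in lborel. \<bar>(\<Prod>i\<le>k. F n i x) - f x ^ Suc k\<bar> \<le> C ^ k * (\<Sum>i\<le>k. \<bar>F n i x - f x\<bar>)"
          using f(4)
        proof eventually_elim
          case (elim x)
          have "\<bar>(\<Prod>i\<le>k. F n i x) - (\<Prod>i\<le>k. f x)\<bar> * C \<le> C ^ card {..k} * (\<Sum>i\<le>k. \<bar>F n i x - f x\<bar>)"
            by (rule abs_prod_diff_le) (use C_pos F0 FC f(2)[of x] elim in auto)
          then show ?case using C_pos by (simp add: mult.assoc)
        qed
        show "integrable lborel (\<lambda>x. \<bar>(\<Prod>i\<le>k. F n i x) - f x ^ Suc k\<bar>)"
          by (intro integrable_abs Bochner_Integration.integrable_diff iP integrable_power_density)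
        show "integrable lborel (\<lambda>x. C ^ k * (\<Sum>i\<le>k. \<bar>F n i x - f x\<bar>))"
          using iF f by (intro integrable_mult_right Bochner_Integration.integrable_sum integrable_abs Bochner_Integration.integrable_diff)
      qed
      also have "\<dots> = C ^ k * (\<Sum>i\<le>k. LBINT x. \<bar>F n i x - f x\<bar>)"
        using iF f by (simp add: Bochner_Integration.integral_sum)
      finally show "\<bar>(LBINT x. (\<Prod>i\<le>k. F n i x)) - power_moment f k\<bar> \<le>
        C ^ k * (\<Sum>i\<le>k. LBINT x. \<bar>F n i x - f x\<bar>)" .
    qed
  qed auto
  \<comment> \<open>The product is constant on cells, so its integral is a sum over cells. Every
    average is a rate divided by \<open>c\<close>, and the cell volume turns one of the
    \<open>k + 1\<close> factors \<open>c\<close> into \<open>n\<close>.\<close>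
  have eq: "(real n * l n ^ CARD('d)) ^ k * (LBINT x. (\<Prod>i\<le>k. F n i x)) =
    (\<Sum>z\<in>G n. \<Prod>i\<le>k. rate n (z + v i)) / real n" if n: "1 \<le> n" for n
  proof -
    define c where "c = real n * l n ^ CARD('d)"
    have c: "0 < c" using n l(1)[of n] by (simp add: c_def)
    have "(\<Prod>i\<le>k. F n i x) = (\<Sum>z\<in>G n. indicator (cell (l n) z) x *
        ((\<Prod>i\<le>k. rate n (z + v i)) / c ^ Suc k))" for x
    proof -
      have "(\<Prod>i\<le>k. F n i x) = (\<Prod>i\<le>k. rate n (grid_label (l n) x + v i)) / c ^ Suc k"
        unfolding F_def cell_avg_inside_eq_rate[OF n] c_def[symmetric] by (simp add: prod_dividef)
      also have "\<dots> = (\<Sum>z\<in>G n. if grid_label (l n) x = z then (\<Prod>i\<le>k. rate n (z + v i)) / c ^ Suc k else 0)"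
      proof (cases "grid_label (l n) x \<in> G n")
        case True then show ?thesis by (simp add: G(1))
      next
        case False
        \<comment> \<open>Since \<open>v 0 = 0\<close>, the factor at the cell of \<open>x\<close>
          itself vanishes off \<open>G n\<close>; therefore the sum over \<open>G n\<close> captures
          the whole integral.\<close>
        then have "rate n (grid_label (l n) x + v 0) = 0" by (simp add: v0 cell_rate_def)
        then have "(\<Prod>i\<le>k. rate n (grid_label (l n) x + v i)) = 0" by (intro prod_zero) auto
        then show ?thesis using False by (simp add: G(1))
      qed
      also have "\<dots> = (\<Sum>z\<in>G n. indicator (cell (l n) z) x * ((\<Prod>i\<le>k. rate n (z + v i)) / c ^ Suc k))"
        by (intro sum.cong) (auto simp: indicator_def)
      finally show ?thesis .
    qed
    then have "(LBINT x. (\<Prod>i\<le>k. F n i x)) = (LBINT x. (\<Sum>z\<in>G n. indicator (cell (l n) z) x *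
        ((\<Prod>i\<le>k. rate n (z + v i)) / c ^ Suc k)))" by simp
    also have "\<dots> = (\<Sum>z\<in>G n. LBINT x. indicator (cell (l n) z) x *
        ((\<Prod>i\<le>k. rate n (z + v i)) / c ^ Suc k))"
    proof (rule Bochner_Integration.integral_sum)
      fix z
      show "integrable lborel (\<lambda>x. indicator (cell (l n) z) x *
        ((\<Prod>i\<le>k. rate n (z + v i)) / c ^ Suc k))"
        by (intro integrable_mult_left integrable_real_indicator) (auto simp: emeasure_cell[OF l(1)])
    qed
    also have "\<dots> = (\<Sum>z\<in>G n. l n ^ CARD('d) * ((\<Prod>i\<le>k. rate n (z + v i)) / c ^ Suc k))"
      using l(1)[of n] by (intro sum.cong refl) (simp add: measure_def emeasure_cell[OF l(1)])
    also have "\<dots> = (\<Sum>z\<in>G n. \<Prod>i\<le>k. rate n (z + v i)) * (l n ^ CARD('d) / c ^ Suc k)"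
      by (simp add: sum_distrib_right sum_distrib_left mult.commute)
    finally have "c ^ k * (LBINT x. (\<Prod>i\<le>k. F n i x)) =
       (\<Sum>z\<in>G n. \<Prod>i\<le>k. rate n (z + v i)) * (c ^ k * (l n ^ CARD('d) / c ^ Suc k))" by simp
    also have "c ^ k * (l n ^ CARD('d) / c ^ Suc k) = l n ^ CARD('d) / c" using c by simp
    also have "\<dots> = 1 / real n" using n l(1)[of n] by (simp add: c_def)
    finally show ?thesis by (simp add: c_def)
  qed
  have "(\<lambda>n. (real n * l n ^ CARD('d)) ^ k * (LBINT x. (\<Prod>i\<le>k. F n i x))) \<longlonglongrightarrow>
    \<kappa> ^ k * power_moment f k"
    by (intro tendsto_intros lim l(3))
  then show ?thesis
    by (rule Lim_transform_eventually) (use eq in \<open>auto intro!: eventually_sequentiallyI[of 1]\<close>)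
qed

end

section \<open>The limiting mean\<close>

text \<open>These represent the ordered adjacent tuples of lattice cells modulo translation, with
  the first entry moved to the origin.\<close>

definition rooted_tuples :: "('z :: ab_group_add \<Rightarrow> 'z \<Rightarrow> bool) \<Rightarrow> nat \<Rightarrow> (nat \<Rightarrow> 'z) set" where
  "rooted_tuples R k = {v \<in> {..k} \<rightarrow>\<^sub>E UNIV. v 0 = 0 \<and> tuple_pairwise R k v}"

text \<open>All entries but the root are either in \<open>D\<close> by adjacency to the origin or
  beyond \<open>k\<close> and fixed. The growth is exponential in \<open>k\<close>, so the factorial
  in \<open>weight\<close> dominates it.\<close>

lemma rooted_tuples_card_le:
  assumes D: "finite D" "\<And>a. R a 0 \<Longrightarrow> a \<in> D"
  shows "finite (rooted_tuples R k)" "card (rooted_tuples R k) \<le> card D ^ k"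
proof -
  let ?E = "PiE {..k} (\<lambda>i. if i = 0 then {0} else D)"
  have sub: "rooted_tuples R k \<subseteq> ?E"
  proof
    fix v assume v: "v \<in> rooted_tuples R k"
    have "v i \<in> (if i = 0 then {0} else D)" if "i \<le> k" for i
    proof (cases "i = 0")
      case False
      moreover have "tuple_pairwise R k v"
        using v unfolding rooted_tuples_def by blast
      ultimately have "R (v i) (v 0)" using that by blast
      then show ?thesis using False v D(2)[of "v i"] by (simp add: rooted_tuples_def)
    qed (use v in \<open>simp add: rooted_tuples_def\<close>)
    then show "v \<in> ?E" using v by (auto simp: rooted_tuples_def PiE_iff)
  qed
  have fE: "finite ?E" using D by (intro finite_PiE) auto
  show "finite (rooted_tuples R k)" using sub fE by (rule finite_subset)
  have "card ?E = (\<Prod>i\<le>k. card (if i = 0 then {0} else D))" by (simp add: card_PiE)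
  also have "\<dots> = card D ^ k" by (simp add: prod.atMost_shift)
  finally show "card (rooted_tuples R k) \<le> card D ^ k"
    using card_mono[OF fE sub] by simp
qed

context refining_grid
begin

lemma sum_rate_le: "(\<Sum>z\<in>G n. rate n z) \<le> real n"
proof -
  have e: "(\<Sum>z\<in>G n. rate n z) = real n * (\<Sum>z\<in>G n. LBINT y. indicator (cell (l n) z) y * f y)"
    by (simp add: cell_rate_def sum_distrib_left)
  have "(\<Sum>z\<in>G n. LBINT y. indicator (cell (l n) z) y * f y) =
    (LBINT y. (\<Sum>z\<in>G n. indicator (cell (l n) z) y * f y))"
    using f by (intro Bochner_Integration.integral_sum[symmetric] integrable_cell_indicator)
  also have "\<dots> \<le> (LBINT y. f y)"
  proof (rule integral_mono)
    show "integrable lborel (\<lambda>y. \<Sum>z\<in>G n. indicator (cell (l n) z) y * f y)"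
      using f by (intro Bochner_Integration.integrable_sum integrable_cell_indicator)
    fix y
    have "(\<Sum>z\<in>G n. indicator (cell (l n) z) y * f y) =
      (\<Sum>z\<in>G n. if grid_label (l n) y = z then f y else 0)"
      by (intro sum.cong) (auto simp: indicator_def)
    then show "(\<Sum>z\<in>G n. indicator (cell (l n) z) y * f y) \<le> f y"
      using f(2) by (simp add: G(1))
  qed (use f in auto)
  finally show ?thesis unfolding e f(3) using mult_left_mono[of _ 1 "real n"] by simp
qed

lemma rate_le: "rate n z \<le> C * (real n * l n ^ CARD('d))"
proof -
  \<comment> \<open>The displacement is chosen so that the average is taken over the cell
    \<open>z\<close>, wherever \<open>x\<close> lies.\<close>
  have "cell_avg (l n) (z - grid_label (l n) x) f x \<le> C" for x
    by (rule cell_avg_le[OF l(1) f(1) f(4)])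
  then have "(LBINT y. indicator (cell (l n) z) y * f y) \<le> C * l n ^ CARD('d)"
    using l(1)[of n] by (simp add: cell_avg_def field_simps)
  then have "real n * (LBINT y. indicator (cell (l n) z) y * f y) \<le> real n * (C * l n ^ CARD('d))"
    by (intro mult_left_mono) auto
  then show ?thesis
    using C_pos l(1)[of n] by (auto simp: cell_rate_def mult_ac)
qed

lemma rate_bounded: "\<exists>B>0. \<forall>n z. rate n z \<le> B"
proof -
  obtain K where K: "K > 0" "\<And>n. \<bar>real n * l n ^ CARD('d)\<bar> \<le> K"
    using convergent_imp_Bseq[OF convergentI[OF l(3)]] by (auto simp: Bseq_def)
  have "rate n z \<le> C * K" for n z
  proof -
    have "real n * l n ^ CARD('d) \<le> K" using K(2)[of n] by linarith
    then have "C * (real n * l n ^ CARD('d)) \<le> C * K" using C_pos by (intro mult_left_mono) auto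
    then show ?thesis using rate_le[of n z] by linarith
  qed
  then show ?thesis using C_pos K by (intro exI[of _ "C * K"]) auto
qed

context
  fixes R :: "int ^ 'd \<Rightarrow> int ^ 'd \<Rightarrow> bool" and D :: "(int ^ 'd) set"
  assumes R: "\<And>a b c. R (a + c) (b + c) = R a b"
    and D: "finite D" "\<And>a. R a 0 \<Longrightarrow> a \<in> D"
begin

abbreviation tuple_sum :: "nat \<Rightarrow> nat \<Rightarrow> real" where
  "tuple_sum n k \<equiv> \<Sum>z\<in>clique_tuples R k (G n). \<Prod>i\<le>k. rate n (z i)"

text \<open>A tuple corresponds to its root together with the differences to the root. On the right
  there are also pairs for which some \<open>z + v i\<close> leaves \<open>G n\<close>, and these
  contribute zero because the rate vanishes there.\<close>

lemma tuple_sum_eq: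
  "tuple_sum n k = (\<Sum>v\<in>rooted_tuples R k. \<Sum>z\<in>G n. \<Prod>i\<le>k. rate n (z + v i))"
proof -
  let ?T = "rooted_tuples R k \<times> G n"
  let ?T' = "{(v, z). (v, z) \<in> ?T \<and> (\<exists>i\<le>k. z + v i \<notin> G n)}"
  have fT: "finite ?T" using rooted_tuples_card_le(1)[of D R k] D G(1) by auto
  have "tuple_sum n k = (\<Sum>(v, z)\<in>?T. \<Prod>i\<le>k. rate n (z + v i))"
  proof (rule sum.reindex_bij_witness_not_neutral[where S'="{}" and T'="?T'"
        and j="\<lambda>z. (restrict (\<lambda>i. z i - z 0) {..k}, z 0)" and i="\<lambda>(v, z). restrict (\<lambda>i. z + v i) {..k}"])
    show "finite ?T'" by (rule finite_subset[OF _ fT]) auto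
    fix z assume z: "z \<in> clique_tuples R k (G n) - {}"
    then have zG: "\<And>i. i \<le> k \<Longrightarrow> z i \<in> G n" by (auto simp: clique_tuples_def)
    show "(case (restrict (\<lambda>i. z i - z 0) {..k}, z 0) of (v, z) \<Rightarrow> restrict (\<lambda>i. z + v i) {..k}) = z"
      using z by (auto simp: clique_tuples_def PiE_def extensional_def restrict_def fun_eq_iff)
    have "R (z i - z 0) (z j - z 0) = R (z i) (z j)" for i j
      using R[of "z i" "- z 0" "z j"] by simp
    then have "restrict (\<lambda>i. z i - z 0) {..k} \<in> rooted_tuples R k"
      using z by (auto simp: clique_tuples_def rooted_tuples_def)
    then show "(restrict (\<lambda>i. z i - z 0) {..k}, z 0) \<in> ?T - ?T'"
      using zG by auto
  next
    fix p assume p: "p \<in> ?T - ?T'"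
    obtain v z where [simp]: "p = (v, z)" by (cases p)
    have v: "v \<in> rooted_tuples R k" and z: "z \<in> G n" and vz: "\<And>i. i \<le> k \<Longrightarrow> z + v i \<in> G n"
      using p by auto
    have v0: "v 0 = 0" using v by (simp add: rooted_tuples_def)
    show "(restrict (\<lambda>i. (case p of (v, z) \<Rightarrow> restrict (\<lambda>i. z + v i) {..k}) i -
        (case p of (v, z) \<Rightarrow> restrict (\<lambda>i. z + v i) {..k}) 0) {..k},
        (case p of (v, z) \<Rightarrow> restrict (\<lambda>i. z + v i) {..k}) 0) = p"
      using v v0 by (auto simp: rooted_tuples_def PiE_def extensional_def restrict_def fun_eq_iff)
    have "R (z + v i) (z + v j) = R (v i) (v j)" for i j
      using R[of "v i" z "v j"] by (simp add: add.commute)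
    then show "(case p of (v, z) \<Rightarrow> restrict (\<lambda>i. z + v i) {..k}) \<in> clique_tuples R k (G n) - {}"
      using v vz by (auto simp: clique_tuples_def rooted_tuples_def)
  next
    fix p assume "p \<in> ?T'"
    then obtain v z i where p: "p = (v, z)" "i \<le> k" "z + v i \<notin> G n" by auto
    then have "rate n (z + v i) = 0" by (simp add: cell_rate_def)
    then show "(case p of (v, z) \<Rightarrow> \<Prod>i\<le>k. rate n (z + v i)) = 0"
      using p by (auto intro!: prod_zero)
  qed (auto intro!: prod.cong)
  then show ?thesis by (simp add: sum.cartesian_product)
qed

lemma tuple_sum_tendsto:
  "(\<lambda>n. tuple_sum n k / real n) \<longlonglongrightarrow>
    real (card (rooted_tuples R k)) * \<kappa> ^ k * power_moment f k"
proof -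
  have "(\<lambda>n. \<Sum>v\<in>rooted_tuples R k. (\<Sum>z\<in>G n. \<Prod>i\<le>k. rate n (z + v i)) / real n) \<longlonglongrightarrow>
    (\<Sum>v\<in>rooted_tuples R k. \<kappa> ^ k * power_moment f k)"
    by (intro tendsto_sum sum_prod_rate_tendsto) (auto simp: rooted_tuples_def)
  then show ?thesis by (simp add: tuple_sum_eq sum_divide_distrib mult.assoc)
qed

text \<open>The rate at the root is kept for the summation over cells, which yields
  \<open>n\<close>; each of the other \<open>k\<close> rates is bounded by \<open>B\<close>.\<close>

lemma tuple_sum_bounds:
  assumes B: "\<And>n z. rate n z \<le> B"
  shows "0 \<le> tuple_sum n k" "tuple_sum n k \<le> real n * (real (card D) * B) ^ k"
proof -
  have B0: "0 \<le> B" using B[of 0 0] rate_nonneg[of 0 0] by linarith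
  show "0 \<le> tuple_sum n k" by (intro sum_nonneg prod_nonneg) (auto simp: rate_nonneg)
  have "tuple_sum n k \<le> (\<Sum>v\<in>rooted_tuples R k. real n * B ^ k)"
    unfolding tuple_sum_eq
  proof (rule sum_mono)
    fix v assume v: "v \<in> rooted_tuples R k"
    have "(\<Sum>z\<in>G n. \<Prod>i\<le>k. rate n (z + v i)) \<le> (\<Sum>z\<in>G n. rate n z * B ^ k)"
    proof (rule sum_mono)
      fix z
      have "(\<Prod>i\<le>k. rate n (z + v i)) = rate n z * (\<Prod>i<k. rate n (z + v (Suc i)))"
        using v by (simp add: prod.atMost_shift rooted_tuples_def)
      also have "\<dots> \<le> rate n z * (\<Prod>i<k. B)"
        using B rate_nonneg by (intro mult_left_mono prod_mono) auto
      finally show "(\<Prod>i\<le>k. rate n (z + v i)) \<le> rate n z * B ^ k" by simp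
    qed
    also have "\<dots> \<le> real n * B ^ k"
      using sum_rate_le B0 by (simp add: sum_distrib_right[symmetric] mult_right_mono)
    finally show "(\<Sum>z\<in>G n. \<Prod>i\<le>k. rate n (z + v i)) \<le> real n * B ^ k" .
  qed
  also have "\<dots> = real (card (rooted_tuples R k)) * (real n * B ^ k)" by simp
  also have "\<dots> \<le> real (card D ^ k) * (real n * B ^ k)"
    using rooted_tuples_card_le(2)[of D R k] D B0 by (intro mult_right_mono of_nat_mono) auto
  finally show "tuple_sum n k \<le> real n * (real (card D) * B) ^ k"
    by (simp add: power_mult_distrib mult_ac)
qed

text \<open>The terms divided by \<open>n\<close> are dominated, uniformly in \<open>n\<close>, by
  those of the exponential series at \<open>card D * B\<close>. Tannery's theorem then permits the
  limit term by term.\<close>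

lemma mean_tendsto:
  assumes w: "\<And>n. 0 \<le> w n" "\<And>n. w n \<le> 1"
  shows "summable (\<lambda>k. weight w k * tuple_sum n k)"
    "(\<lambda>n. (\<Sum>k. weight w k * tuple_sum n k) / real n) \<longlonglongrightarrow>
      (\<Sum>k. weight w k * (real (card (rooted_tuples R k)) * \<kappa> ^ k * power_moment f k))"
    "summable (\<lambda>k. weight w k * (real (card (rooted_tuples R k)) * \<kappa> ^ k * power_moment f k))"
proof -
  obtain B where B: "\<And>n z. rate n z \<le> B" "0 < B" using rate_bounded by auto
  define h where "h k = (real (card D) * B) ^ k /\<^sub>R fact k" for k
  have sh: "summable h" unfolding h_def by (rule summable_exp_generic)
  have h0: "0 \<le> h k" for k using B(2) by (simp add: h_def)
  have b: "weight w k * tuple_sum n k \<le> real n * h k" for n k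
  proof -
    have "weight w k \<le> 1 / fact k"
      using w[of "Suc k"] by (intro frac_le) (auto intro: fact_mono)
    then have "weight w k * tuple_sum n k \<le> 1 / fact k * (real n * (real (card D) * B) ^ k)"
      using tuple_sum_bounds[OF B(1)] w by (intro mult_mono) auto
    then show ?thesis by (simp add: h_def field_simps)
  qed
  have nn: "0 \<le> weight w k * tuple_sum n k" for n k
    using w tuple_sum_bounds(1)[OF B(1)] by (intro mult_nonneg_nonneg) auto
  show s: "summable (\<lambda>k. weight w k * tuple_sum n k)" for n
    by (rule summable_comparison_test'[OF summable_mult[OF sh, of "real n"], of 0])
       (use b nn in \<open>simp only: real_norm_def abs_of_nonneg\<close>)
  have T: "eventually (\<lambda>n. summable (\<lambda>k. norm (weight w k * (tuple_sum n k / real n)))) sequentially \<and>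
      summable (\<lambda>k. norm (weight w k * (real (card (rooted_tuples R k)) * \<kappa> ^ k * power_moment f k))) \<and>
      (\<lambda>n. \<Sum>k. weight w k * (tuple_sum n k / real n)) \<longlonglongrightarrow>
      (\<Sum>k. weight w k * (real (card (rooted_tuples R k)) * \<kappa> ^ k * power_moment f k))"
  proof (rule tannerys_theorem[OF _ _ sh])
    show "(\<lambda>n. weight w k * (tuple_sum n k / real n)) \<longlonglongrightarrow>
      weight w k * (real (card (rooted_tuples R k)) * \<kappa> ^ k * power_moment f k)" for k
      by (intro tendsto_mult tendsto_const tuple_sum_tendsto)
    have "norm (weight w k * (tuple_sum n k / real n)) \<le> h k" for k n
    proof (cases "n = 0")
      case True then show ?thesis using h0 by simp
    next
      case False
      then have "weight w k * tuple_sum n k / real n \<le> h k"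
        using b[of k n] by (simp add: field_simps del: fact_Suc)
      moreover have "0 \<le> weight w k * tuple_sum n k / real n"
        using nn[of k n] by (intro divide_nonneg_nonneg) auto
      ultimately show ?thesis by (simp del: fact_Suc)
    qed
    then show "\<forall>\<^sub>F (k, n) in at_top \<times>\<^sub>F sequentially. norm (weight w k * (tuple_sum n k / real n)) \<le> h k"
      by (intro always_eventually) auto
  qed simp
  then show "summable (\<lambda>k. weight w k * (real (card (rooted_tuples R k)) * \<kappa> ^ k * power_moment f k))"
    by (auto intro: summable_norm_cancel)
  have "(\<Sum>k. weight w k * (tuple_sum n k / real n)) =
    (\<Sum>k. weight w k * tuple_sum n k) / real n" for n
    using suminf_divide[OF s[of n], of "real n"] by simp
  then show "(\<lambda>n. (\<Sum>k. weight w k * tuple_sum n k) / real n) \<longlonglongrightarrow>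
      (\<Sum>k. weight w k * (real (card (rooted_tuples R k)) * \<kappa> ^ k * power_moment f k))"
    using T by simp
qed

end

end

section \<open>Comparing the grid with the Rips complex\<close>

text \<open>It compares the lower corners of two cells after dividing all lengths by
  \<open>s n\<close>, hence does not depend on \<open>n\<close>. For negative \<open>u\<close>
  nothing is adjacent, not even a cell to itself.\<close>

definition grid_adj :: "real \<Rightarrow> real \<Rightarrow> int ^ 'd \<Rightarrow> int ^ 'd \<Rightarrow> bool" where
  "grid_adj e u a b \<longleftrightarrow> e * norm (\<chi> i. real_of_int (a $ i - b $ i)) \<le> 2 * u"

lemma grid_adj_translate: "grid_adj e u (a + c) (b + c) = grid_adj e u a b"
  by (simp add: grid_adj_def)

lemma finite_vec_components:
  assumes "finite S"
  shows "finite {a :: 'b ^ 'd. \<forall>i. a $ i \<in> S}"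
proof (rule finite_subset)
  show "finite (vec_lambda ` (UNIV \<rightarrow>\<^sub>E S) :: ('b ^ 'd) set)"
    using assms by (intro finite_imageI finite_PiE) auto
  show "{a :: 'b ^ 'd. \<forall>i. a $ i \<in> S} \<subseteq> vec_lambda ` (UNIV \<rightarrow>\<^sub>E S)"
  proof
    fix a :: "'b ^ 'd" assume "a \<in> {a. \<forall>i. a $ i \<in> S}"
    then have "a = vec_lambda (($) a)" "(($) a) \<in> UNIV \<rightarrow>\<^sub>E S" by auto
    then show "a \<in> vec_lambda ` (UNIV \<rightarrow>\<^sub>E S)" by blast
  qed
qed

lemma grid_adj_component_le:
  assumes e: "0 < e" and "grid_adj e u a b"
  shows "\<bar>a $ i - b $ i\<bar> \<le> \<lceil>2 * u / e\<rceil>"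
proof -
  have "\<bar>real_of_int (a $ i - b $ i)\<bar> \<le> norm (\<chi> i. real_of_int (a $ i - b $ i))"
    using component_le_norm_cart[of "\<chi> i. real_of_int (a $ i - b $ i)" i] by simp
  also have "\<dots> \<le> 2 * u / e" using assms by (simp add: grid_adj_def field_simps)
  finally show ?thesis by linarith
qed

text \<open>The fractional parts of two numbers differ by at most 1, so each coordinate contributes
  an error of at most \<open>l\<close>, and the l1 norm bounds the Euclidean one.\<close>

lemma dist_grid_label:
  fixes x y :: "real ^ 'd"
  assumes l: "0 < l"
  shows "\<bar>dist x y - l * norm (\<chi> i. real_of_int (grid_label l x $ i - grid_label l y $ i))\<bar> \<le> l * CARD('d)"
proof -
  let ?w = "l *\<^sub>R (\<chi> i. real_of_int (grid_label l x $ i - grid_label l y $ i)) :: real ^ 'd"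
  have c: "\<bar>(x - y - ?w) $ i\<bar> \<le> l" for i
  proof -
    have "\<bar>x $ i / l - y $ i / l - real_of_int (\<lfloor>x $ i / l\<rfloor> - \<lfloor>y $ i / l\<rfloor>)\<bar> \<le> 1" by linarith
    then have "\<bar>l * (x $ i / l - y $ i / l - real_of_int (\<lfloor>x $ i / l\<rfloor> - \<lfloor>y $ i / l\<rfloor>))\<bar> \<le> l * 1"
      unfolding abs_mult using l by (intro mult_mono) auto
    also have "l * (x $ i / l - y $ i / l - real_of_int (\<lfloor>x $ i / l\<rfloor> - \<lfloor>y $ i / l\<rfloor>)) = (x - y - ?w) $ i"
      using l by (simp add: grid_label_def algebra_simps)
    finally show ?thesis by simp
  qed
  have "\<bar>norm (x - y) - norm ?w\<bar> \<le> norm (x - y - ?w)" by (rule norm_triangle_ineq3)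
  also have "\<dots> \<le> (\<Sum>i\<in>UNIV. \<bar>(x - y - ?w) $ i\<bar>)" by (rule norm_le_l1_cart)
  also have "\<dots> \<le> (\<Sum>i\<in>(UNIV :: 'd set). l)" by (intro sum_mono c)
  finally show ?thesis using l by (simp add: dist_norm mult.commute)
qed

text \<open>The distance error is \<open>e * s * CARD('d)\<close>. The distance threshold is twice
  the radius, measured in units of \<open>s\<close>, so the radius has to grow by
  \<open>e * CARD('d) / 2\<close>.\<close>

lemma grid_adj_of_dist:
  fixes x y :: "real ^ 'd" and e s t u :: real
  assumes "0 < e" "0 < s" "dist x y \<le> 2 * (s * t)" "t + e * CARD('d) / 2 \<le> u"
  shows "grid_adj e u (grid_label (e * s) x) (grid_label (e * s) y)"
proof -
  let ?m = "norm (\<chi> i. real_of_int (grid_label (e * s) x $ i - grid_label (e * s) y $ i))"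
  have "e * s * ?m \<le> 2 * (s * t) + e * s * CARD('d)"
    using dist_grid_label[of "e * s" x y] assms by auto
  then have "s * (e * ?m) \<le> s * (2 * t + e * CARD('d))" by (simp add: algebra_simps)
  then have "e * ?m \<le> 2 * t + e * CARD('d)" using assms by simp
  then show ?thesis unfolding grid_adj_def using assms by linarith
qed

lemma dist_of_grid_adj:
  fixes x y :: "real ^ 'd" and e s t u :: real
  assumes "0 < e" "0 < s" "grid_adj e u (grid_label (e * s) x) (grid_label (e * s) y)"
    "u + e * CARD('d) / 2 \<le> t"
  shows "dist x y \<le> 2 * (s * t)"
proof -
  let ?m = "norm (\<chi> i. real_of_int (grid_label (e * s) x $ i - grid_label (e * s) y $ i))"
  have "dist x y \<le> e * s * ?m + e * s * CARD('d)"
    using dist_grid_label[of "e * s" x y] assms by auto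
  also have "\<dots> = s * (e * ?m + e * CARD('d))" by (simp add: algebra_simps)
  also have "\<dots> \<le> s * (2 * t)"
    using assms by (intro mult_left_mono) (auto simp: grid_adj_def)
  finally show ?thesis by simp
qed

section \<open>Volumes of Rips configurations rooted at the origin\<close>

abbreviation from_origin :: "(nat \<Rightarrow> 'a::zero) \<Rightarrow> nat \<Rightarrow> 'a" where
  "from_origin y \<equiv> \<lambda>i. if i = 0 then 0 else y i"

definition rips_region :: "nat \<Rightarrow> real \<Rightarrow> (nat \<Rightarrow> 'a::euclidean_space) set" where
  "rips_region k r = {y \<in> {1..k} \<rightarrow>\<^sub>E UNIV. tuple_pairwise (\<lambda>a b. dist a b \<le> 2 * r) k (from_origin y)}"

text \<open>The \<open>itself\<close> argument names the ambient space, which \<open>k\<close> and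
  \<open>r\<close> do not determine.\<close>

definition rips_volume :: "'a::euclidean_space itself \<Rightarrow> nat \<Rightarrow> real \<Rightarrow> real" where
  "rips_volume _ k r = measure (\<Pi>\<^sub>M i\<in>{1..k}. lborel) (rips_region k r :: (nat \<Rightarrow> 'a) set)"

lemma sets_rips_region:
  "(rips_region k r :: (nat \<Rightarrow> 'a::euclidean_space) set) \<in> sets (\<Pi>\<^sub>M i\<in>{1..k}. lborel)"
proof -
  let ?M = "\<Pi>\<^sub>M i\<in>{1..k}. (lborel :: 'a measure)"
  have [measurable]: "(\<lambda>y. if i = 0 then 0 else y i) \<in> measurable ?M borel" if "i \<le> k" for i
    using that measurable_component_singleton[of i "{1..k}" "\<lambda>_. lborel :: 'a measure"] by (cases "i = 0") auto
  have "rips_region k r = {y \<in> space ?M. \<forall>i\<in>{..k}. \<forall>j\<in>{..k}. i \<noteq> j \<longrightarrow>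
     dist (from_origin y i) (from_origin y j) \<le> 2 * r}"
    by (auto simp: rips_region_def space_PiM)
  also have "\<dots> \<in> sets ?M" by measurable
  finally show ?thesis .
qed

text \<open>With \<open>j = k + 1\<close> the two simplices share all their vertices, so the product
  of the two indicators is the indicator itself, and two of the three factorials are
  \<open>fact 0\<close>.\<close>

lemma psi_eq_rips_volume:
  fixes f :: "'a::euclidean_space \<Rightarrow> real"
  shows "psi f (k + 1) k k r r = power_moment f k / fact (Suc k) * rips_volume TYPE('a) k r"
proof -
  let ?y = "\<lambda>y i. if i = 0 then 0 else y i :: 'a"
  have rips: "rips k r z = of_bool (\<forall>i\<le>k. \<forall>j\<le>k. i \<noteq> j \<longrightarrow> dist (z i) (z j) \<le> 2 * r)" for z :: "nat \<Rightarrow> 'a"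
    unfolding rips_eq_of_bool cball_inter_cball_nonempty_iff ..
  have e: "rips k r (\<lambda>i. if i = 0 then 0 else if i < k + 1 then y i else y (k + 1 + (i - (k + 1)))) = rips k r (?y y)" for y :: "nat \<Rightarrow> 'a"
    unfolding rips by auto
  have sq: "of_bool b * of_bool b = (of_bool b :: real)" for b by simp
  have N: "k + k + 1 - (k + 1) = k" "k + k + 2 - (k + 1) = Suc k" by auto
  have "(\<integral>y. rips k r (?y y) * rips k r (\<lambda>i. if i = 0 then 0 else if i < k + 1 then y i else y (k + 1 + (i - (k + 1))))
      \<partial>(\<Pi>\<^sub>M i\<in>{1..k}. lborel)) = (\<integral>y. indicator (rips_region k r) y \<partial>(\<Pi>\<^sub>M i\<in>{1..k}. (lborel :: 'a measure)))"
    unfolding e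
  proof (intro Bochner_Integration.integral_cong refl)
    fix y assume "y \<in> space (\<Pi>\<^sub>M i\<in>{1..k}. (lborel :: 'a measure))"
    then have "y \<in> rips_region k r \<longleftrightarrow> (\<forall>i\<le>k. \<forall>j\<le>k. i \<noteq> j \<longrightarrow> dist (?y y i) (?y y j) \<le> 2 * r)"
      by (simp only: rips_region_def space_PiM mem_Collect_eq space_lborel) blast
    then show "rips k r (?y y) * rips k r (?y y) = indicator (rips_region k r) y"
      by (simp only: rips indicator_def sq)
  qed
  also have "\<dots> = rips_volume TYPE('a) k r"
    unfolding rips_volume_def Bochner_Integration.integral_indicator
    by (rule arg_cong[OF Int_absorb2[OF sets.sets_into_space[OF sets_rips_region]]])
  finally show ?thesis unfolding psi_def N by simp
qed

lemma emeasure_lborel_PiE: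
  fixes A :: "nat \<Rightarrow> 'a::euclidean_space set"
  assumes "\<And>i. i \<in> {1..k} \<Longrightarrow> A i \<in> sets lborel"
  shows "emeasure (\<Pi>\<^sub>M i\<in>{1..k}. (lborel :: 'a measure)) (PiE {1..k} A) = (\<Prod>i\<in>{1..k}. emeasure lborel (A i))"
proof -
  interpret product_sigma_finite "\<lambda>_ :: nat. lborel :: 'a measure" by standard
  show ?thesis by (rule emeasure_PiM) (use assms in auto)
qed

lemma rips_region_subset: "rips_region k r \<subseteq> {1..k} \<rightarrow>\<^sub>E cball 0 (2 * r)"
proof
  fix y :: "nat \<Rightarrow> 'a" assume y: "y \<in> rips_region k r"
  have "y i \<in> cball 0 (2 * r)" if "i \<in> {1..k}" for i
  proof -
    have "tuple_pairwise (\<lambda>a b. dist a b \<le> 2 * r) k (from_origin y)"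
      using y unfolding rips_region_def by blast
    from this[rule_format, of 0 i] that show ?thesis by auto
  qed
  then show "y \<in> {1..k} \<rightarrow>\<^sub>E cball 0 (2 * r)" using y by (auto simp: rips_region_def PiE_iff)
qed

lemma emeasure_rips_region_le:
  "emeasure (\<Pi>\<^sub>M i\<in>{1..k}. lborel) (rips_region k r :: (nat \<Rightarrow> 'a::euclidean_space) set) \<le>
    ennreal (measure lborel (cball (0 :: 'a) (2 * r)) ^ k)"
proof -
  have "emeasure (\<Pi>\<^sub>M i\<in>{1..k}. lborel) (rips_region k r :: (nat \<Rightarrow> 'a) set) \<le>
    emeasure (\<Pi>\<^sub>M i\<in>{1..k}. lborel) ({1..k} \<rightarrow>\<^sub>E cball (0 :: 'a) (2 * r))"
    by (intro emeasure_mono rips_region_subset sets_PiM_I_finite) auto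
  also have "\<dots> = emeasure lborel (cball (0 :: 'a) (2 * r)) ^ k" by (subst emeasure_lborel_PiE) auto
  also have "emeasure lborel (cball (0 :: 'a) (2 * r)) = ennreal (measure lborel (cball (0 :: 'a) (2 * r)))"
    using emeasure_lborel_cball_finite by (intro emeasure_eq_ennreal_measure) (auto simp: less_top[symmetric])
  finally show ?thesis by (simp add: ennreal_power)
qed

lemma emeasure_rips_region_eq:
  "emeasure (\<Pi>\<^sub>M i\<in>{1..k}. lborel) (rips_region k r :: (nat \<Rightarrow> 'a::euclidean_space) set) =
    ennreal (rips_volume TYPE('a) k r)"
  unfolding rips_volume_def
  using emeasure_rips_region_le[of k r, where 'a='a] by (intro emeasure_eq_ennreal_measure) (auto simp: top_unique)

lemma rips_volume_le: "rips_volume TYPE('a::euclidean_space) k r \<le> measure lborel (cball (0 :: 'a) (2 * r)) ^ k"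
  using emeasure_rips_region_le[of k r, where 'a='a] by (simp add: emeasure_rips_region_eq del: One_nat_def)

lemma rips_volume_nonneg: "0 \<le> rips_volume TYPE('a::euclidean_space) k r"
  by (simp add: rips_volume_def)

text \<open>A product measure is determined by its values on boxes, where the claim is the
  one-factor scaling law \<open>lborel_affine\<close> applied to each coordinate.\<close>

lemma PiM_lborel_scale:
  fixes r :: real
  assumes r: "0 < r"
  shows "(\<Pi>\<^sub>M i\<in>{1..k}. (lborel :: 'a::euclidean_space measure)) =
    scale_measure (ennreal (r ^ (DIM('a) * k)))
      (distr (\<Pi>\<^sub>M i\<in>{1..k}. lborel) (\<Pi>\<^sub>M i\<in>{1..k}. lborel) (\<lambda>y. \<lambda>i\<in>{1..k}. r *\<^sub>R y i))"
    (is "?P = scale_measure ?c (distr ?P ?P ?T)")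
proof -
  interpret product_sigma_finite "\<lambda>_ :: nat. lborel :: 'a measure" by standard
  have T[measurable]: "?T \<in> measurable ?P ?P" by (intro measurable_restrict) measurable
  show ?thesis
  proof (rule PiM_eqI[symmetric])
    fix A :: "nat \<Rightarrow> 'a set" assume A: "\<And>i. i \<in> {1..k} \<Longrightarrow> A i \<in> sets lborel"
    have sc: "emeasure lborel B = ennreal (r ^ DIM('a)) * emeasure lborel ((\<lambda>x. r *\<^sub>R x) -` B)"
      if B: "B \<in> sets (borel :: 'a measure)" for B
    proof -
      have "emeasure lborel B = emeasure (density (distr lborel borel (\<lambda>x :: 'a. 0 + r *\<^sub>R x)) (\<lambda>_. ennreal (\<bar>r\<bar> ^ DIM('a)))) B"
        using lborel_affine[of r "0 :: 'a"] r by simp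
      also have "\<dots> = ennreal (r ^ DIM('a)) * emeasure (distr lborel borel (\<lambda>x :: 'a. r *\<^sub>R x)) B"
        using r B by (subst emeasure_density_const) auto
      finally show ?thesis using B by (simp add: emeasure_distr)
    qed
    have c: "?c = (\<Prod>i\<in>{1..k}. ennreal (r ^ DIM('a)))"
      using r by (simp add: ennreal_power power_mult)
    have pre: "(\<lambda>x. r *\<^sub>R x) -` A i \<in> sets (borel :: 'a measure)" if "i \<in> {1..k}" for i
    proof -
      have "(\<lambda>x :: 'a. r *\<^sub>R x) \<in> measurable borel borel" by measurable
      from measurable_sets[OF this, of "A i"] A[OF that] show ?thesis by simp
    qed
    have "emeasure (scale_measure ?c (distr ?P ?P ?T)) (PiE {1..k} A) = ?c * emeasure ?P (?T -` (PiE {1..k} A) \<inter> space ?P)"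
      using A by (simp add: emeasure_distr sets_PiM_I_finite)
    also have "?T -` (PiE {1..k} A) \<inter> space ?P = PiE {1..k} (\<lambda>i. (\<lambda>x. r *\<^sub>R x) -` A i)"
      by (auto simp: space_PiM PiE_iff)
    also have "emeasure ?P \<dots> = (\<Prod>i\<in>{1..k}. emeasure lborel ((\<lambda>x. r *\<^sub>R x) -` A i))"
      using pre by (intro emeasure_lborel_PiE) simp
    also have "?c * (\<Prod>i\<in>{1..k}. emeasure lborel ((\<lambda>x. r *\<^sub>R x) -` A i)) = (\<Prod>i\<in>{1..k}. emeasure lborel (A i))"
      unfolding c prod.distrib[symmetric] using A by (intro prod.cong refl sc[symmetric]) simp
    finally show "emeasure (scale_measure ?c (distr ?P ?P ?T)) (PiE {1..k} A) = (\<Prod>i\<in>{1..k}. emeasure lborel (A i))" .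
  qed auto
qed

text \<open>The homothety with ratio \<open>r\<close> carries the configurations of radius 1 onto
  those of radius \<open>r\<close>. This homogeneity makes the limit a power series in a power of
  the radius.\<close>

lemma rips_volume_scale:
  assumes r: "0 < r"
  shows "rips_volume TYPE('a::euclidean_space) k r = r ^ (DIM('a) * k) * rips_volume TYPE('a) k 1"
proof -
  let ?P = "\<Pi>\<^sub>M i\<in>{1..k}. (lborel :: 'a measure)"
  let ?T = "\<lambda>y :: nat \<Rightarrow> 'a. \<lambda>i\<in>{1..k}. r *\<^sub>R y i"
  have T: "?T \<in> measurable ?P ?P" by (intro measurable_restrict) measurable
  have "emeasure ?P (rips_region k r) = emeasure (scale_measure (ennreal (r ^ (DIM('a) * k))) (distr ?P ?P ?T)) (rips_region k r)"
    by (subst PiM_lborel_scale[OF r, of k]) simp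
  also have "\<dots> = ennreal (r ^ (DIM('a) * k)) * emeasure ?P (?T -` rips_region k r \<inter> space ?P)"
    using T by (simp add: emeasure_distr sets_rips_region del: One_nat_def)
  also have "?T -` rips_region k r \<inter> space ?P = rips_region k 1"
  proof -
    have d: "dist (from_origin (?T y) i) (from_origin (?T y) j) \<le> 2 * r \<longleftrightarrow>
      dist (from_origin y i) (from_origin y j) \<le> 2 * 1" if "i \<le> k" "j \<le> k" for i j y
    proof -
      have "(from_origin (?T y) i) = r *\<^sub>R (from_origin y i)" if "i \<le> k" for i
        using that by auto
      then have "dist (from_origin (?T y) i) (from_origin (?T y) j) =
        r * dist (from_origin y i) (from_origin y j)"
        using that r by (simp only: dist_norm scaleR_diff_right[symmetric] norm_scaleR abs_of_pos)
      then show ?thesis using r by (simp add: mult.commute[of 2 r] del: if_split_asm)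
    qed
    show ?thesis
    proof (rule set_eqI)
      fix y :: "nat \<Rightarrow> 'a"
      have "tuple_pairwise (\<lambda>a b. dist a b \<le> 2 * r) k (from_origin (?T y)) \<longleftrightarrow>
        tuple_pairwise (\<lambda>a b. dist a b \<le> 2 * 1) k (from_origin y)"
        by (rule iff_allI, rule imp_cong[OF refl], rule iff_allI, rule imp_cong[OF refl],
            rule imp_cong[OF refl], rule d; assumption)
      moreover have "?T y \<in> {1..k} \<rightarrow>\<^sub>E UNIV" by auto
      ultimately show "y \<in> ?T -` rips_region k r \<inter> space ?P \<longleftrightarrow> y \<in> rips_region k 1"
        unfolding rips_region_def vimage_eq Int_iff mem_Collect_eq space_PiM space_lborel
        by (simp only: simp_thms space_borel) (rule conj_commute)
    qed
  qed
  finally have "ennreal (rips_volume TYPE('a) k r) = ennreal (r ^ (DIM('a) * k) * rips_volume TYPE('a) k 1)"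
    using r by (simp add: emeasure_rips_region_eq ennreal_mult' rips_volume_nonneg del: One_nat_def)
  then show ?thesis using r by (simp add: rips_volume_nonneg)
qed

lemma rips_volume_0: "rips_volume TYPE('a::euclidean_space) 0 r = 1"
proof -
  have "(rips_region 0 r :: (nat \<Rightarrow> 'a) set) = {\<lambda>_. undefined}" by (auto simp: rips_region_def)
  then show ?thesis by (simp add: rips_volume_def PiM_empty measure_def)
qed

text \<open>For \<open>r < 0\<close> and \<open>k = 0\<close> both sides are \<open>1\<close>, by \<open>0 ^ 0 = 1\<close>; the limit thus extends
  continuously to negative parameters, which occur when \<open>t\<close> is shrunk.\<close>

lemma rips_volume_eq:
  "rips_volume TYPE('a::euclidean_space) k r = (max r 0 ^ DIM('a)) ^ k * rips_volume TYPE('a) k 1"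
proof (cases "k = 0")
  case True
  then show ?thesis by (simp add: rips_volume_0)
next
  case k: False
  show ?thesis
  proof (cases "0 < r")
    case True
    then show ?thesis using rips_volume_scale[OF True, of k, where 'a='a] by (simp add: power_mult)
  next
    case False
    have "emeasure lborel (cball (0 :: 'a) (2 * r)) = 0"
      using False by (cases "r = 0") auto
    then have "measure lborel (cball (0 :: 'a) (2 * r)) ^ k = 0" using k by (simp only: measure_def) simp
    then have "rips_volume TYPE('a) k r = 0"
      using rips_volume_le[of k r, where 'a='a] rips_volume_nonneg[of k r, where 'a='a] by linarith
    then show ?thesis using False k by (simp add: power_0_left)
  qed
qed

lemma grid_label_0: "grid_label l 0 = 0"
  by (simp add: grid_label_def vec_eq_iff)

text \<open>A point of the box of \<open>v\<close> recovers \<open>v\<close> as its labels at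
  \<open>1..k\<close>, index 0 being fixed at the origin and larger indices by extensionality. So
  the boxes are disjoint and their volumes add up.\<close>

lemma rooted_tuples_volume:
  fixes V :: "(nat \<Rightarrow> int ^ 'd) set"
  assumes e: "0 < e" and V: "finite V" "V = rooted_tuples R k"
  defines "U \<equiv> \<Union>v\<in>V. PiE {1..k} (\<lambda>i. (cell e (v i)))"
  shows "U \<in> sets (\<Pi>\<^sub>M i\<in>{1..k}. lborel)"
    "emeasure (\<Pi>\<^sub>M i\<in>{1..k}. lborel) U = ennreal (real (card V) * (e ^ CARD('d)) ^ k)"
proof -
  let ?P = "\<Pi>\<^sub>M i\<in>{1..k}. (lborel :: (real ^ 'd) measure)"
  let ?B = "\<lambda>v :: nat \<Rightarrow> int ^ 'd. PiE {1..k} (\<lambda>i. (cell e (v i)))"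
  have cell: "(cell e z) \<in> sets lborel" for z by measurable
  have B: "?B v \<in> sets ?P" for v using cell by (intro sets_PiM_I_finite) auto
  then show "U \<in> sets (\<Pi>\<^sub>M i\<in>{1..k}. lborel)" unfolding U_def using V by (intro sets.finite_UN) auto
  have "disjoint_family_on ?B V"
    unfolding disjoint_family_on_def
  proof (intro ballI impI)
    fix v v' assume v: "v \<in> V" "v' \<in> V" "v \<noteq> v'"
    show "?B v \<inter> ?B v' = {}"
    proof (rule equals0I)
      fix y assume y: "y \<in> ?B v \<inter> ?B v'"
      have "v i = v' i" for i
      proof -
        consider "i = 0" | "i \<in> {1..k}" | "i \<notin> {..k}" by fastforce
        then show ?thesis
        proof cases
          case 2
          then have "grid_label e (y i) = v i" "grid_label e (y i) = v' i" using y by (auto simp: PiE_iff)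
          then show ?thesis by simp
        qed (use v V in \<open>auto simp: rooted_tuples_def PiE_def extensional_def\<close>)
      qed
      then show False using v by auto
    qed
  qed
  then have "emeasure ?P U = (\<Sum>v\<in>V. emeasure ?P (?B v))"
    unfolding U_def using V B by (intro sum_emeasure[symmetric]) auto
  also have "\<dots> = (\<Sum>v\<in>V. ennreal ((e ^ CARD('d)) ^ k))"
    using e cell by (intro sum.cong refl) (subst emeasure_lborel_PiE, auto simp: emeasure_cell ennreal_power)
  also have "\<dots> = ennreal (real (card V) * (e ^ CARD('d)) ^ k)"
    using e by (simp add: ennreal_mult ennreal_of_nat_eq_real_of_nat)
  finally show "emeasure ?P U = ennreal (real (card V) * (e ^ CARD('d)) ^ k)" .
qed

abbreviation grid_volume :: "'d::finite itself \<Rightarrow> real \<Rightarrow> real \<Rightarrow> nat \<Rightarrow> real" where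
  "grid_volume _ e u k \<equiv>
     real (card (rooted_tuples (grid_adj e u :: int ^ 'd \<Rightarrow> int ^ 'd \<Rightarrow> bool) k)) * (e ^ CARD('d)) ^ k"

text \<open>The comparison of points with cells is reused at scale \<open>s = 1\<close>: the labels
  of a configuration of radius \<open>t\<close> form a rooted tuple for enlarged \<open>u\<close>,
  and points with the labels of a rooted tuple form a configuration for enlarged \<open>t\<close>.
  The origin has label 0, so rooting is preserved.\<close>

lemma rooted_tuples_grid_adj:
  assumes e: "0 < e"
  shows "finite (rooted_tuples (grid_adj e u :: int ^ 'd \<Rightarrow> int ^ 'd \<Rightarrow> bool) k)"
    "t + e * CARD('d) / 2 \<le> u \<Longrightarrow> rips_volume TYPE(real ^ 'd) k t \<le>
      grid_volume TYPE('d) e u k"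
    "u + e * CARD('d) / 2 \<le> t \<Longrightarrow>
      grid_volume TYPE('d) e u k
      \<le> rips_volume TYPE(real ^ 'd) k t"
proof -
  let ?R = "grid_adj e u :: int ^ 'd \<Rightarrow> int ^ 'd \<Rightarrow> bool"
  let ?V = "rooted_tuples ?R k"
  let ?P = "\<Pi>\<^sub>M i\<in>{1..k}. (lborel :: (real ^ 'd) measure)"
  let ?U = "\<Union>v\<in>?V. PiE {1..k} (\<lambda>i. (cell e (v i)))"
  have "finite {a :: int ^ 'd. \<forall>i. a $ i \<in> {- \<lceil>2 * u / e\<rceil>..\<lceil>2 * u / e\<rceil>}}"
    by (intro finite_vec_components) auto
  then show fV: "finite ?V"
  proof (rule rooted_tuples_card_le(1))
    fix a :: "int ^ 'd" assume "grid_adj e u a 0"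
    from grid_adj_component_le[OF e this] show "a \<in> {a. \<forall>i. a $ i \<in> {- \<lceil>2 * u / e\<rceil>..\<lceil>2 * u / e\<rceil>}}"
      by (simp add: abs_le_iff minus_le_iff)
  qed
  note U = rooted_tuples_volume[OF e fV refl]
  show "rips_volume TYPE(real ^ 'd) k t \<le> real (card ?V) * (e ^ CARD('d)) ^ k"
    if tu: "t + e * CARD('d) / 2 \<le> u"
  proof -
    have "rips_region k t \<subseteq> ?U"
    proof
      fix y :: "nat \<Rightarrow> real ^ 'd" assume y: "y \<in> rips_region k t"
      define v where "v = restrict (\<lambda>i. grid_label e (from_origin y i)) {..k}"
      have d: "tuple_pairwise (\<lambda>a b. dist a b \<le> 2 * (1 * t)) k (from_origin y)"
        using y unfolding rips_region_def by simp
      have "?R (v i) (v j)" if "i \<le> k" "j \<le> k" "i \<noteq> j" for i j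
        using grid_adj_of_dist[OF e, of 1, OF _ d[rule_format, OF that] tu] that by (simp add: v_def)
      then have "v \<in> ?V" by (auto simp: rooted_tuples_def v_def grid_label_0)
      moreover have "y \<in> PiE {1..k} (\<lambda>i. (cell e (v i)))"
        using y by (auto simp: v_def rips_region_def PiE_iff)
      ultimately show "y \<in> ?U" by blast
    qed
    then have "emeasure ?P (rips_region k t) \<le> emeasure ?P ?U" using U(1) by (intro emeasure_mono)
    then show ?thesis unfolding U(2) emeasure_rips_region_eq using e by simp
  qed
  show "real (card ?V) * (e ^ CARD('d)) ^ k \<le> rips_volume TYPE(real ^ 'd) k t"
    if tu: "u + e * CARD('d) / 2 \<le> t"
  proof -
    have "?U \<subseteq> rips_region k t"
    proof
      fix y :: "nat \<Rightarrow> real ^ 'd" assume "y \<in> ?U"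
      then obtain v where v: "v \<in> ?V" and y: "y \<in> PiE {1..k} (\<lambda>i. (cell e (v i)))" by blast
      have lab: "grid_label e (from_origin y i) = v i" if "i \<le> k" for i
        using v y that by (auto simp: rooted_tuples_def grid_label_0 PiE_iff)
      have R: "tuple_pairwise ?R k v" using v unfolding rooted_tuples_def by blast
      have "dist (from_origin y i) (from_origin y j) \<le> 2 * (1 * t)"
        if "i \<le> k" "j \<le> k" "i \<noteq> j" for i j
      proof (rule dist_of_grid_adj[OF e _ _ tu])
        show "grid_adj e u (grid_label (e * 1) (from_origin y i)) (grid_label (e * 1) (from_origin y j))"
          unfolding mult_1_right lab[OF that(1)] lab[OF that(2)] using R that by blast
      qed simp
      then show "y \<in> rips_region k t" using y by (simp add: rips_region_def PiE_iff)
    qed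
    then have "emeasure ?P ?U \<le> emeasure ?P (rips_region k t)" using sets_rips_region by (intro emeasure_mono)
    then show ?thesis unfolding U(2) emeasure_rips_region_eq using e by (simp add: rips_volume_nonneg)
  qed
qed

text \<open>For \<open>m\<close> the power moments of the density and the two parity weights, the
  difference of the two values is the alternating series of \<open>psi\<close>.\<close>

definition rips_limit :: "'a::euclidean_space itself \<Rightarrow> (nat \<Rightarrow> real) \<Rightarrow> (nat \<Rightarrow> real) \<Rightarrow> real \<Rightarrow> real" where
  "rips_limit T w m r = (\<Sum>k. weight w k * (rips_volume T k r * m k))"

context
  fixes w m :: "nat \<Rightarrow> real" and C :: real
  assumes w: "\<And>n. 0 \<le> w n" "\<And>n. w n \<le> 1" and m: "\<And>k. 0 \<le> m k" "\<And>k. m k \<le> C ^ k"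
begin

lemma summable_rips_limit_powser:
  "summable (\<lambda>k. weight w k * (rips_volume TYPE('a::euclidean_space) k 1 * m k) * x ^ k)"
proof (rule summable_comparison_test')
  let ?c = "measure lborel (cball (0 :: 'a) 2)"
  show "summable (\<lambda>k. (?c * C * \<bar>x\<bar>) ^ k /\<^sub>R fact k)" by (rule summable_exp_generic)
  fix k :: nat
  have C: "0 \<le> C ^ k" using m[of k] by linarith
  have wf: "weight w k \<le> 1 / fact k"
    using w[of "Suc k"] by (intro frac_le) (auto intro: fact_mono)
  have "rips_volume TYPE('a) k 1 \<le> ?c ^ k"
    using rips_volume_le[of k 1, where 'a='a] by simp
  then have vm: "rips_volume TYPE('a) k 1 * m k \<le> ?c ^ k * C ^ k"
    using rips_volume_nonneg[of k 1, where 'a='a] m by (intro mult_mono) auto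
  have "weight w k * (rips_volume TYPE('a) k 1 * m k) \<le> 1 / fact k * (?c ^ k * C ^ k)"
    by (rule mult_mono[OF wf vm]) (use m rips_volume_nonneg[of k 1, where 'a='a] in auto)
  moreover have "0 \<le> weight w k * (rips_volume TYPE('a) k 1 * m k)"
    using w m rips_volume_nonneg[of k 1, where 'a='a] by simp
  ultimately have "\<bar>weight w k * (rips_volume TYPE('a) k 1 * m k)\<bar> * \<bar>x\<bar> ^ k \<le> 1 / fact k * (?c ^ k * C ^ k) * \<bar>x\<bar> ^ k"
    by (intro mult_right_mono) (auto simp del: fact_Suc)
  then show "norm (weight w k * (rips_volume TYPE('a) k 1 * m k) * x ^ k) \<le> (?c * C * \<bar>x\<bar>) ^ k /\<^sub>R fact k"
    by (simp add: abs_mult power_abs power_mult_distrib field_simps del: fact_Suc)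
qed

lemma rips_limit_summable:
  "summable (\<lambda>k. weight w k * (rips_volume TYPE('a::euclidean_space) k r * m k))"
proof -
  have "(\<lambda>k. weight w k * (rips_volume TYPE('a) k r * m k)) =
    (\<lambda>k. weight w k * (rips_volume TYPE('a) k 1 * m k) * (max r 0 ^ DIM('a)) ^ k)"
    by (subst rips_volume_eq) (simp add: mult_ac)
  then show ?thesis using summable_rips_limit_powser by simp
qed

text \<open>By homogeneity the radius enters only through powers of
  \<open>max r 0 ^ DIM('a)\<close>. The limit is thus an everywhere convergent power series composed
  with a continuous function.\<close>

lemma isCont_rips_limit: "isCont (rips_limit TYPE('a::euclidean_space) w m) r"
proof -
  let ?a = "\<lambda>k. weight w k * (rips_volume TYPE('a) k 1 * m k)"
  have e: "rips_limit TYPE('a) w m = (\<lambda>x. \<Sum>k. ?a k * x ^ k) \<circ> (\<lambda>r. max r 0 ^ DIM('a))"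
    unfolding rips_limit_def by (subst rips_volume_eq) (simp add: fun_eq_iff mult_ac)
  have "isCont (\<lambda>x. \<Sum>k. ?a k * x ^ k) x" for x
  proof (rule isCont_powser)
    show "summable (\<lambda>k. ?a k * (\<bar>x\<bar> + 1) ^ k)" by (rule summable_rips_limit_powser)
  qed simp
  then show ?thesis unfolding e by (intro continuous_at_compose continuous_intros)
qed

lemma rips_limit_grid_bounds:
  fixes e u :: real
  assumes e: "0 < e"
    and s: "summable (\<lambda>k. weight w k *
       (grid_volume TYPE('d) e u k * m k))"
  shows "t + e * CARD('d) / 2 \<le> u \<Longrightarrow> rips_limit TYPE(real ^ 'd) w m t \<le> (\<Sum>k. weight w k *
       (grid_volume TYPE('d) e u k * m k))"
    "u + e * CARD('d) / 2 \<le> t \<Longrightarrow> (\<Sum>k. weight w k *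
       (grid_volume TYPE('d) e u k * m k))
       \<le> rips_limit TYPE(real ^ 'd) w m t"
  unfolding rips_limit_def
  by (intro suminf_le rips_limit_summable s mult_left_mono mult_right_mono rooted_tuples_grid_adj e m;
      use w in simp)+

end

section \<open>Poisson processes observed on a grid\<close>

text \<open>Independence is known for counts in \<open>ennreal\<close>; this expresses cell counts
  as a measurable function of them. For infinite sets both sides take the default value 0.\<close>

lemma nat_floor_point_count: "nat \<lfloor>enn2real (point_count Y A)\<rfloor> = card (Y \<inter> A)"
proof (cases "finite (Y \<inter> A)")
  case True
  then show ?thesis by (simp add: point_count_def)
next
  case False
  then show ?thesis by (simp add: point_count_def)
qed

locale critical_poisson = prob_space M for M :: "'w measure" +
  fixes f :: "real ^ 'd \<Rightarrow> real" and C :: real and P :: "nat \<Rightarrow> 'w \<Rightarrow> (real ^ 'd) set" and s :: "nat \<Rightarrow> real"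
  assumes f: "integrable lborel f" "\<And>x. 0 \<le> f x" "(LBINT x. f x) = 1" "AE x in lborel. f x \<le> C"
    and P: "\<And>n. n \<ge> 1 \<Longrightarrow> poisson_point_process M (density lborel (\<lambda>x. ennreal (real n * f x))) (P n)"
    and s: "\<And>n. n \<ge> 1 \<Longrightarrow> 0 < s n" "s \<longlonglongrightarrow> 0" "(\<lambda>n. real n * s n ^ CARD('d)) \<longlonglongrightarrow> 1"
begin

lemma emeasure_intensity:
  assumes A: "A \<in> sets borel"
  shows "emeasure (density lborel (\<lambda>x. ennreal (real n * f x))) A =
    ennreal (real n * (LBINT x. indicator A x * f x))"
proof -
  have [measurable]: "f \<in> borel_measurable borel" using f(1) by simp
  have i: "integrable lborel (\<lambda>x. real n * (indicator A x * f x))"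
    using integrable_mult_indicator[OF _ f(1), of A] A by simp
  have "emeasure (density lborel (\<lambda>x. ennreal (real n * f x))) A =
    (\<integral>\<^sup>+x. ennreal (real n * f x) * indicator A x \<partial>lborel)"
    using A by (intro emeasure_density) auto
  also have "\<dots> = (\<integral>\<^sup>+x. ennreal (real n * (indicator A x * f x)) \<partial>lborel)"
    by (intro nn_integral_cong) (auto simp: indicator_def)
  also have "\<dots> = ennreal (LBINT x. real n * (indicator A x * f x))"
    using f(2) by (intro nn_integral_eq_integral i) auto
  finally show ?thesis by simp
qed

lemma measure_intensity:
  assumes A: "A \<in> sets borel"
  shows "measure (density lborel (\<lambda>x. ennreal (real n * f x))) A = real n * (LBINT x. indicator A x * f x)"
  using emeasure_intensity[OF A, of n] f(2)
  by (simp add: measure_def Bochner_Integration.integral_nonneg)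

lemma prob_point_count:
  assumes n: "n \<ge> 1" and A: "A \<in> sets borel"
  shows "(\<lambda>\<omega>. point_count (P n \<omega>) A) \<in> borel_measurable M"
    "measure M {\<omega>\<in>space M. point_count (P n \<omega>) A = of_nat k} =
      exp (- (real n * (LBINT x. indicator A x * f x))) * (real n * (LBINT x. indicator A x * f x)) ^ k / fact k"
  using P[OF n] A emeasure_intensity[OF A, of n] measure_intensity[OF A, of n]
  unfolding poisson_point_process_def by auto

text \<open>Nothing is assumed about \<open>s 0\<close>; the case distinction keeps the side positive for all \<open>n\<close>.\<close>

definition side :: "real \<Rightarrow> nat \<Rightarrow> real" where
  "side e n = e * (if n = 0 then 1 else s n)"

text \<open>Growing boxes of labels exhaust the space, so the mass outside them tends to zero by
  dominated convergence.\<close>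

lemma ex_finite_cells:
  assumes l: "0 < l" and \<delta>: "0 < \<delta>"
  shows "\<exists>G :: (int ^ 'd) set. finite G \<and> (LBINT x. indicator {x. grid_label l x \<notin> G} x * f x) \<le> \<delta>"
proof -
  define G :: "nat \<Rightarrow> (int ^ 'd) set" where "G m = {a. \<forall>i. a $ i \<in> {- int m..int m}}" for m
  have [measurable]: "f \<in> borel_measurable borel" using f(1) by simp
  have "(\<lambda>m. LBINT x. indicator {x. grid_label l x \<notin> G m} x * f x) \<longlonglongrightarrow> (\<integral>(x :: real ^ 'd). 0 \<partial>lborel)"
  proof (rule integral_dominated_convergence[where w=f])
    show "AE x in lborel. (\<lambda>m. indicator {x. grid_label l x \<notin> G m} x * f x) \<longlonglongrightarrow> 0"
    proof (intro AE_I2 tendsto_eventually)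
      fix x :: "real ^ 'd"
      define m0 where "m0 = nat (\<Sum>i\<in>UNIV. \<bar>grid_label l x $ i\<bar>)"
      have "grid_label l x \<in> G m" if "m0 \<le> m" for m
      proof -
        have "\<bar>grid_label l x $ i\<bar> \<le> int m" for i
        proof -
          have "\<bar>grid_label l x $ i\<bar> \<le> (\<Sum>i\<in>UNIV. \<bar>grid_label l x $ i\<bar>)"
            by (intro member_le_sum) auto
          then show ?thesis using that by (simp add: m0_def)
        qed
        then show ?thesis by (simp add: G_def abs_le_iff minus_le_iff)
      qed
      then show "\<forall>\<^sub>F m in sequentially. indicator {x. grid_label l x \<notin> G m} x * f x = 0"
        by (intro eventually_sequentiallyI[of m0]) simp
    qed
    show "AE x in lborel. norm (indicator {x. grid_label l x \<notin> G m} x * f x) \<le> f x" for m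
      using f(2) by (auto simp: indicator_def)
    show "(\<lambda>x. indicator {x. grid_label l x \<notin> G m} x * f x) \<in> borel_measurable lborel" for m
    proof -
      have "{x. grid_label l x \<notin> G m} \<in> sets lborel" by measurable
      then show ?thesis by simp
    qed
  qed (use f in auto)
  then have "\<forall>\<^sub>F m in sequentially. (LBINT x. indicator {x. grid_label l x \<notin> G m} x * f x) < \<delta>"
    using \<delta> by (intro order_tendstoD) auto
  then obtain m where "(LBINT x. indicator {x. grid_label l x \<notin> G m} x * f x) < \<delta>"
    by (auto simp: eventually_sequentially)
  moreover have "finite (G m)" unfolding G_def by (intro finite_vec_components) auto
  ultimately show ?thesis by (intro exI[of _ "G m"]) auto
qed

text \<open>The bound makes the expected number of points outside these cells summable in \<open>n\<close>.\<close>

definition cells :: "real \<Rightarrow> nat \<Rightarrow> (int ^ 'd) set" where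
  "cells e n = (SOME G. finite G \<and>
     (LBINT x. indicator {x. grid_label (side e n) x \<notin> G} x * f x) \<le> (1 / 2) ^ n / (real n + 1))"

lemma side_pos: "0 < e \<Longrightarrow> 0 < side e n"
  using s(1)[of n] by (simp add: side_def)

lemma cells:
  assumes "0 < e"
  shows "finite (cells e n)"
    "(LBINT x. indicator {x. grid_label (side e n) x \<notin> cells e n} x * f x) \<le> (1 / 2) ^ n / (real n + 1)"
proof -
  have "\<exists>G. finite G \<and>
     (LBINT x. indicator {x. grid_label (side e n) x \<notin> G} x * f x) \<le> (1 / 2) ^ n / (real n + 1)"
    by (rule ex_finite_cells[OF side_pos[OF assms]]) simp
  from someI_ex[OF this] show "finite (cells e n)"
    "(LBINT x. indicator {x. grid_label (side e n) x \<notin> cells e n} x * f x) \<le> (1 / 2) ^ n / (real n + 1)"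
    unfolding cells_def by auto
qed

lemma refining_grid:
  assumes e: "0 < e"
  shows "refining_grid f C (e ^ CARD('d)) (side e) (cells e)"
proof
  have ev: "\<forall>\<^sub>F n in sequentially. e * s n = side e n"
    by (intro eventually_sequentiallyI[of 1]) (auto simp: side_def)
  have "(\<lambda>n. e * s n) \<longlonglongrightarrow> e * 0" by (intro tendsto_intros s)
  then show "side e \<longlonglongrightarrow> 0" using ev by (auto intro: Lim_transform_eventually)
  have "(\<lambda>n. e ^ CARD('d) * (real n * s n ^ CARD('d))) \<longlonglongrightarrow> e ^ CARD('d) * 1" by (intro tendsto_intros s)
  then have "(\<lambda>n. e ^ CARD('d) * (real n * s n ^ CARD('d))) \<longlonglongrightarrow> e ^ CARD('d)" by simp
  then show "(\<lambda>n. real n * side e n ^ CARD('d)) \<longlonglongrightarrow> e ^ CARD('d)"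
    by (rule Lim_transform_eventually)
       (auto simp: side_def power_mult_distrib intro!: eventually_sequentiallyI[of 1])
  have "(\<lambda>n. (1 / 2 :: real) ^ n / (real n + 1)) \<longlonglongrightarrow> 0"
  proof (rule tendsto_sandwich[OF _ _ tendsto_const])
    show "(\<lambda>n. (1 / 2 :: real) ^ n) \<longlonglongrightarrow> 0" by (intro LIMSEQ_realpow_zero) auto
    show "\<forall>\<^sub>F n in sequentially. (1 / 2 :: real) ^ n / (real n + 1) \<le> (1 / 2) ^ n"
      by (intro always_eventually allI) (simp add: divide_le_eq)
  qed auto
  then show "(\<lambda>n. LBINT x. indicator {x. grid_label (side e n) x \<notin> cells e n} x * f x) \<longlonglongrightarrow> 0"
    by (rule tendsto_sandwich[OF _ _ tendsto_const, rotated 2])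
       (use cells(2)[OF e] f(2) in \<open>auto intro!: always_eventually Bochner_Integration.integral_nonneg\<close>)
qed (use f cells(1)[OF e] side_pos[OF e] in auto)

definition cell_count :: "real \<Rightarrow> nat \<Rightarrow> int ^ 'd \<Rightarrow> 'w \<Rightarrow> nat" where
  "cell_count e n g \<omega> = card {x \<in> P n \<omega>. grid_label (side e n) x = g}"

lemma poisson_cells:
  assumes n: "n \<ge> 1" and e: "0 < e"
  shows "poisson_cells M (cells e n) (cell_count e n) (cell_rate f (side e n) (cells e n) n)"
proof
  let ?cell = "\<lambda>g. {x. grid_label (side e n) x = g}"
  have cell: "?cell g \<in> sets borel" for g by measurable
  have N: "cell_count e n g \<omega> = nat \<lfloor>enn2real (point_count (P n \<omega>) (?cell g))\<rfloor>" for g \<omega>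
    unfolding nat_floor_point_count cell_count_def by (rule arg_cong[where f=card]) auto
  show "finite (cells e n)" by (rule cells(1)[OF e])
  \<comment> \<open>Independence is available for families indexed by an initial segment of the
    naturals, so the cells are enumerated.\<close>
  obtain h where h: "bij_betw h {..<card (cells e n)} (cells e n)"
    using ex_bij_betw_nat_finite[OF cells(1)[OF e, of n]] by (auto simp: atLeast0LessThan)
  define h' where "h' = inv_into {..<card (cells e n)} h"
  have h': "h' g < card (cells e n)" "h (h' g) = g" if "g \<in> cells e n" for g
    using h that bij_betwE[OF bij_betw_inv_into[OF h]] by (auto simp: h'_def bij_betw_def f_inv_into_f)
  have "indep_vars (\<lambda>_. borel) (\<lambda>i \<omega>. point_count (P n \<omega>) (?cell (h i))) {..<card (cells e n)}"
  proof -
    have "disjoint_family_on (\<lambda>i. ?cell (h i)) {..<card (cells e n)}"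
      using bij_betw_imp_inj_on[OF h] by (auto simp: disjoint_family_on_def inj_on_def)
    moreover have "\<forall>(l::nat) A. (\<forall>i<l. A i \<in> sets borel) \<and> disjoint_family_on A {..<l} \<longrightarrow>
        indep_vars (\<lambda>_. borel) (\<lambda>i \<omega>. point_count (P n \<omega>) (A i)) {..<l}"
      using P[OF n] unfolding poisson_point_process_def by (elim conjE)
    ultimately show ?thesis using cell by simp
  qed
  \<comment> \<open>The singleton blocks \<open>{h' g}\<close> carry the index from numbers back to
    cells.\<close>
  then have "indep_vars (\<lambda>g. \<Pi>\<^sub>M i\<in>{h' g}. borel)
      (\<lambda>g \<omega>. restrict (\<lambda>i. point_count (P n \<omega>) (?cell (h i))) {h' g}) (cells e n)"
  proof (rule indep_vars_restrict)
    show "disjoint_family_on (\<lambda>g. {h' g}) (cells e n)"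
      unfolding disjoint_family_on_def
    proof (intro ballI impI)
      fix g g' assume "g \<in> cells e n" "g' \<in> cells e n" "g \<noteq> g'"
      then have "h' g \<noteq> h' g'" using h'(2)[of g] h'(2)[of g'] by auto
      then show "{h' g} \<inter> {h' g'} = {}" by simp
    qed
  qed (use h' in auto)
  then have "indep_vars (\<lambda>_. count_space UNIV)
      (\<lambda>g \<omega>. nat \<lfloor>enn2real (restrict (\<lambda>i. point_count (P n \<omega>) (?cell (h i))) {h' g} (h' g))\<rfloor>) (cells e n)"
  proof (rule indep_vars_compose2)
    fix g
    have [measurable]: "(\<lambda>x. x (h' g)) \<in> measurable (\<Pi>\<^sub>M i\<in>{h' g}. borel :: ennreal measure) borel"
      by (rule measurable_component_singleton) simp
    show "(\<lambda>x. nat \<lfloor>enn2real (x (h' g))\<rfloor>) \<in> measurable (\<Pi>\<^sub>M i\<in>{h' g}. borel :: ennreal measure) (count_space UNIV)"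
      by measurable
  qed
  then show "indep_vars (\<lambda>_. count_space UNIV) (cell_count e n) (cells e n)"
    by (rule indep_vars_cong[OF refl _ refl, THEN iffD1, rotated]) (simp add: N h' fun_eq_iff)
  fix g assume g: "g \<in> cells e n"
  show "poisson_var M (cell_count e n g) (cell_rate f (side e n) (cells e n) n g)"
    unfolding poisson_var_def
  proof (intro conjI allI)
    have [measurable]: "(\<lambda>\<omega>. point_count (P n \<omega>) (?cell g)) \<in> borel_measurable M"
      by (rule prob_point_count(1)[OF n cell])
    show "cell_count e n g \<in> measurable M (count_space UNIV)"
      unfolding N by measurable
    show "0 \<le> cell_rate f (side e n) (cells e n) n g"
      by (rule refining_grid.rate_nonneg[OF refining_grid[OF e]])
    fix k
    \<comment> \<open>Boundedness makes the number of points in the cell finite, so that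
      \<open>card\<close> agrees with \<open>point_count\<close>.\<close>
    have "bounded (?cell g)"
    proof (rule boundedI)
      fix x assume x: "x \<in> ?cell g"
      have "dist 0 x \<le> side e n * norm (\<chi> i. real_of_int (grid_label (side e n) 0 $ i - g $ i)) + side e n * CARD('d)"
        using dist_grid_label[OF side_pos[OF e, of n], of 0 x] x by auto
      then show "norm x \<le> side e n * norm (\<chi> i. real_of_int (grid_label (side e n) (0 :: real ^ 'd) $ i - g $ i)) + side e n * CARD('d)"
        by simp
    qed
    then have "finite (P n \<omega> \<inter> ?cell g)" if "\<omega> \<in> space M" for \<omega>
      using P[OF n] that unfolding poisson_point_process_def by blast
    then have "point_count (P n \<omega>) (?cell g) = of_nat (cell_count e n g \<omega>)" if "\<omega> \<in> space M" for \<omega>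
      using that unfolding N nat_floor_point_count by (simp add: point_count_def)
    then have "{\<omega>\<in>space M. cell_count e n g \<omega> = k} = {\<omega>\<in>space M. point_count (P n \<omega>) (?cell g) = of_nat k}"
      by auto
    then show "prob {\<omega>\<in>space M. cell_count e n g \<omega> = k} =
      exp (- cell_rate f (side e n) (cells e n) n g) * cell_rate f (side e n) (cells e n) n g ^ k / fact k"
      using prob_point_count(2)[OF n cell, of g k] g by (simp add: cell_rate_def)
  qed
qed

text \<open>The probability of a point outside the cells is \<open>1 - exp (- r)\<close>, at most
  the intensity \<open>r\<close> there, so Borel-Cantelli applies. Finitely many cells are bounded,
  and local finiteness then makes the whole of \<open>P n \<omega>\<close> finite.\<close>

lemma AE_points_in_cells:
  assumes e: "0 < e"
  shows "AE \<omega> in M. \<forall>\<^sub>F n in sequentially. finite (P n \<omega>) \<and> grid_label (side e n) ` P n \<omega> \<subseteq> cells e n"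
proof -
  let ?out = "\<lambda>n. {x. grid_label (side e n) x \<notin> cells e n}"
  have out: "?out n \<in> sets borel" for n by measurable
  define A where "A n = (if n = 0 then {} else {\<omega>\<in>space M. point_count (P n \<omega>) (?out n) \<noteq> 0})" for n
  have A: "A n \<in> sets M" for n
  proof (cases "n = 0")
    case False
    then have [measurable]: "(\<lambda>\<omega>. point_count (P n \<omega>) (?out n)) \<in> borel_measurable M"
      by (intro prob_point_count(1) out) simp
    have "{\<omega>\<in>space M. point_count (P n \<omega>) (?out n) \<noteq> 0} \<in> sets M" by measurable
    then show ?thesis using False by (simp add: A_def)
  qed (simp add: A_def)
  have le: "measure M (A n) \<le> (1 / 2) ^ n" for n
  proof (cases "n = 0")
    case False
    let ?r = "real n * (LBINT x. indicator (?out n) x * f x)"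
    have "prob {\<omega>\<in>space M. point_count (P n \<omega>) (?out n) = of_nat 0} = exp (- ?r)"
      using prob_point_count(2)[OF _ out, of n n 0] False by simp
    moreover have "{\<omega>\<in>space M. point_count (P n \<omega>) (?out n) = of_nat 0} = space M - A n"
      using False by (auto simp: A_def)
    ultimately have "1 - prob (A n) = exp (- ?r)" using prob_compl[OF A[of n]] by simp
    then have "prob (A n) \<le> ?r" using exp_ge_add_one_self[of "- ?r"] by linarith
    \<comment> \<open>The denominator \<open>real n + 1\<close> in the choice of cells absorbs the
      factor \<open>n\<close> of the intensity.\<close>
    also have "?r \<le> real n * ((1 / 2) ^ n / (real n + 1))"
      by (intro mult_left_mono cells(2)[OF e]) simp
    also have "\<dots> = real n / (real n + 1) * (1 / 2) ^ n" by simp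
    also have "\<dots> \<le> 1 * (1 / 2) ^ n" by (intro mult_right_mono) auto
    also have "\<dots> = (1 / 2) ^ n" by simp
    finally show ?thesis .
  qed (simp add: A_def)
  have "AE \<omega> in M. \<forall>\<^sub>F n in sequentially. \<omega> \<in> space M - A n"
  proof (rule borel_cantelli_AE1[OF A])
    show "summable (\<lambda>n. prob (A n))"
      by (rule summable_comparison_test'[OF summable_geometric[of "1 / 2"], of 0]) (use le in auto)
  qed (simp add: emeasure_eq_measure)
  then show ?thesis
  proof eventually_elim
    case (elim \<omega>)
    then show ?case using eventually_ge_at_top[of 1]
    proof eventually_elim
      case (elim n)
      have w: "\<omega> \<in> space M" "point_count (P n \<omega>) (?out n) = 0" using elim by (auto simp: A_def split: if_splits)
      then have "P n \<omega> \<inter> ?out n = {}" by (simp add: point_count_def emeasure_count_space_eq_0)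
      then have sub: "grid_label (side e n) ` P n \<omega> \<subseteq> cells e n" by auto
      let ?b = "\<Sum>g\<in>cells e n. norm (\<chi> i. real_of_int (g $ i))"
      have "norm x \<le> side e n * ?b + side e n * CARD('d)" if x: "x \<in> P n \<omega>" for x
      proof -
        have "norm (\<chi> i. real_of_int (grid_label (side e n) x $ i)) \<le> ?b"
          using sub x cells(1)[OF e, of n] by (intro member_le_sum[where f="\<lambda>g. norm (\<chi> i. real_of_int (g $ i))"]) auto
        then have "side e n * norm (\<chi> i. real_of_int (grid_label (side e n) x $ i)) \<le> side e n * ?b"
          using side_pos[OF e, of n] by (intro mult_left_mono) auto
        moreover have "norm x \<le> side e n * norm (\<chi> i. real_of_int (grid_label (side e n) x $ i)) + side e n * CARD('d)"
          using dist_grid_label[OF side_pos[OF e, of n], of x 0] by (simp add: grid_label_0)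
        ultimately show ?thesis by linarith
      qed
      then have "bounded (P n \<omega>)" by (rule boundedI)
      then have "finite (P n \<omega> \<inter> P n \<omega>)"
        using P[of n] w elim unfolding poisson_point_process_def by blast
      then show ?case using sub by simp
    qed
  qed
qed

end

section \<open>Convergence\<close>

definition grid_nbhd :: "int \<Rightarrow> (int ^ 'd) set \<Rightarrow> int ^ 'd \<Rightarrow> (int ^ 'd) set" where
  "grid_nbhd m G q = {g \<in> G. \<forall>i. \<bar>g $ i - q $ i\<bar> \<le> m}"

definition grid_colour :: "int \<Rightarrow> int ^ 'd \<Rightarrow> int ^ 'd" where
  "grid_colour m q = (\<chi> i. q $ i mod (2 * m + 1))"

abbreviation grid_box :: "int \<Rightarrow> (int ^ 'd) set" where
  "grid_box m \<equiv> {a. \<forall>i. a $ i \<in> {- m..m}}"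

text \<open>Different cells of one colour differ by a nonzero multiple of \<open>2 * m + 1\<close>
  in some coordinate, too far for their \<open>m\<close>-neighbourhoods to meet.\<close>

lemma disjoint_grid_nbhd:
  assumes "0 \<le> m"
  shows "disjoint_family_on (grid_nbhd m G) {q \<in> G'. grid_colour m q = c}"
  unfolding disjoint_family_on_def
proof (intro ballI impI equals0I)
  fix q q' g
  assume q: "q \<in> {q \<in> G'. grid_colour m q = c}" "q' \<in> {q \<in> G'. grid_colour m q = c}" "q \<noteq> q'"
    and g: "g \<in> grid_nbhd m G q \<inter> grid_nbhd m G q'"
  have "q $ i = q' $ i" for i
  proof (rule ccontr)
    assume ne: "q $ i \<noteq> q' $ i"
    have "grid_colour m q $ i = grid_colour m q' $ i" using q by simp
    then have "(2 * m + 1) dvd (q $ i - q' $ i)" by (simp add: grid_colour_def mod_eq_dvd_iff)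
    then have "\<bar>2 * m + 1\<bar> \<le> \<bar>q $ i - q' $ i\<bar>" using ne by (intro dvd_imp_le_int) auto
    moreover have "\<bar>g $ i - q $ i\<bar> \<le> m" "\<bar>g $ i - q' $ i\<bar> \<le> m" using g by (auto simp: grid_nbhd_def)
    ultimately show False using assms by linarith
  qed
  then show False using q by (simp add: vec_eq_iff)
qed

lemma finite_grid_box: "finite (grid_box m :: (int ^ 'd) set)"
  by (intro finite_vec_components) auto

lemma card_grid_nbhd_le:
  fixes q :: "int ^ 'd"
  shows "card (grid_nbhd m G q) \<le> card (grid_box m :: (int ^ 'd) set)"
proof -
  have "inj_on (\<lambda>g. g - q) (grid_nbhd m G q)" by (auto intro: inj_onI)
  moreover have "(\<lambda>g. g - q) ` grid_nbhd m G q \<subseteq> grid_box m"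
    by (auto simp: grid_nbhd_def abs_le_iff) (smt (verit))
  ultimately show ?thesis using finite_grid_box[of m] by (rule card_inj_on_le)
qed

text \<open>Exchanging the sums, each cell lies in at most as many neighbourhoods as a box of radius
  \<open>m\<close> has cells.\<close>

lemma sum_grid_nbhd_le:
  fixes r :: "int ^ 'd \<Rightarrow> real"
  assumes G: "finite G" and r: "\<And>g. 0 \<le> r g"
  shows "(\<Sum>q\<in>G. \<Sum>g\<in>grid_nbhd m G q. r g) \<le> real (card (grid_box m :: (int ^ 'd) set)) * (\<Sum>g\<in>G. r g)"
proof -
  have "(\<Sum>q\<in>G. \<Sum>g\<in>grid_nbhd m G q. r g) = (\<Sum>q\<in>G. \<Sum>g\<in>{g\<in>G. \<forall>i. \<bar>g $ i - q $ i\<bar> \<le> m}. r g)"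
    by (simp add: grid_nbhd_def)
  also have "\<dots> = (\<Sum>g\<in>G. \<Sum>q\<in>{q\<in>G. \<forall>i. \<bar>g $ i - q $ i\<bar> \<le> m}. r g)"
    by (rule sum.swap_restrict[OF G G])
  also have "\<dots> = (\<Sum>g\<in>G. \<Sum>q\<in>grid_nbhd m G g. r g)"
    by (simp add: grid_nbhd_def abs_minus_commute)
  also have "\<dots> \<le> (\<Sum>g\<in>G. real (card (grid_box m :: (int ^ 'd) set)) * r g)"
    by (intro sum_mono) (simp only: sum_constant, intro mult_right_mono of_nat_mono card_grid_nbhd_le r)
  finally show ?thesis by (simp add: sum_distrib_left)
qed

text \<open>This makes the moment bounds linear in the rates, so that their sum over all cells is of
  order \<open>n\<close>.\<close>

lemma exp_minus_one_le:
  fixes x :: real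
  assumes "x \<le> b" "0 \<le> x"
  shows "exp x - 1 \<le> x * exp b"
proof -
  have "1 - x \<le> exp (- x)" using exp_ge_add_one_self[of "- x"] by simp
  then have "(1 - x) * exp x \<le> exp (- x) * exp x" by (intro mult_right_mono) auto
  then have "exp x - 1 \<le> x * exp x" by (simp add: exp_minus_inverse mult.commute[of "exp (- x)"] algebra_simps)
  also have "\<dots> \<le> x * exp b" using assms by (intro mult_left_mono) auto
  finally show ?thesis .
qed

context critical_poisson
begin

text \<open>The count \<open>T\<close> equals its mean \<open>E\<close> plus one fluctuation
  \<open>Y c\<close> per colour. The number of colours does not depend on \<open>n\<close>, so it
  suffices that each fluctuation is almost surely negligible.\<close>

lemma grid_clique_sum_tendsto:
  assumes e: "0 < e" and w: "\<And>n. 0 \<le> w n" "\<And>n. w n \<le> 1"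
  shows "summable (\<lambda>k. weight w k *
      (grid_volume TYPE('d) e u k *
       power_moment f k))"
    "AE \<omega> in M. (\<lambda>n. clique_sum w (\<lambda>a b. grid_adj e u (grid_label (side e n) a) (grid_label (side e n) b))
        (P n \<omega>) / real n) \<longlonglongrightarrow>
      (\<Sum>k. weight w k *
        (grid_volume TYPE('d) e u k *
         power_moment f k))"
proof -
  let ?R = "grid_adj e u :: int ^ 'd \<Rightarrow> int ^ 'd \<Rightarrow> bool"
  let ?G = "cells e"
  interpret rg: refining_grid f C "e ^ CARD('d)" "side e" "cells e" by (rule refining_grid[OF e])
  \<comment> \<open>Adjacent cells differ by at most the ceiling in every coordinate. The maximum
    with 0 covers shrunk, negative radii and keeps every cell in its own neighbourhood.\<close>
  define m where "m = max 0 \<lceil>2 * u / e\<rceil>"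
  have m: "0 \<le> m" by (simp add: m_def)
  have adj: "\<bar>g $ i - q $ i\<bar> \<le> m" if "?R g q" for g q i
    using grid_adj_component_le[OF e that, of i] by (simp add: m_def)
  have D: "a \<in> grid_box m" if "?R a 0" for a
    using adj[OF that] by (simp add: abs_le_iff minus_le_iff)
  note mean = rg.mean_tendsto[where R="?R" and D="grid_box m" and w=w, OF grid_adj_translate finite_grid_box D w]
  show "summable (\<lambda>k. weight w k *
      (grid_volume TYPE('d) e u k * power_moment f k))"
    by (rule mean(3))
  define T where "T n \<omega> = clique_sum w (\<lambda>a b. ?R (fst a) (fst b)) (SIGMA g:?G n. {..<cell_count e n g \<omega>})" for n \<omega>
  define E where "E n = (\<Sum>k. weight w k * (\<Sum>z\<in>clique_tuples ?R k (?G n). \<Prod>i\<le>k. rg.rate n (z i)))" for n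
  define X where "X n q \<omega> = rooted_sum w ?R (?G n) (\<lambda>g. cell_count e n g \<omega>) q" for n q \<omega>
  define Y where "Y c n \<omega> = (\<Sum>q\<in>{q\<in>?G n. grid_colour m q = c}. X n q \<omega> - expectation (X n q))" for c n \<omega>
  have K: "grid_nbhd m (?G n) q \<subseteq> ?G n" "q \<in> ?G n \<Longrightarrow> q \<in> grid_nbhd m (?G n) q"
    "g \<in> ?G n \<Longrightarrow> ?R g q \<Longrightarrow> g \<in> grid_nbhd m (?G n) q" for n q g
    using m adj by (auto simp: grid_nbhd_def)
  \<comment> \<open>Residues modulo \<open>2 * m + 1\<close> lie between 0 and \<open>2 * m\<close>,
    hence in this box, which is already known to be finite.\<close>
  let ?C = "grid_box (2 * m) :: (int ^ 'd) set"
  have col: "grid_colour m ` ?G n \<subseteq> ?C" for n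
  proof -
    have "0 \<le> q $ i mod (2 * m + 1)" "q $ i mod (2 * m + 1) < 2 * m + 1" for q :: "int ^ 'd" and i
      using m pos_mod_bound[of "2 * m + 1" "q $ i"] pos_mod_sign[of "2 * m + 1" "q $ i"] by linarith+
    then show ?thesis using m by (fastforce simp: grid_colour_def intro: order_trans[of _ 0])
  qed
  have TE: "T n \<omega> - E n = (\<Sum>c\<in>?C. Y c n \<omega>)" if n: "n \<ge> 1" for n \<omega>
  proof -
    interpret pc: poisson_cells M "?G n" "cell_count e n" "rg.rate n" by (rule poisson_cells[OF n e])
    have "(\<integral>\<^sup>+\<omega>. ennreal (T n \<omega>) \<partial>M) = ennreal (E n)"
      unfolding T_def E_def pc.nn_integral_total[where w=w, OF w(1)]
      by (intro suminf_ennreal2 mean(1))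
         (use w in \<open>auto intro!: divide_nonneg_nonneg mult_nonneg_nonneg sum_nonneg prod_nonneg simp: rg.rate_nonneg\<close>)
    moreover have "0 \<le> E n"
      unfolding E_def
      by (intro suminf_nonneg mean(1))
         (use w in \<open>auto intro!: divide_nonneg_nonneg mult_nonneg_nonneg sum_nonneg prod_nonneg simp: rg.rate_nonneg\<close>)
    ultimately have "E n = enn2real (\<integral>\<^sup>+\<omega>. ennreal (T n \<omega>) \<partial>M)" by simp
    then show ?thesis
      unfolding T_def Y_def X_def
      using pc.total_minus_expectation[where w=w and R="?R" and K="grid_nbhd m (?G n)" and \<omega>=\<omega>,
          OF w K finite_grid_box col]
      by simp
  qed
  obtain B where B: "\<And>n z. rg.rate n z \<le> B" "0 < B" using rg.rate_bounded by auto
  let ?b = "real (card (grid_box m :: (int ^ 'd) set))"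
  \<comment> \<open>A neighbourhood has rate at most \<open>?b * B\<close>, which fixes the
    exponential. The factor \<open>15 * ?b\<close> collects the exponent 15 and the overlap of
    neighbourhoods, so that \<open>A \<le> a * real n\<close>.\<close>
  define a where "a = exp (15 * (?b * B)) * (15 * ?b)"
  have a0: "0 \<le> a" by (simp add: a_def)
  have Y: "Y c n \<in> borel_measurable M \<and>
     (\<integral>\<^sup>+\<omega>. ennreal (Y c n \<omega> ^ 4) \<partial>M) \<le> ennreal ((2 * a + 3 * a ^ 2) * real n ^ 2)" if n: "n \<ge> 1" for c n
  proof -
    interpret pc: poisson_cells M "?G n" "cell_count e n" "rg.rate n" by (rule poisson_cells[OF n e])
    let ?L = "{q\<in>?G n. grid_colour m q = c}"
    let ?s = "\<lambda>q. \<Sum>g\<in>grid_nbhd m (?G n) q. rg.rate n g"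
    define A where "A = (\<Sum>q\<in>?L. exp (15 * ?s q) - 1)"
    have s0: "0 \<le> ?s q" for q by (intro sum_nonneg rg.rate_nonneg)
    have "?s q \<le> ?b * B" for q
    proof -
      have "?s q \<le> real (card (grid_nbhd m (?G n) q)) * B" by (rule sum_bounded_above) (rule B)
      also have "\<dots> \<le> ?b * B"
        using B(2) card_grid_nbhd_le[of m "?G n" q] by (intro mult_right_mono) auto
      finally show ?thesis .
    qed
    then have ex: "exp (15 * ?s q) - 1 \<le> 15 * ?s q * exp (15 * (?b * B))" for q
      using s0 by (intro exp_minus_one_le) auto
    have "A \<le> (\<Sum>q\<in>?G n. 15 * ?s q * exp (15 * (?b * B)))"
      unfolding A_def
      by (rule order_trans[OF sum_mono[OF ex] sum_mono2]) (use cells(1)[OF e] s0 in auto)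
    also have "\<dots> = 15 * exp (15 * (?b * B)) * (\<Sum>q\<in>?G n. ?s q)"
      by (simp add: sum_distrib_left sum_distrib_right mult_ac)
    also have "\<dots> \<le> 15 * exp (15 * (?b * B)) * (?b * real n)"
    proof (intro mult_left_mono)
      have "(\<Sum>q\<in>?G n. ?s q) \<le> ?b * (\<Sum>g\<in>?G n. rg.rate n g)"
        by (intro sum_grid_nbhd_le cells(1)[OF e] rg.rate_nonneg)
      also have "\<dots> \<le> ?b * real n" by (intro mult_left_mono rg.sum_rate_le) auto
      finally show "(\<Sum>q\<in>?G n. ?s q) \<le> ?b * real n" .
    qed auto
    finally have A: "A \<le> a * real n" by (simp add: a_def mult_ac)
    have A0: "0 \<le> A" unfolding A_def using s0 by (intro sum_nonneg) auto
    have "2 * A + 3 * A ^ 2 \<le> 2 * (a * real n) * real n + 3 * (a * real n) ^ 2"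
    proof (intro add_mono mult_left_mono power_mono)
      \<comment> \<open>The linear term is weakened to a quadratic one by \<open>n \<ge> 1\<close>,
        to fit the single bound of order \<open>n ^ 2\<close>.\<close>
      have "a * real n * 1 \<le> a * real n * real n" using n a0 by (intro mult_left_mono) auto
      then show "2 * A \<le> 2 * (a * real n) * real n" using A by linarith
    qed (use A A0 in auto)
    also have "\<dots> = (2 * a + 3 * a ^ 2) * real n ^ 2" by (simp add: power2_eq_square algebra_simps)
    finally have *: "ennreal (2 * A + 3 * A ^ 2) \<le> ennreal ((2 * a + 3 * a ^ 2) * real n ^ 2)" by (rule ennreal_leI)
    have L: "?L \<subseteq> ?G n" by auto
    note cs = pc.centred_class_sum[where w=w and R="?R" and K="grid_nbhd m (?G n)" and L="?L",
      OF w K L disjoint_grid_nbhd[OF m]]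
    show ?thesis
      using cs(1) order_trans[OF cs(2)[folded A_def] *] unfolding Y_def X_def by blast
  qed
  have "AE \<omega> in M. \<forall>c\<in>?C. (\<lambda>n. Y c n \<omega> / real n) \<longlonglongrightarrow> 0"
  proof (intro AE_finite_allI finite_grid_box)
    fix c
    show "AE \<omega> in M. (\<lambda>n. Y c n \<omega> / real n) \<longlonglongrightarrow> 0"
      by (rule AE_tendsto_zero_of_fourth_moment[of 1 "Y c" "2 * a + 3 * a ^ 2"]) (use Y a0 in auto)
  qed
  then show "AE \<omega> in M. (\<lambda>n. clique_sum w (\<lambda>a b. ?R (grid_label (side e n) a) (grid_label (side e n) b))
        (P n \<omega>) / real n) \<longlonglongrightarrow> (\<Sum>k. weight w k *
      (grid_volume TYPE('d) e u k * power_moment f k))"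
    using AE_points_in_cells[OF e]
  proof eventually_elim
    case (elim \<omega>)
    have "(\<lambda>n. (\<Sum>c\<in>?C. Y c n \<omega> / real n) + E n / real n) \<longlonglongrightarrow> (\<Sum>c\<in>?C. 0) + (\<Sum>k. weight w k *
      (grid_volume TYPE('d) e u k * power_moment f k))"
      unfolding E_def by (intro tendsto_add tendsto_sum mean(2)) (use elim in auto)
    then have lim: "(\<lambda>n. (\<Sum>c\<in>?C. Y c n \<omega> / real n) + E n / real n) \<longlonglongrightarrow> (\<Sum>k. weight w k *
      (grid_volume TYPE('d) e u k * power_moment f k))" by simp
    show ?case
    proof (rule Lim_transform_eventually[OF lim])
      show "\<forall>\<^sub>F n in sequentially. (\<Sum>c\<in>?C. Y c n \<omega> / real n) + E n / real n =
        clique_sum w (\<lambda>a b. ?R (grid_label (side e n) a) (grid_label (side e n) b)) (P n \<omega>) / real n"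
        using elim(2) eventually_ge_at_top[of 1]
      proof eventually_elim
        case (elim n)
        have "clique_sum w (\<lambda>a b. ?R (grid_label (side e n) a) (grid_label (side e n) b)) (P n \<omega>) = T n \<omega>"
          unfolding T_def cell_count_def using elim by (intro clique_sum_labels) auto
        then show ?case
          using TE[OF elim(2), of \<omega>] by (simp add: sum_divide_distrib[symmetric] add_divide_distrib[symmetric])
      qed
    qed
  qed
qed

abbreviation rips_sum :: "(nat \<Rightarrow> real) \<Rightarrow> nat \<Rightarrow> real \<Rightarrow> 'w \<Rightarrow> real" where
  "rips_sum w n t \<omega> \<equiv> clique_sum w (\<lambda>a b. dist a b \<le> 2 * (s n * t)) (P n \<omega>)"

abbreviation density_limit :: "(nat \<Rightarrow> real) \<Rightarrow> real \<Rightarrow> real" where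
  "density_limit w \<equiv> rips_limit TYPE(real ^ 'd) w (power_moment f)"

lemma density_moments:
  "0 \<le> power_moment f k" "power_moment f k \<le> C ^ k"
proof -
  interpret rg: refining_grid f C "1 ^ CARD('d)" "side 1" "cells 1" by (rule refining_grid) simp
  show "power_moment f k \<le> C ^ k" by (rule rg.integral_power_density_le)
  show "0 \<le> power_moment f k" using f(2) by (intro Bochner_Integration.integral_nonneg) simp
qed

lemma isCont_density_limit:
  assumes "\<And>n. 0 \<le> w n" "\<And>n. w n \<le> 1"
  shows "isCont (density_limit w) t"
  by (rule isCont_rips_limit[OF assms density_moments])

lemma AE_finite_points: "AE \<omega> in M. \<forall>\<^sub>F n in sequentially. finite (P n \<omega>)"
  using AE_points_in_cells[of 1] by (auto elim!: eventually_mono)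

text \<open>For each mesh the count lies between two grid counts whose limits are bounded by
  \<open>density_limit w\<close> at radii shifted by \<open>2 * \<delta> j\<close>. Continuity at
  \<open>t\<close> makes these bounds as close to the claimed limit as desired.\<close>

lemma rips_sum_tendsto:
  assumes w: "\<And>n. 0 \<le> w n" "\<And>n. w n \<le> 1"
  shows "AE \<omega> in M. (\<lambda>n. rips_sum w n t \<omega> / real n) \<longlonglongrightarrow> density_limit w t"
proof -
  define e where "e j = 1 / (real j + 1)" for j :: nat
  \<comment> \<open>This radius shift is paid twice, from points to cells and from lattice counts to
    volumes; hence the arguments \<open>t + 2 * \<delta> j\<close> and
    \<open>t + - 2 * \<delta> j\<close> below.\<close>
  define \<delta> where "\<delta> j = e j * CARD('d) / 2" for j
  have e: "0 < e j" for j by (simp add: e_def)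
  let ?V = "\<lambda>j u n \<omega>. clique_sum w (\<lambda>a b. grid_adj (e j) u (grid_label (side (e j) n) a) (grid_label (side (e j) n) b)) (P n \<omega>)"
  let ?l = "\<lambda>j u. \<Sum>k. weight w k *
        (grid_volume TYPE('d) (e j) u k *
         power_moment f k)"
  \<comment> \<open>The mesh runs through a sequence, so the exceptional null sets of all
    \<open>j\<close> form one null set. The values \<open>c = 1\<close> and \<open>c = - 1\<close>
    give the upper and the lower count.\<close>
  have V: "AE \<omega> in M. \<forall>j. (\<lambda>n. ?V j (t + c * \<delta> j) n \<omega> / real n) \<longlonglongrightarrow> ?l j (t + c * \<delta> j)" for c
    unfolding AE_all_countable by (intro allI grid_clique_sum_tendsto(2)[OF e w])
  have cont: "isCont (density_limit w) t" by (rule isCont_density_limit[OF w])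
  have "(\<lambda>j. c * \<delta> j) \<longlonglongrightarrow> 0" for c
  proof -
    have "(\<lambda>j. c * (inverse (real (Suc j)) * (real CARD('d) / 2))) \<longlonglongrightarrow> c * (0 * (real CARD('d) / 2))"
      by (intro tendsto_intros LIMSEQ_inverse_real_of_nat)
    then show ?thesis by (simp add: \<delta>_def e_def field_simps)
  qed
  then have "(\<lambda>j. t + c * \<delta> j) \<longlonglongrightarrow> t + 0" for c by (intro tendsto_intros)
  then have "(\<lambda>j. t + c * \<delta> j) \<longlonglongrightarrow> t" for c by simp
  then have lim: "(\<lambda>j. density_limit w (t + c * \<delta> j)) \<longlonglongrightarrow> density_limit w t" for c
    by (rule isCont_tendsto_compose[OF cont])
  show ?thesis
    using V[of 1] V[of "- 1"] AE_finite_points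
  proof eventually_elim
    case (elim \<omega>)
    show ?case
    proof (rule order_tendstoI)
      fix x assume x: "density_limit w t < x"
      then have "\<forall>\<^sub>F j in sequentially. density_limit w (t + 2 * \<delta> j) < x" using lim by (intro order_tendstoD)
      then obtain j where j: "density_limit w (t + 2 * \<delta> j) < x" by (auto simp: eventually_sequentially)
      have "?l j (t + \<delta> j) \<le> density_limit w (t + 2 * \<delta> j)"
        by (rule rips_limit_grid_bounds(2)[OF w density_moments e grid_clique_sum_tendsto(1)[OF e w]]) (simp add: \<delta>_def)
      then have "?l j (t + 1 * \<delta> j) < x" using j by simp
      then have "\<forall>\<^sub>F n in sequentially. ?V j (t + 1 * \<delta> j) n \<omega> / real n < x"
        using elim(1) by (intro order_tendstoD(2)[of _ "?l j (t + 1 * \<delta> j)"]) blast+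
      then show "\<forall>\<^sub>F n in sequentially. rips_sum w n t \<omega> / real n < x"
        using elim(3) eventually_ge_at_top[of 1]
      proof eventually_elim
        case (elim n)
        have "rips_sum w n t \<omega> \<le> ?V j (t + 1 * \<delta> j) n \<omega>"
        proof (rule clique_sum_mono[OF elim(2) w(1)])
          fix a b :: "real ^ 'd" assume "dist a b \<le> 2 * (s n * t)"
          then show "grid_adj (e j) (t + 1 * \<delta> j) (grid_label (side (e j) n) a) (grid_label (side (e j) n) b)"
            using grid_adj_of_dist[OF e s(1)[OF elim(3)], of a b t j "t + 1 * \<delta> j"] elim(3) by (simp add: side_def \<delta>_def)
        qed
        then have "rips_sum w n t \<omega> / real n \<le> ?V j (t + 1 * \<delta> j) n \<omega> / real n" by (intro divide_right_mono) auto
        then show ?case using elim(1) by linarith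
      qed
    next
      fix x assume x: "x < density_limit w t"
      then have "\<forall>\<^sub>F j in sequentially. x < density_limit w (t + - 2 * \<delta> j)" using lim by (intro order_tendstoD)
      then obtain j where j: "x < density_limit w (t + - 2 * \<delta> j)" by (auto simp: eventually_sequentially)
      have "density_limit w (t + - 2 * \<delta> j) \<le> ?l j (t + - 1 * \<delta> j)"
        by (rule rips_limit_grid_bounds(1)[OF w density_moments e grid_clique_sum_tendsto(1)[OF e w]]) (simp add: \<delta>_def)
      then have "x < ?l j (t + - 1 * \<delta> j)" using j by simp
      then have "\<forall>\<^sub>F n in sequentially. x < ?V j (t + - 1 * \<delta> j) n \<omega> / real n"
        using elim(2) by (intro order_tendstoD(1)[of _ "?l j (t + - 1 * \<delta> j)"]) blast+
      then show "\<forall>\<^sub>F n in sequentially. x < rips_sum w n t \<omega> / real n"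
        using elim(3) eventually_ge_at_top[of 1]
      proof eventually_elim
        case (elim n)
        have "?V j (t + - 1 * \<delta> j) n \<omega> \<le> rips_sum w n t \<omega>"
        proof (rule clique_sum_mono[OF elim(2) w(1)])
          fix a b :: "real ^ 'd" assume "grid_adj (e j) (t + - 1 * \<delta> j) (grid_label (side (e j) n) a) (grid_label (side (e j) n) b)"
          then show "dist a b \<le> 2 * (s n * t)"
            using dist_of_grid_adj[OF e s(1)[OF elim(3)], of j "t + - 1 * \<delta> j" a b t] elim(3) by (simp add: side_def \<delta>_def)
        qed
        then have "?V j (t + - 1 * \<delta> j) n \<omega> / real n \<le> rips_sum w n t \<omega> / real n" by (intro divide_right_mono) auto
        then show ?case using elim(1) by linarith
      qed
    qed
  qed
qed

end

text \<open>Between neighbouring points of a fine finite net, monotonicity encloses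
  \<open>F n t\<close> by the values at the two ends, while \<open>L\<close> varies by less than
  \<open>\<eta> / 2\<close>. The nets are equidistant so that all of them together use only
  countably many points.\<close>

lemma monotone_tendsto_uniformly:
  fixes F :: "nat \<Rightarrow> real \<Rightarrow> real"
  assumes mono: "\<forall>\<^sub>F n in sequentially. \<forall>x y. x \<le> y \<longrightarrow> F n x \<le> F n y"
    and L: "\<And>x. isCont L x" and T: "0 < T"
    and lim: "\<And>i j. (\<lambda>n. F n (T * real i / real (Suc j))) \<longlonglongrightarrow> L (T * real i / real (Suc j))"
    and \<eta>: "0 < \<eta>"
  shows "\<forall>\<^sub>F n in sequentially. \<forall>t\<in>{0..T}. \<bar>F n t - L t\<bar> \<le> \<eta>"
proof -
  have "uniformly_continuous_on {0..T} L"
    using L by (intro compact_uniformly_continuous continuous_at_imp_continuous_on) auto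
  then obtain d where d: "0 < d" "\<And>x y. x \<in> {0..T} \<Longrightarrow> y \<in> {0..T} \<Longrightarrow> dist y x < d \<Longrightarrow> dist (L y) (L x) < \<eta> / 2"
    unfolding uniformly_continuous_on_def using \<eta> by (meson half_gt_zero)
  obtain j where j: "T / d < real (Suc j)" 
  proof -
    obtain j :: nat where "T / d < real j" using reals_Archimedean2 by blast
    then show thesis by (intro that[of j]) simp
  qed
  define p where "p i = T * real i / real (Suc j)" for i
  have "\<forall>\<^sub>F n in sequentially. \<bar>F n (p i) - L (p i)\<bar> < \<eta> / 2" for i
    using lim[of i j] \<eta> unfolding p_def tendsto_iff dist_real_def by (meson half_gt_zero)
  then have "\<forall>\<^sub>F n in sequentially. \<forall>i\<in>{..Suc j}. \<bar>F n (p i) - L (p i)\<bar> < \<eta> / 2"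
    by (intro eventually_ball_finite) auto
  with mono show ?thesis
  proof eventually_elim
    case (elim n)
    show ?case
    proof
      fix t assume t: "t \<in> {0..T}"
      \<comment> \<open>At \<open>t = T\<close> the floor would give \<open>i = j + 1\<close>, whose
        right neighbour lies beyond the net, so the last interval is taken instead.\<close>
      obtain i where i: "i \<le> j" "p i \<le> t" "t \<le> p (Suc i)"
      proof (cases "t = T")
        case True
        then show ?thesis using T by (intro that[of j]) (auto simp: p_def field_simps)
      next
        case False
        define i where "i = nat \<lfloor>t * real (Suc j) / T\<rfloor>"
        have nn: "0 \<le> t * real (Suc j) / T" using t T by auto
        have "t < T" using t False by simp
        then have "t * real (Suc j) < T * real (Suc j)" by (intro mult_strict_right_mono) auto
        then have "t * real (Suc j) / T < real (Suc j)" using T by (simp add: divide_less_eq mult.commute)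
        then have "i \<le> j" unfolding i_def using nn by linarith
        moreover have "real i \<le> t * real (Suc j) / T" "t * real (Suc j) / T \<le> real (Suc i)"
          unfolding i_def using nn by linarith+
        then have "p i \<le> t" "t \<le> p (Suc i)" using T by (auto simp: p_def field_simps)
        ultimately show ?thesis by (rule that)
      qed
      have p: "p k \<in> {0..T}" if "k \<le> Suc j" for k
        using that T mult_left_mono[of "real k" "real (Suc j)" T] by (simp add: p_def divide_le_eq)
      have "p (Suc i) - p i = T / real (Suc j)"
        unfolding p_def diff_divide_distrib[symmetric] by (simp add: algebra_simps)
      also have "\<dots> < d" using j d T by (simp add: field_simps)
      finally have gap: "p (Suc i) - p i < d" .
      have "dist (L (p (Suc i))) (L t) < \<eta> / 2" "dist (L (p i)) (L t) < \<eta> / 2"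
        using d(2)[OF t p[of "Suc i"]] d(2)[OF t p[of i]] i gap by (auto simp: dist_real_def)
      moreover have "\<bar>F n (p i) - L (p i)\<bar> < \<eta> / 2" "\<bar>F n (p (Suc i)) - L (p (Suc i))\<bar> < \<eta> / 2"
        using elim(2) i by auto
      moreover have "F n (p i) \<le> F n t" "F n t \<le> F n (p (Suc i))" using elim(1) i by auto
      ultimately show "\<bar>F n t - L t\<bar> \<le> \<eta>" unfolding dist_real_def by linarith
    qed
  qed
qed

context critical_poisson
begin

text \<open>Pointwise almost sure convergence holds simultaneously at the countably many net points;
  monotonicity in the radius then covers all \<open>t\<close> outside that one null set.\<close>

lemma rips_sum_tendsto_uniformly:
  assumes w: "\<And>n. 0 \<le> w n" "\<And>n. w n \<le> 1" and T: "0 < T"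
  shows "AE \<omega> in M. \<forall>\<eta>>0. \<forall>\<^sub>F n in sequentially. \<forall>t\<in>{0..T}. \<bar>rips_sum w n t \<omega> / real n - density_limit w t\<bar> \<le> \<eta>"
proof -
  have "AE \<omega> in M. \<forall>i j. (\<lambda>n. rips_sum w n (T * real i / real (Suc j)) \<omega> / real n) \<longlonglongrightarrow>
    density_limit w (T * real i / real (Suc j))"
    unfolding AE_all_countable by (intro allI rips_sum_tendsto w)
  then show ?thesis using AE_finite_points
  proof eventually_elim
    case (elim \<omega>)
    have "\<forall>\<^sub>F n in sequentially. \<forall>x y. x \<le> y \<longrightarrow> rips_sum w n x \<omega> / real n \<le> rips_sum w n y \<omega> / real n"
      using elim(2) eventually_ge_at_top[of 1]
    proof eventually_elim
      case (elim n)
      show ?case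
      proof (intro allI impI divide_right_mono clique_sum_mono elim w)
        fix x y :: real and a b :: "real ^ 'd" assume "x \<le> y" "dist a b \<le> 2 * (s n * x)"
        moreover from this have "s n * x \<le> s n * y" using s(1)[OF elim(2)] by (intro mult_left_mono) auto
        ultimately show "dist a b \<le> 2 * (s n * y)" by linarith
      qed simp
    qed
    then show ?case
      using elim(1) T isCont_density_limit[of w, OF w]
      by (intro allI impI monotone_tendsto_uniformly) auto
  qed
qed

text \<open>Each parity weight annihilates the terms of the other parity, and both parity series
  converge on their own, so the alternating series may be split.\<close>

lemma alternating_psi_sum:
  "(\<Sum>k. (-1) ^ k * psi f (k + 1) k k t t) =
    density_limit (\<lambda>n. of_bool (odd n)) t - density_limit (\<lambda>n. of_bool (even n)) t"
proof -
  let ?a = "\<lambda>w k. weight w k * (rips_volume TYPE(real ^ 'd) k t * power_moment f k)"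
  have "(-1) ^ k * psi f (k + 1) k k t t = ?a (\<lambda>n. of_bool (odd n)) k - ?a (\<lambda>n. of_bool (even n)) k" for k
    unfolding psi_eq_rips_volume by (cases "even k") (auto simp del: fact_Suc)
  then have "(\<Sum>k. (-1) ^ k * psi f (k + 1) k k t t) =
    (\<Sum>k. ?a (\<lambda>n. of_bool (odd n)) k - ?a (\<lambda>n. of_bool (even n)) k)" by simp
  also have "\<dots> = (\<Sum>k. ?a (\<lambda>n. of_bool (odd n)) k) - (\<Sum>k. ?a (\<lambda>n. of_bool (even n)) k)"
    by (intro suminf_diff[symmetric] rips_limit_summable[where C=C and m="power_moment f"]
        density_moments) simp_all
  finally show ?thesis by (simp add: rips_limit_def)
qed

lemma euler_char_tendsto_uniformly:
  assumes T: "0 < T"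
  shows "AE \<omega> in M. (\<lambda>n. SUP t\<in>{0..T}. ereal \<bar>euler_char (s n * t) (P n \<omega>) / real n
    - (\<Sum>k. (-1) ^ k * psi f (k + 1) k k t t)\<bar>) \<longlonglongrightarrow> 0"
proof -
  have "AE \<omega> in M. \<forall>\<eta>>0. \<forall>\<^sub>F n in sequentially. \<forall>t\<in>{0..T}.
      \<bar>rips_sum (\<lambda>n. of_bool (odd n)) n t \<omega> / real n - density_limit (\<lambda>n. of_bool (odd n)) t\<bar> \<le> \<eta>"
    "AE \<omega> in M. \<forall>\<eta>>0. \<forall>\<^sub>F n in sequentially. \<forall>t\<in>{0..T}.
      \<bar>rips_sum (\<lambda>n. of_bool (even n)) n t \<omega> / real n - density_limit (\<lambda>n. of_bool (even n)) t\<bar> \<le> \<eta>"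
    by (rule rips_sum_tendsto_uniformly; simp add: T)+
  then show ?thesis using AE_finite_points
  proof eventually_elim
    case (elim \<omega>)
    let ?S = "\<lambda>n. SUP t\<in>{0..T}. ereal \<bar>euler_char (s n * t) (P n \<omega>) / real n - (\<Sum>k. (-1) ^ k * psi f (k + 1) k k t t)\<bar>"
    have pos: "0 \<le> ?S n" for n
      by (rule SUP_upper2[of 0]) (use T in auto)
    \<comment> \<open>The tolerance is shared between the two parities; eventual finiteness of
      \<open>P n \<omega>\<close> justifies splitting \<open>euler_char\<close>.\<close>
    have small: "\<forall>\<^sub>F n in sequentially. ?S n \<le> ereal \<eta>" if \<eta>: "0 < \<eta>" for \<eta>
    proof -
      have "0 < \<eta> / 2" using \<eta> by simp
      from elim(1)[rule_format, OF this] elim(2)[rule_format, OF this] elim(3)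
      show ?thesis
      proof eventually_elim
        case (elim n)
        show ?case
        proof (intro SUP_least)
          fix t assume t: "t \<in> {0..T}"
          have "\<bar>rips_sum (\<lambda>n. of_bool (odd n)) n t \<omega> / real n - density_limit (\<lambda>n. of_bool (odd n)) t\<bar> \<le> \<eta> / 2"
            "\<bar>rips_sum (\<lambda>n. of_bool (even n)) n t \<omega> / real n - density_limit (\<lambda>n. of_bool (even n)) t\<bar> \<le> \<eta> / 2"
            using elim(1,2) t by auto
          then show "ereal \<bar>euler_char (s n * t) (P n \<omega>) / real n - (\<Sum>k. (-1) ^ k * psi f (k + 1) k k t t)\<bar> \<le> ereal \<eta>"
            unfolding euler_char_eq_clique_sum[OF elim(3)] alternating_psi_sum diff_divide_distrib ereal_less_eq
            by linarith
        qed
      qed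
    qed
    show ?case
    proof (rule order_tendstoI)
      fix x :: ereal assume "x < 0"
      then show "\<forall>\<^sub>F n in sequentially. x < ?S n" using pos by (intro always_eventually allI) (rule less_le_trans)
    next
      fix x :: ereal assume "0 < x"
      then obtain \<eta> where "0 < ereal \<eta>" "ereal \<eta> < x" using ereal_dense2 by blast
      then show "\<forall>\<^sub>F n in sequentially. ?S n < x" using small[of \<eta>] by (auto elim!: eventually_mono)
    qed
  qed
qed

end

theorem theorem3p2:
  fixes f :: "real ^ 'd \<Rightarrow> real"
    and M :: "'w measure"
    and P :: "nat \<Rightarrow> 'w \<Rightarrow> (real ^ 'd) set"
    and s :: "nat \<Rightarrow> real"
    and T :: real
  assumes "f \<in> borel_measurable borel"
    and "\<And>x. 0 \<le> f x"
    and "(\<integral>\<^sup>+ x. ennreal (f x) \<partial>lborel) = 1"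
    and "esssup lborel (\<lambda>x. ereal (f x)) < \<infinity>"
    and "prob_space M"
    and "\<And>n. n \<ge> 1 \<Longrightarrow>
           poisson_point_process M (density lborel (\<lambda>x. ennreal (real n * f x))) (P n)"
    and "\<And>n. n \<ge> 1 \<Longrightarrow> 0 < s n"
    and "s \<longlonglongrightarrow> 0"
    and "(\<lambda>n. real n * s n ^ CARD('d)) \<longlonglongrightarrow> 1"
    and "0 < T"
  shows "AE \<omega> in M.
           (\<lambda>n. SUP t\<in>{0..T}. ereal \<bar>euler_char (s n * t) (P n \<omega>) / real n
                                      - (\<Sum>k. (-1) ^ k * psi f (k + 1) k k t t)\<bar>) \<longlonglongrightarrow> 0"
proof -
  have i: "integrable lborel f \<and> (\<integral>x. f x \<partial>lborel) = 1"
    using assms(1-3) by (subst nn_integral_eq_integrable[symmetric]) auto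
  \<comment> \<open>The essential supremum becomes the constant \<open>C\<close>. The value minus
    infinity would contradict the inequality at any point where it holds.\<close>
  have "AE x in lborel. f x \<le> real_of_ereal (esssup lborel (\<lambda>x. ereal (f x)))"
    using esssup_AE[of "\<lambda>x. ereal (f x)" lborel]
  proof eventually_elim
    case (elim x)
    then show ?case using assms(4) by (cases "esssup lborel (\<lambda>x. ereal (f x))") auto
  qed
  then have "critical_poisson M f (real_of_ereal (esssup lborel (\<lambda>x. ereal (f x)))) P s"
    using assms i by (intro critical_poisson.intro critical_poisson_axioms.intro) auto
  then show ?thesis using assms(10) by (rule critical_poisson.euler_char_tendsto_uniformly)
qed

end
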